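(* Let $k$ be a field, let $\mathcal{C}$ be a (skeletally small) $k$-linear category with center $Z(\mathcal{C})=k$, and let $G$ be a group with a $k$-linear $G$-action $\{F_g,\varepsilon_{g,h}\mid g,h\in G\}$ on $\mathcal{C}$. Then there is an exact sequence of groups $$1\longrightarrow\widehat{G}\stackrel{\rho}\longrightarrow{\rm Aut}(\mathcal{C};G)\stackrel{\phi}\longrightarrow{\rm Aut}^G(\mathcal{C})\stackrel{\sigma}\longrightarrow H^2(G,k^* ),$$ where $\phi$ is the forgetful homomorphism and $\sigma$ is the obstruction homomorphism of the given $G$-action.
   Context: All functors are $k$-linear. $Z(\mathcal{C})$ is the $k$-algebra of natural transformations ${\rm Id}_\mathcal{C}\to{\rm Id}_\mathcal{C}$. A $k$-linear $G$-action consists of $k$-linear autoequivalences $F_g$ and natural isomorphisms $\varepsilon_{g,h}\colon F_gF_h\to F_{gh}$ with $\varepsilon_{gh,l}\circ\varepsilon_{g,h}F_l=\varepsilon_{g,hl}\circ F_g\varepsilon_{h,l}$. $\widehat{G}={\rm Hom}(G,k^* )$. $H^2(G,k^* )$ is group cohomology with trivial action on $k^*$. ${\rm Aut}(\mathcal{C})$ is the group of isoclasses $[F]$ of $k$-linear autoequivalences of $\mathcal{C}$, and ${\rm Aut}^G(\mathcal{C})=\{[F]\in{\rm Aut}(\mathcal{C})\mid[FF_g]=[F_gF]\text{ for each }g\in G\}$. ${\rm Aut}(\mathcal{C};G)$ is the group of isoclasses $[F,\delta]$ of $k$-linear $G$-equivariant autoequivalences: $F$ is an autoequivalence and $\delta_g\colon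 FF_g\to F_gF$ are natural isomorphisms with $\delta_{gh}\circ F\varepsilon_{g,h}=\varepsilon_{g,h}F\circ F_g\delta_h\circ\delta_gF_h$; isomorphisms $(F,\delta)\to(F',\delta')$ are natural isomorphisms $\phi\colon F\to F'$ with $F_g\phi\circ\delta_g=\delta'_g\circ\phi F_g$; the product is $(F,\delta)(F',\delta')=(FF',(\delta_gF'\circ F\delta'_g)_g)$. $\rho$ sends $\chi$ to $[{\rm Id}_\mathcal{C},(\chi(g){\rm Id}_{F_g})_{g\in G}]$. $\phi$ sends $[F,\delta]$ to $[F]$. $\sigma$ sends $[F]$ to the class $[\sigma_F]$, where one chooses natural isomorphisms $\delta_g\colon FF_g\to F_gF$ for $g\in G$ and $\sigma_F(g,h)\in k^*$ is the unique scalar with $\delta_{gh}\circ F\varepsilon_{g,h}=\sigma_F(g,h)\,\varepsilon_{g,h}F\circ F_g\delta_h\circ\delta_gF_h$; $\sigma_F$ is a $2$-cocycle whose class is independent of the choices, and $\sigma$ is a group homomorphism. *)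

theory Defs
  imports "HOL-Algebra.Module" "HOL-Algebra.QuotRing" "HOL-Algebra.Product_Groups"
begin

section \<open>Linear categories\<close>

text \<open>
  Each \<open>Hom C X Y\<close> is a module over the scalars.  It is packaged in the library's \<^type>\<open>module\<close>
  record; the multiplication and unit which that record inherits from rings play no role.
  \<open>g \<cdot>\<^bsub>C\<^esub> f\<close> is composition in the usual order (first \<open>f\<close>, then \<open>g\<close>).
  All categories are small, with objects forming a set over an arbitrary type.
\<close>

record ('k, 'o, 'm) lincat =
  Obj :: "'o set"
  Hom :: "'o \<Rightarrow> 'o \<Rightarrow> ('k, 'm) module"
  Ident :: "'o \<Rightarrow> 'm"
  Comp :: "'m \<Rightarrow> 'm \<Rightarrow> 'm"  (infixl \<open>\<cdot>\<index>\<close> 70)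

text \<open>
  As usual for categories whose arrows have a well-defined source and target, distinct hom-sets
  are disjoint; this is what allows \<^const>\<open>Comp\<close> to be written without object arguments.
\<close>

locale linear_category = cring K
  for K :: "('k, 'r) ring_scheme" (structure) +
  fixes C :: "('k, 'o, 'm) lincat"
  assumes Hom_module: "\<lbrakk>X \<in> Obj C; Y \<in> Obj C\<rbrakk> \<Longrightarrow> module K (Hom C X Y)"
    and Hom_disjoint:
      "\<lbrakk>X \<in> Obj C; Y \<in> Obj C; X' \<in> Obj C; Y' \<in> Obj C;
        f \<in> carrier (Hom C X Y); f \<in> carrier (Hom C X' Y')\<rbrakk> \<Longrightarrow> X = X' \<and> Y = Y'"
    and Ident_closed: "X \<in> Obj C \<Longrightarrow> Ident C X \<in> carrier (Hom C X X)"
    and Comp_closed: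
      "\<lbrakk>X \<in> Obj C; Y \<in> Obj C; Z \<in> Obj C; f \<in> carrier (Hom C X Y); g \<in> carrier (Hom C Y Z)\<rbrakk>
        \<Longrightarrow> g \<cdot>\<^bsub>C\<^esub> f \<in> carrier (Hom C X Z)"
    and Ident_left:
      "\<lbrakk>X \<in> Obj C; Y \<in> Obj C; f \<in> carrier (Hom C X Y)\<rbrakk> \<Longrightarrow> Ident C Y \<cdot>\<^bsub>C\<^esub> f = f"
    and Ident_right:
      "\<lbrakk>X \<in> Obj C; Y \<in> Obj C; f \<in> carrier (Hom C X Y)\<rbrakk> \<Longrightarrow> f \<cdot>\<^bsub>C\<^esub> Ident C X = f"
    and Comp_assoc:
      "\<lbrakk>W \<in> Obj C; X \<in> Obj C; Y \<in> Obj C; Z \<in> Obj C;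
        f \<in> carrier (Hom C W X); g \<in> carrier (Hom C X Y); h \<in> carrier (Hom C Y Z)\<rbrakk>
        \<Longrightarrow> (h \<cdot>\<^bsub>C\<^esub> g) \<cdot>\<^bsub>C\<^esub> f = h \<cdot>\<^bsub>C\<^esub> (g \<cdot>\<^bsub>C\<^esub> f)"
    and Comp_add_left:
      "\<lbrakk>X \<in> Obj C; Y \<in> Obj C; Z \<in> Obj C; f \<in> carrier (Hom C X Y);
        g \<in> carrier (Hom C Y Z); g' \<in> carrier (Hom C Y Z)\<rbrakk>
        \<Longrightarrow> (g \<oplus>\<^bsub>Hom C Y Z\<^esub> g') \<cdot>\<^bsub>C\<^esub> f = g \<cdot>\<^bsub>C\<^esub> f \<oplus>\<^bsub>Hom C X Z\<^esub> g' \<cdot>\<^bsub>C\<^esub> f"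
    and Comp_add_right:
      "\<lbrakk>X \<in> Obj C; Y \<in> Obj C; Z \<in> Obj C; f \<in> carrier (Hom C X Y);
        f' \<in> carrier (Hom C X Y); g \<in> carrier (Hom C Y Z)\<rbrakk>
        \<Longrightarrow> g \<cdot>\<^bsub>C\<^esub> (f \<oplus>\<^bsub>Hom C X Y\<^esub> f') = g \<cdot>\<^bsub>C\<^esub> f \<oplus>\<^bsub>Hom C X Z\<^esub> g \<cdot>\<^bsub>C\<^esub> f'"
    and Comp_smult_left:
      "\<lbrakk>X \<in> Obj C; Y \<in> Obj C; Z \<in> Obj C; a \<in> carrier K;
        f \<in> carrier (Hom C X Y); g \<in> carrier (Hom C Y Z)\<rbrakk>
        \<Longrightarrow> (a \<odot>\<^bsub>Hom C Y Z\<^esub> g) \<cdot>\<^bsub>C\<^esub> f = a \<odot>\<^bsub>Hom C X Z\<^esub> (g \<cdot>\<^bsub>C\<^esub> f)"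
    and Comp_smult_right:
      "\<lbrakk>X \<in> Obj C; Y \<in> Obj C; Z \<in> Obj C; a \<in> carrier K;
        f \<in> carrier (Hom C X Y); g \<in> carrier (Hom C Y Z)\<rbrakk>
        \<Longrightarrow> g \<cdot>\<^bsub>C\<^esub> (a \<odot>\<^bsub>Hom C X Y\<^esub> f) = a \<odot>\<^bsub>Hom C X Z\<^esub> (g \<cdot>\<^bsub>C\<^esub> f)"

definition is_iso :: "('k, 'o, 'm) lincat \<Rightarrow> 'o \<Rightarrow> 'o \<Rightarrow> 'm \<Rightarrow> bool" where
  "is_iso C X Y f \<longleftrightarrow> f \<in> carrier (Hom C X Y) \<and>
     (\<exists>g \<in> carrier (Hom C Y X). g \<cdot>\<^bsub>C\<^esub> f = Ident C X \<and> f \<cdot>\<^bsub>C\<^esub> g = Ident C Y)"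


section \<open>Linear endofunctors and natural transformations\<close>

record ('o, 'm) endofunctor =
  ob :: "'o \<Rightarrow> 'o"
  ar :: "'m \<Rightarrow> 'm"

definition linear_functor ::
    "('k, 'r) ring_scheme \<Rightarrow> ('k, 'o, 'm) lincat \<Rightarrow> ('o, 'm) endofunctor \<Rightarrow> bool" where
  "linear_functor K C F \<longleftrightarrow>
     (\<forall>X \<in> Obj C. ob F X \<in> Obj C \<and> ar F (Ident C X) = Ident C (ob F X)) \<and>
     (\<forall>X \<in> Obj C. \<forall>Y \<in> Obj C. \<forall>f \<in> carrier (Hom C X Y).
        ar F f \<in> carrier (Hom C (ob F X) (ob F Y))) \<and>
     (\<forall>X \<in> Obj C. \<forall>Y \<in> Obj C. \<forall>Z \<in> Obj C. \<forall>f \<in> carrier (Hom C X Y). \<forall>g \<in> carrier (Hom C Y Z).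
        ar F (g \<cdot>\<^bsub>C\<^esub> f) = ar F g \<cdot>\<^bsub>C\<^esub> ar F f) \<and>
     (\<forall>X \<in> Obj C. \<forall>Y \<in> Obj C. \<forall>f \<in> carrier (Hom C X Y). \<forall>f' \<in> carrier (Hom C X Y).
        ar F (f \<oplus>\<^bsub>Hom C X Y\<^esub> f') = ar F f \<oplus>\<^bsub>Hom C (ob F X) (ob F Y)\<^esub> ar F f') \<and>
     (\<forall>X \<in> Obj C. \<forall>Y \<in> Obj C. \<forall>a \<in> carrier K. \<forall>f \<in> carrier (Hom C X Y).
        ar F (a \<odot>\<^bsub>Hom C X Y\<^esub> f) = a \<odot>\<^bsub>Hom C (ob F X) (ob F Y)\<^esub> ar F f)"

definition id_functor :: "('o, 'm) endofunctor" where
  "id_functor = \<lparr>ob = (\<lambda>X. X), ar = (\<lambda>f. f)\<rparr>"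

definition fcomp :: "('o, 'm) endofunctor \<Rightarrow> ('o, 'm) endofunctor \<Rightarrow> ('o, 'm) endofunctor"
    (infixl \<open>\<bullet>\<close> 75) where
  "F \<bullet> F' = \<lparr>ob = (\<lambda>X. ob F (ob F' X)), ar = (\<lambda>f. ar F (ar F' f))\<rparr>"

text \<open>
  A natural transformation is a family of arrows indexed by objects.  Its values outside the set
  of objects are unconstrained, so two of them are compared with \<open>nt_eq\<close>.
\<close>

definition nat_trans ::
    "('k, 'o, 'm) lincat \<Rightarrow> ('o, 'm) endofunctor \<Rightarrow> ('o, 'm) endofunctor \<Rightarrow> ('o \<Rightarrow> 'm) \<Rightarrow> bool" where
  "nat_trans C F F' \<alpha> \<longleftrightarrow>
     (\<forall>X \<in> Obj C. \<alpha> X \<in> carrier (Hom C (ob F X) (ob F' X))) \<and>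
     (\<forall>X \<in> Obj C. \<forall>Y \<in> Obj C. \<forall>f \<in> carrier (Hom C X Y). \<alpha> Y \<cdot>\<^bsub>C\<^esub> ar F f = ar F' f \<cdot>\<^bsub>C\<^esub> \<alpha> X)"

definition nat_iso ::
    "('k, 'o, 'm) lincat \<Rightarrow> ('o, 'm) endofunctor \<Rightarrow> ('o, 'm) endofunctor \<Rightarrow> ('o \<Rightarrow> 'm) \<Rightarrow> bool" where
  "nat_iso C F F' \<alpha> \<longleftrightarrow>
     nat_trans C F F' \<alpha> \<and> (\<forall>X \<in> Obj C. is_iso C (ob F X) (ob F' X) (\<alpha> X))"

definition nt_eq :: "('k, 'o, 'm) lincat \<Rightarrow> ('o \<Rightarrow> 'm) \<Rightarrow> ('o \<Rightarrow> 'm) \<Rightarrow> bool" where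
  "nt_eq C \<alpha> \<beta> \<longleftrightarrow> (\<forall>X \<in> Obj C. \<alpha> X = \<beta> X)"

definition nt_id :: "('k, 'o, 'm) lincat \<Rightarrow> ('o, 'm) endofunctor \<Rightarrow> 'o \<Rightarrow> 'm" where
  "nt_id C F = (\<lambda>X. Ident C (ob F X))"

definition nt_comp :: "('k, 'o, 'm) lincat \<Rightarrow> ('o \<Rightarrow> 'm) \<Rightarrow> ('o \<Rightarrow> 'm) \<Rightarrow> 'o \<Rightarrow> 'm"
    (infixr \<open>\<circ>\<index>\<close> 65) where
  "\<beta> \<circ>\<^bsub>C\<^esub> \<alpha> = (\<lambda>X. \<beta> X \<cdot>\<^bsub>C\<^esub> \<alpha> X)"

text \<open>The whiskerings \<open>F\<alpha>\<close> (written \<open>F \<rhd> \<alpha>\<close>) and \<open>\<alpha>F\<close> (written \<open>\<alpha> \<lhd>\<^sub>w F\<close>).\<close>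

definition whisker_left :: "('o, 'm) endofunctor \<Rightarrow> ('o \<Rightarrow> 'm) \<Rightarrow> 'o \<Rightarrow> 'm"  (infixr \<open>\<rhd>\<close> 75) where
  "F \<rhd> \<alpha> = (\<lambda>X. ar F (\<alpha> X))"

definition whisker_right :: "('o \<Rightarrow> 'm) \<Rightarrow> ('o, 'm) endofunctor \<Rightarrow> 'o \<Rightarrow> 'm"  (infixl \<open>\<lhd>\<^sub>w\<close> 75) where
  "\<alpha> \<lhd>\<^sub>w F = (\<lambda>X. \<alpha> (ob F X))"

text \<open>The scalar multiple of a natural transformation from \<open>F\<close> to \<open>F'\<close>.\<close>

definition nt_smult ::
    "('k, 'o, 'm) lincat \<Rightarrow> ('o, 'm) endofunctor \<Rightarrow> ('o, 'm) endofunctor \<Rightarrow> 'k \<Rightarrow> ('o \<Rightarrow> 'm) \<Rightarrow> 'o \<Rightarrow> 'm"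
  where "nt_smult C F F' a \<alpha> = (\<lambda>X. a \<odot>\<^bsub>Hom C (ob F X) (ob F' X)\<^esub> \<alpha> X)"


section \<open>The center\<close>

text \<open>
  Here natural transformations are made extensional, so that equality in the algebra is equality
  of natural transformations.
\<close>

definition center :: "('k, 'o, 'm) lincat \<Rightarrow> ('k, 'o \<Rightarrow> 'm) module" where
  "center C =
     \<lparr>carrier = {\<alpha> \<in> extensional (Obj C). nat_trans C id_functor id_functor \<alpha>},
      mult = (\<lambda>\<alpha> \<beta>. \<lambda>X \<in> Obj C. \<alpha> X \<cdot>\<^bsub>C\<^esub> \<beta> X),
      one = (\<lambda>X \<in> Obj C. Ident C X),
      zero = (\<lambda>X \<in> Obj C. \<zero>\<^bsub>Hom C X X\<^esub>),
      add = (\<lambda>\<alpha> \<beta>. \<lambda>X \<in> Obj C. \<alpha> X \<oplus>\<^bsub>Hom C X X\<^esub> \<beta> X),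
      smult = (\<lambda>a \<alpha>. \<lambda>X \<in> Obj C. a \<odot>\<^bsub>Hom C X X\<^esub> \<alpha> X)\<rparr>"

text \<open>\<open>Z(C) = k\<close> means that the structure map of the \<open>k\<close>-algebra \<open>Z(C)\<close> is an isomorphism.\<close>

definition center_is_scalars :: "('k, 'r) ring_scheme \<Rightarrow> ('k, 'o, 'm) lincat \<Rightarrow> bool" where
  "center_is_scalars K C \<longleftrightarrow>
     (\<lambda>a. a \<odot>\<^bsub>center C\<^esub> \<one>\<^bsub>center C\<^esub>) \<in> ring_iso K (center C)"


section \<open>The group of autoequivalences up to isomorphism\<close>

definition autoequivalences ::
    "('k, 'r) ring_scheme \<Rightarrow> ('k, 'o, 'm) lincat \<Rightarrow> ('o, 'm) endofunctor set" where
  "autoequivalences K C = {F. linear_functor K C F \<and>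
     (\<exists>F'. linear_functor K C F' \<and>
        (\<exists>\<eta>. nat_iso C id_functor (F' \<bullet> F) \<eta>) \<and> (\<exists>\<theta>. nat_iso C (F \<bullet> F') id_functor \<theta>))}"

definition functor_iso_rel ::
    "('k, 'r) ring_scheme \<Rightarrow> ('k, 'o, 'm) lincat \<Rightarrow> ('o, 'm) endofunctor rel" where
  "functor_iso_rel K C = {(F, F'). F \<in> autoequivalences K C \<and> F' \<in> autoequivalences K C \<and>
     (\<exists>\<alpha>. nat_iso C F F' \<alpha>)}"

definition iso_class ::
    "('k, 'r) ring_scheme \<Rightarrow> ('k, 'o, 'm) lincat \<Rightarrow> ('o, 'm) endofunctor \<Rightarrow> ('o, 'm) endofunctor set"
  where "iso_class K C F = functor_iso_rel K C `` {F}"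

text \<open>
  Operations on isoclasses are defined, here and below, as the union over all representatives of
  the resulting isoclasses (as in \<^theory>\<open>HOL.Equiv_Relations\<close>).  The union is a single class
  precisely when the operation does not depend on the choices.
\<close>

definition Aut ::
    "('k, 'r) ring_scheme \<Rightarrow> ('k, 'o, 'm) lincat \<Rightarrow> ('o, 'm) endofunctor set monoid" where
  "Aut K C =
     \<lparr>carrier = autoequivalences K C // functor_iso_rel K C,
      mult = (\<lambda>A B. \<Union>F \<in> A. \<Union>F' \<in> B. iso_class K C (F \<bullet> F')),
      one = iso_class K C id_functor\<rparr>"


section \<open>Group actions and equivariant autoequivalences\<close>

locale linear_group_action = linear_category K C + group G
  for K :: "('k, 'r) ring_scheme" (structure) and C :: "('k, 'o, 'm) lincat"
    and G :: "('g, 's) monoid_scheme" (structure) +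
  fixes T :: "'g \<Rightarrow> ('o, 'm) endofunctor" and \<epsilon> :: "'g \<Rightarrow> 'g \<Rightarrow> 'o \<Rightarrow> 'm"
  assumes action_autoequivalence: "g \<in> carrier G \<Longrightarrow> T g \<in> autoequivalences K C"
    and action_iso:
      "\<lbrakk>g \<in> carrier G; h \<in> carrier G\<rbrakk> \<Longrightarrow> nat_iso C (T g \<bullet> T h) (T (g \<otimes>\<^bsub>G\<^esub> h)) (\<epsilon> g h)"
    and action_assoc:
      "\<lbrakk>g \<in> carrier G; h \<in> carrier G; l \<in> carrier G\<rbrakk> \<Longrightarrow>
        nt_eq C (\<epsilon> (g \<otimes>\<^bsub>G\<^esub> h) l \<circ>\<^bsub>C\<^esub> (\<epsilon> g h \<lhd>\<^sub>w T l)) (\<epsilon> g (h \<otimes>\<^bsub>G\<^esub> l) \<circ>\<^bsub>C\<^esub> (T g \<rhd> \<epsilon> h l))"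

definition AutG ::
    "('k, 'r) ring_scheme \<Rightarrow> ('k, 'o, 'm) lincat \<Rightarrow> ('g, 's) monoid_scheme \<Rightarrow>
     ('g \<Rightarrow> ('o, 'm) endofunctor) \<Rightarrow> ('o, 'm) endofunctor set monoid" where
  "AutG K C G T = (Aut K C)
     \<lparr>carrier := {iso_class K C F | F. F \<in> autoequivalences K C \<and>
        (\<forall>g \<in> carrier G. iso_class K C (F \<bullet> T g) = iso_class K C (T g \<bullet> F))}\<rparr>"

text \<open>All choices of natural isomorphisms \<open>\<delta>\<^sub>g : F F\<^sub>g \<rightarrow> F\<^sub>g F\<close>, with no compatibility required.\<close>

definition commutations ::
    "('k, 'o, 'm) lincat \<Rightarrow> ('g, 's) monoid_scheme \<Rightarrow> ('g \<Rightarrow> ('o, 'm) endofunctor) \<Rightarrow>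
     ('o, 'm) endofunctor \<Rightarrow> ('g \<Rightarrow> 'o \<Rightarrow> 'm) set" where
  "commutations C G T F = {\<delta>. \<forall>g \<in> carrier G. nat_iso C (F \<bullet> T g) (T g \<bullet> F) (\<delta> g)}"

definition equivariant_autoequivalences ::
    "('k, 'r) ring_scheme \<Rightarrow> ('k, 'o, 'm) lincat \<Rightarrow> ('g, 's) monoid_scheme \<Rightarrow>
     ('g \<Rightarrow> ('o, 'm) endofunctor) \<Rightarrow> ('g \<Rightarrow> 'g \<Rightarrow> 'o \<Rightarrow> 'm) \<Rightarrow>
     (('o, 'm) endofunctor \<times> ('g \<Rightarrow> 'o \<Rightarrow> 'm)) set" where
  "equivariant_autoequivalences K C G T \<epsilon> =
     {(F, \<delta>). F \<in> autoequivalences K C \<and> \<delta> \<in> commutations C G T F \<and>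
        (\<forall>g \<in> carrier G. \<forall>h \<in> carrier G.
           nt_eq C (\<delta> (g \<otimes>\<^bsub>G\<^esub> h) \<circ>\<^bsub>C\<^esub> (F \<rhd> \<epsilon> g h))
                   ((\<epsilon> g h \<lhd>\<^sub>w F) \<circ>\<^bsub>C\<^esub> (T g \<rhd> \<delta> h) \<circ>\<^bsub>C\<^esub> (\<delta> g \<lhd>\<^sub>w T h)))}"

definition equivariant_iso_rel ::
    "('k, 'r) ring_scheme \<Rightarrow> ('k, 'o, 'm) lincat \<Rightarrow> ('g, 's) monoid_scheme \<Rightarrow>
     ('g \<Rightarrow> ('o, 'm) endofunctor) \<Rightarrow> ('g \<Rightarrow> 'g \<Rightarrow> 'o \<Rightarrow> 'm) \<Rightarrow>
     (('o, 'm) endofunctor \<times> ('g \<Rightarrow> 'o \<Rightarrow> 'm)) rel" where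
  "equivariant_iso_rel K C G T \<epsilon> =
     {((F, \<delta>), (F', \<delta>')).
        (F, \<delta>) \<in> equivariant_autoequivalences K C G T \<epsilon> \<and>
        (F', \<delta>') \<in> equivariant_autoequivalences K C G T \<epsilon> \<and>
        (\<exists>\<phi>. nat_iso C F F' \<phi> \<and>
           (\<forall>g \<in> carrier G. nt_eq C ((T g \<rhd> \<phi>) \<circ>\<^bsub>C\<^esub> \<delta> g) (\<delta>' g \<circ>\<^bsub>C\<^esub> (\<phi> \<lhd>\<^sub>w T g))))}"

definition equivariant_class ::
    "('k, 'r) ring_scheme \<Rightarrow> ('k, 'o, 'm) lincat \<Rightarrow> ('g, 's) monoid_scheme \<Rightarrow>
     ('g \<Rightarrow> ('o, 'm) endofunctor) \<Rightarrow> ('g \<Rightarrow> 'g \<Rightarrow> 'o \<Rightarrow> 'm) \<Rightarrow>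
     ('o, 'm) endofunctor \<times> ('g \<Rightarrow> 'o \<Rightarrow> 'm) \<Rightarrow>
     (('o, 'm) endofunctor \<times> ('g \<Rightarrow> 'o \<Rightarrow> 'm)) set" where
  "equivariant_class K C G T \<epsilon> p = equivariant_iso_rel K C G T \<epsilon> `` {p}"

fun equivariant_mult ::
    "('k, 'o, 'm) lincat \<Rightarrow> ('o, 'm) endofunctor \<times> ('g \<Rightarrow> 'o \<Rightarrow> 'm) \<Rightarrow>
     ('o, 'm) endofunctor \<times> ('g \<Rightarrow> 'o \<Rightarrow> 'm) \<Rightarrow> ('o, 'm) endofunctor \<times> ('g \<Rightarrow> 'o \<Rightarrow> 'm)" where
  "equivariant_mult C (F, \<delta>) (F', \<delta>') = (F \<bullet> F', \<lambda>g. (\<delta> g \<lhd>\<^sub>w F') \<circ>\<^bsub>C\<^esub> (F \<rhd> \<delta>' g))"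

definition Aut_equivariant ::
    "('k, 'r) ring_scheme \<Rightarrow> ('k, 'o, 'm) lincat \<Rightarrow> ('g, 's) monoid_scheme \<Rightarrow>
     ('g \<Rightarrow> ('o, 'm) endofunctor) \<Rightarrow> ('g \<Rightarrow> 'g \<Rightarrow> 'o \<Rightarrow> 'm) \<Rightarrow>
     (('o, 'm) endofunctor \<times> ('g \<Rightarrow> 'o \<Rightarrow> 'm)) set monoid" where
  "Aut_equivariant K C G T \<epsilon> =
     \<lparr>carrier = equivariant_autoequivalences K C G T \<epsilon> // equivariant_iso_rel K C G T \<epsilon>,
      mult = (\<lambda>A B. \<Union>p \<in> A. \<Union>q \<in> B. equivariant_class K C G T \<epsilon> (equivariant_mult C p q)),
      one = equivariant_class K C G T \<epsilon> (id_functor, \<lambda>g. nt_id C (T g))\<rparr>"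


section \<open>Characters and second cohomology with trivial coefficients\<close>

definition character_group ::
    "('g, 's) monoid_scheme \<Rightarrow> ('k, 'r) ring_scheme \<Rightarrow> ('g \<Rightarrow> 'k) monoid" where
  "character_group G K = (product_group (carrier G) (\<lambda>_. units_of K))
     \<lparr>carrier := hom G (units_of K) \<inter> extensional (carrier G)\<rparr>"

definition cochains2 ::
    "('g, 's) monoid_scheme \<Rightarrow> ('k, 'r) ring_scheme \<Rightarrow> ('g \<times> 'g \<Rightarrow> 'k) monoid" where
  "cochains2 G K = product_group (carrier G \<times> carrier G) (\<lambda>_. units_of K)"

definition cocycles2 ::
    "('g, 's) monoid_scheme \<Rightarrow> ('k, 'r) ring_scheme \<Rightarrow> ('g \<times> 'g \<Rightarrow> 'k) monoid" where
  "cocycles2 G K = (cochains2 G K)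
     \<lparr>carrier := {c \<in> carrier (cochains2 G K).
        \<forall>g \<in> carrier G. \<forall>h \<in> carrier G. \<forall>l \<in> carrier G.
          c (g \<otimes>\<^bsub>G\<^esub> h, l) \<otimes>\<^bsub>K\<^esub> c (g, h) = c (g, h \<otimes>\<^bsub>G\<^esub> l) \<otimes>\<^bsub>K\<^esub> c (h, l)}\<rparr>"

definition coboundaries2 ::
    "('g, 's) monoid_scheme \<Rightarrow> ('k, 'r) ring_scheme \<Rightarrow> ('g \<times> 'g \<Rightarrow> 'k) set" where
  "coboundaries2 G K =
     {\<lambda>(g, h) \<in> carrier G \<times> carrier G. b g \<otimes>\<^bsub>K\<^esub> b h \<otimes>\<^bsub>K\<^esub> inv\<^bsub>K\<^esub> (b (g \<otimes>\<^bsub>G\<^esub> h))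
      | b. b \<in> carrier G \<rightarrow> Units K}"

definition H2 ::
    "('g, 's) monoid_scheme \<Rightarrow> ('k, 'r) ring_scheme \<Rightarrow> ('g \<times> 'g \<Rightarrow> 'k) set monoid" where
  "H2 G K = cocycles2 G K Mod coboundaries2 G K"

definition cohomology_class ::
    "('g, 's) monoid_scheme \<Rightarrow> ('k, 'r) ring_scheme \<Rightarrow> ('g \<times> 'g \<Rightarrow> 'k) \<Rightarrow> ('g \<times> 'g \<Rightarrow> 'k) set" where
  "cohomology_class G K c = coboundaries2 G K #>\<^bsub>cocycles2 G K\<^esub> c"


section \<open>The maps in the sequence\<close>

definition rho ::
    "('k, 'r) ring_scheme \<Rightarrow> ('k, 'o, 'm) lincat \<Rightarrow> ('g, 's) monoid_scheme \<Rightarrow>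
     ('g \<Rightarrow> ('o, 'm) endofunctor) \<Rightarrow> ('g \<Rightarrow> 'g \<Rightarrow> 'o \<Rightarrow> 'm) \<Rightarrow>
     ('g \<Rightarrow> 'k) \<Rightarrow> (('o, 'm) endofunctor \<times> ('g \<Rightarrow> 'o \<Rightarrow> 'm)) set" where
  "rho K C G T \<epsilon> \<chi> =
     equivariant_class K C G T \<epsilon>
       (id_functor, \<lambda>g. nt_smult C (T g) (T g) (\<chi> g) (nt_id C (T g)))"

definition forget ::
    "('k, 'r) ring_scheme \<Rightarrow> ('k, 'o, 'm) lincat \<Rightarrow>
     (('o, 'm) endofunctor \<times> ('g \<Rightarrow> 'o \<Rightarrow> 'm)) set \<Rightarrow> ('o, 'm) endofunctor set" where
  "forget K C A = (\<Union>(F, \<delta>) \<in> A. iso_class K C F)"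

definition obstruction_cocycle ::
    "('k, 'r) ring_scheme \<Rightarrow> ('k, 'o, 'm) lincat \<Rightarrow> ('g, 's) monoid_scheme \<Rightarrow>
     ('g \<Rightarrow> ('o, 'm) endofunctor) \<Rightarrow> ('g \<Rightarrow> 'g \<Rightarrow> 'o \<Rightarrow> 'm) \<Rightarrow>
     ('o, 'm) endofunctor \<Rightarrow> ('g \<Rightarrow> 'o \<Rightarrow> 'm) \<Rightarrow> 'g \<times> 'g \<Rightarrow> 'k" where
  "obstruction_cocycle K C G T \<epsilon> F \<delta> = (\<lambda>(g, h) \<in> carrier G \<times> carrier G.
     THE c. c \<in> Units K \<and>
       nt_eq C (\<delta> (g \<otimes>\<^bsub>G\<^esub> h) \<circ>\<^bsub>C\<^esub> (F \<rhd> \<epsilon> g h))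
         (nt_smult C (F \<bullet> T g \<bullet> T h) (T (g \<otimes>\<^bsub>G\<^esub> h) \<bullet> F) c
           ((\<epsilon> g h \<lhd>\<^sub>w F) \<circ>\<^bsub>C\<^esub> (T g \<rhd> \<delta> h) \<circ>\<^bsub>C\<^esub> (\<delta> g \<lhd>\<^sub>w T h))))"

definition obstruction ::
    "('k, 'r) ring_scheme \<Rightarrow> ('k, 'o, 'm) lincat \<Rightarrow> ('g, 's) monoid_scheme \<Rightarrow>
     ('g \<Rightarrow> ('o, 'm) endofunctor) \<Rightarrow> ('g \<Rightarrow> 'g \<Rightarrow> 'o \<Rightarrow> 'm) \<Rightarrow>
     ('o, 'm) endofunctor set \<Rightarrow> ('g \<times> 'g \<Rightarrow> 'k) set" where
  "obstruction K C G T \<epsilon> A =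
     (\<Union>F \<in> A. \<Union>\<delta> \<in> commutations C G T F.
        cohomology_class G K (obstruction_cocycle K C G T \<epsilon> F \<delta>))"

end

theory Submission
  imports Defs
begin

text \<open>
  Composing a natural endomorphism of an autoequivalence with a quasi-inverse turns it into a
  natural endomorphism of the identity, that is, into an element of \<open>Z(C) = k\<close>.  So two natural
  isomorphisms between the same two autoequivalences differ by exactly one scalar in \<open>k\<^sup>*\<close>
  (\<open>nat_iso_proportional\<close>, \<open>scale_unique\<close>), and every diagram of such isomorphisms commutes up to a
  unit.  The exact sequence is the bookkeeping of these units.

  Let \<open>F\<close> be an autoequivalence with isomorphisms \<open>\<delta>\<^sub>g : F F\<^sub>g \<rightarrow> F\<^sub>g F\<close>.  The unit by which the
  equivariance diagram of \<open>(g, h)\<close> fails to commute is called its defect below; it is the value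
  \<open>\<sigma>\<^sub>F(g, h)\<close> of the obstruction cocycle.  Three computations with it carry the proof:
  \<^item> it satisfies the cocycle identity, because the action is associative (\<open>defect_cocycle\<close>);
  \<^item> it is multiplicative when autoequivalences are composed (\<open>defect_mult\<close>);
  \<^item> if an isomorphism \<open>\<phi> : F \<rightarrow> F'\<close> carries \<open>\<delta>\<^sub>g\<close> to \<open>b g\<close> times \<open>\<delta>'\<^sub>g\<close>, then the two defects
    differ by the coboundary of \<open>b\<close> (\<open>defect_intertwined\<close>).

  The last item has several uses.  As some such \<open>b\<close> exists for every \<open>\<phi>\<close>, the class of the defect
  depends only on the isoclass of \<open>F\<close>, and the second item makes \<open>\<sigma>\<close> a homomorphism.  Rescaling
  \<open>\<delta>\<close> by \<open>b\<close> divides the defect by the coboundary of \<open>b\<close>, so the class is trivial exactly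
  when \<open>F\<close> carries an equivariant structure: this is exactness at \<open>Aut\<^sup>G(C)\<close>.  When both defects are
  trivial, \<open>b\<close> has trivial coboundary, so it is a character; for \<open>F'\<close> the identity this is exactness
  at \<open>Aut(C; G)\<close>.  Finally an isomorphism from the identity with structure \<open>\<chi>\<close> to the identity with
  the trivial structure is a single scalar \<open>d\<close> satisfying \<open>d \<chi>(g) = d\<close>, whence \<open>\<chi> = 1\<close>.
\<close>

section \<open>Groups of equivalence classes\<close>

text \<open>
  Both automorphism groups consist of isoclasses of objects whose composition is a group law only
  up to isomorphism.  The product of two classes is a union over all representatives; it collapses
  to one class by congruence.
\<close>

lemma quotient_group:
  fixes A :: "'a set" and R :: "'a rel" and m :: "'a \<Rightarrow> 'a \<Rightarrow> 'a" and e :: 'a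
  defines "Q \<equiv> \<lparr>carrier = A // R, mult = (\<lambda>P S. \<Union>p \<in> P. \<Union>q \<in> S. R `` {m p q}), one = R `` {e}\<rparr>"
  assumes R: "equiv A R"
    and e: "e \<in> A"
    and m: "\<And>p q. \<lbrakk>p \<in> A; q \<in> A\<rbrakk> \<Longrightarrow> m p q \<in> A"
    and cong: "\<And>p p' q q'. \<lbrakk>(p, p') \<in> R; (q, q') \<in> R\<rbrakk> \<Longrightarrow> (m p q, m p' q') \<in> R"
    and assoc: "\<And>p q r. \<lbrakk>p \<in> A; q \<in> A; r \<in> A\<rbrakk> \<Longrightarrow> (m (m p q) r, m p (m q r)) \<in> R"
    and unit: "\<And>p. p \<in> A \<Longrightarrow> (m e p, p) \<in> R"
    and inverse: "\<And>p. p \<in> A \<Longrightarrow> \<exists>q \<in> A. (m q p, e) \<in> R"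
  shows "group Q"
    and "\<And>p q. \<lbrakk>p \<in> A; q \<in> A\<rbrakk> \<Longrightarrow> R `` {p} \<otimes>\<^bsub>Q\<^esub> R `` {q} = R `` {m p q}"
proof -
  have cls: "R `` {p} = R `` {q}" if "(p, q) \<in> R" for p q
    using equiv_class_eq[OF R that] .
  have mult: "R `` {p} \<otimes>\<^bsub>Q\<^esub> R `` {q} = R `` {m p q}" if "p \<in> A" "q \<in> A" for p q
  proof -
    have pq: "p \<in> R `` {p}" "q \<in> R `` {q}"
      using that equiv_class_self[OF R] by auto
    have "R `` {m p' q'} = R `` {m p q}" if "p' \<in> R `` {p}" "q' \<in> R `` {q}" for p' q'
      using cls[OF cong] that by (simp add: Image_singleton_iff)
    then have "(\<Union>p' \<in> R `` {p}. \<Union>q' \<in> R `` {q}. R `` {m p' q'}) = R `` {m p q}"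
      using pq by blast
    then show ?thesis
      by (simp add: Q_def)
  qed
  have carrier: "x \<in> carrier Q \<longleftrightarrow> (\<exists>p \<in> A. x = R `` {p})" for x
    by (auto simp: Q_def quotient_def)
  have one: "\<one>\<^bsub>Q\<^esub> = R `` {e}"
    by (simp add: Q_def)
  show "group Q"
  proof (rule groupI)
    fix x y assume "x \<in> carrier Q" "y \<in> carrier Q"
    then show "x \<otimes>\<^bsub>Q\<^esub> y \<in> carrier Q"
      unfolding carrier by (metis mult m)
  next
    show "\<one>\<^bsub>Q\<^esub> \<in> carrier Q"
      using e by (auto simp: carrier one)
  next
    fix x y z assume "x \<in> carrier Q" "y \<in> carrier Q" "z \<in> carrier Q"
    then obtain p q r where A: "p \<in> A" "q \<in> A" "r \<in> A"
      and xyz: "x = R `` {p}" "y = R `` {q}" "z = R `` {r}"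
      by (auto simp: carrier)
    show "x \<otimes>\<^bsub>Q\<^esub> y \<otimes>\<^bsub>Q\<^esub> z = x \<otimes>\<^bsub>Q\<^esub> (y \<otimes>\<^bsub>Q\<^esub> z)"
      using A m cls[OF assoc[OF A]] by (simp add: xyz mult)
  next
    fix x assume "x \<in> carrier Q"
    then obtain p where p: "p \<in> A" "x = R `` {p}"
      by (auto simp: carrier)
    show "\<one>\<^bsub>Q\<^esub> \<otimes>\<^bsub>Q\<^esub> x = x"
      using p e cls[OF unit[OF p(1)]] by (simp add: mult one)
    obtain q where q: "q \<in> A" "(m q p, e) \<in> R"
      using inverse p by blast
    show "\<exists>y \<in> carrier Q. y \<otimes>\<^bsub>Q\<^esub> x = \<one>\<^bsub>Q\<^esub>"
      using q(1) p mult[OF q(1) p(1)] cls[OF q(2)]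
      by (intro bexI[of _ "R `` {q}"]) (auto simp: carrier one)
  qed
  show "\<And>p q. \<lbrakk>p \<in> A; q \<in> A\<rbrakk> \<Longrightarrow> R `` {p} \<otimes>\<^bsub>Q\<^esub> R `` {q} = R `` {m p q}"
    by (rule mult)
qed


section \<open>Calculating with arrows\<close>

context linear_category
begin

text \<open>
  Since distinct hom-sets are disjoint, source and target are functions of an arrow.  Stated with
  them, the category axioms have side conditions in which no object has to be guessed, so the
  simplifier can discharge them when it computes with composites.
\<close>

definition Arr :: "'m set" where
  "Arr = {f. \<exists>X \<in> Obj C. \<exists>Y \<in> Obj C. f \<in> carrier (Hom C X Y)}"

definition src :: "'m \<Rightarrow> 'o" where
  "src f = (THE X. X \<in> Obj C \<and> (\<exists>Y \<in> Obj C. f \<in> carrier (Hom C X Y)))"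

definition tgt :: "'m \<Rightarrow> 'o" where
  "tgt f = (THE Y. Y \<in> Obj C \<and> (\<exists>X \<in> Obj C. f \<in> carrier (Hom C X Y)))"

abbreviation after :: "'m \<Rightarrow> 'm \<Rightarrow> 'm"  (infixr \<open>\<star>\<close> 70) where
  "g \<star> f \<equiv> g \<cdot>\<^bsub>C\<^esub> f"

text \<open>
  The hom-set that carries the module structure is read off from the arrow itself.
\<close>

definition scale :: "'k \<Rightarrow> 'm \<Rightarrow> 'm"  (infixr \<open>\<ast>\<close> 75) where
  "a \<ast> f = a \<odot>\<^bsub>Hom C (src f) (tgt f)\<^esub> f"

lemma hom_src_tgt:
  assumes "X \<in> Obj C" "Y \<in> Obj C" "f \<in> carrier (Hom C X Y)"
  shows "f \<in> Arr" "src f = X" "tgt f = Y"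
  using assms Hom_disjoint unfolding Arr_def src_def tgt_def
  by (blast intro: the_equality)+

lemma hom_iff:
  "\<lbrakk>X \<in> Obj C; Y \<in> Obj C\<rbrakk> \<Longrightarrow> f \<in> carrier (Hom C X Y) \<longleftrightarrow> f \<in> Arr \<and> src f = X \<and> tgt f = Y"
  using hom_src_tgt unfolding Arr_def by blast

lemma Arr_hom: "\<lbrakk>f \<in> Arr; src f = X; tgt f = Y\<rbrakk> \<Longrightarrow> f \<in> carrier (Hom C X Y)"
  using hom_src_tgt unfolding Arr_def by blast

lemma src_tgt_Obj [simp]: "f \<in> Arr \<Longrightarrow> src f \<in> Obj C" "f \<in> Arr \<Longrightarrow> tgt f \<in> Obj C"
  using hom_src_tgt unfolding Arr_def by blast+

lemma after_arr [simp]: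
  assumes "f \<in> Arr" "g \<in> Arr" "src g = tgt f"
  shows "g \<star> f \<in> Arr" "src (g \<star> f) = src f" "tgt (g \<star> f) = tgt g"
  using hom_src_tgt[OF _ _ Comp_closed[of "src f" "tgt f" "tgt g" f g]] assms by (simp_all add: Arr_hom)

lemma Ident_arr [simp]:
  "X \<in> Obj C \<Longrightarrow> Ident C X \<in> Arr" "X \<in> Obj C \<Longrightarrow> src (Ident C X) = X" "X \<in> Obj C \<Longrightarrow> tgt (Ident C X) = X"
  using hom_src_tgt[OF _ _ Ident_closed] by auto

lemma after_Ident [simp]:
  "\<lbrakk>f \<in> Arr; tgt f = Y\<rbrakk> \<Longrightarrow> Ident C Y \<star> f = f" "\<lbrakk>f \<in> Arr; src f = X\<rbrakk> \<Longrightarrow> f \<star> Ident C X = f"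
  using Ident_left[of "src f" "tgt f" f] Ident_right[of "src f" "tgt f" f] by (auto simp: Arr_hom)

lemma after_assoc:
  "\<lbrakk>f \<in> Arr; g \<in> Arr; h \<in> Arr; src g = tgt f; src h = tgt g\<rbrakk> \<Longrightarrow> (h \<star> g) \<star> f = h \<star> (g \<star> f)"
  using Comp_assoc[of "src f" "tgt f" "tgt g" "tgt h" f g h] by (simp add: Arr_hom)

lemma scale_arr [simp]:
  assumes "a \<in> carrier K" "f \<in> Arr"
  shows "a \<ast> f \<in> Arr" "src (a \<ast> f) = src f" "tgt (a \<ast> f) = tgt f"
proof -
  interpret M: module K "Hom C (src f) (tgt f)"
    using assms by (intro Hom_module) auto
  have "a \<ast> f \<in> carrier (Hom C (src f) (tgt f))"
    using assms by (simp add: scale_def Arr_hom)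
  then show "a \<ast> f \<in> Arr" "src (a \<ast> f) = src f" "tgt (a \<ast> f) = tgt f"
    using hom_src_tgt[of "src f" "tgt f" "a \<ast> f"] assms(2) by auto
qed

lemma scale_scale [simp]:
  assumes "a \<in> carrier K" "b \<in> carrier K" "f \<in> Arr"
  shows "a \<ast> b \<ast> f = (a \<otimes> b) \<ast> f"
proof -
  interpret M: module K "Hom C (src f) (tgt f)"
    using assms by (intro Hom_module) auto
  show ?thesis
    using assms scale_arr[of b f] M.smult_assoc1 by (simp add: scale_def Arr_hom)
qed

lemma scale_one [simp]:
  assumes "f \<in> Arr"
  shows "\<one> \<ast> f = f"
proof -
  interpret M: module K "Hom C (src f) (tgt f)"
    using assms by (intro Hom_module) auto
  show ?thesis
    using assms by (simp add: scale_def Arr_hom)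
qed

lemma scale_after [simp]:
  "\<lbrakk>a \<in> carrier K; f \<in> Arr; g \<in> Arr; src g = tgt f\<rbrakk> \<Longrightarrow> (a \<ast> g) \<star> f = a \<ast> (g \<star> f)"
  using Comp_smult_left[of "src f" "tgt f" "tgt g" a f g] scale_arr by (simp add: scale_def Arr_hom)

lemma after_scale [simp]:
  "\<lbrakk>a \<in> carrier K; f \<in> Arr; g \<in> Arr; src g = tgt f\<rbrakk> \<Longrightarrow> g \<star> (a \<ast> f) = a \<ast> (g \<star> f)"
  using Comp_smult_right[of "src f" "tgt f" "tgt g" a f g] scale_arr by (simp add: scale_def Arr_hom)

lemma is_iso_iff:
  assumes "X \<in> Obj C" "Y \<in> Obj C"
  shows "is_iso C X Y f \<longleftrightarrow> f \<in> Arr \<and> src f = X \<and> tgt f = Y \<and>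
    (\<exists>g \<in> Arr. src g = Y \<and> tgt g = X \<and> g \<star> f = Ident C X \<and> f \<star> g = Ident C Y)"
  unfolding is_iso_def Bex_def hom_iff[OF assms] hom_iff[OF assms(2,1)] by blast

end


section \<open>Linear functors and natural isomorphisms\<close>

lemma fcomp_sel [simp]:
  "ob (F \<bullet> F') X = ob F (ob F' X)" "ar (F \<bullet> F') f = ar F (ar F' f)"
  "ob id_functor X = X" "ar id_functor f = f"
  by (simp_all add: fcomp_def id_functor_def)

lemma fcomp_assoc [simp]: "(F \<bullet> F') \<bullet> F'' = F \<bullet> (F' \<bullet> F'')"
  by (simp only: fcomp_def endofunctor.simps)

lemma fcomp_id [simp]: "F \<bullet> id_functor = F" "id_functor \<bullet> F = F"
  by - (rule endofunctor.equality; simp add: fcomp_def id_functor_def)+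

context linear_category
begin

abbreviation lin :: "('o, 'm) endofunctor \<Rightarrow> bool" where
  "lin F \<equiv> linear_functor K C F"

lemma lin_ob [simp]:
  assumes "lin F" "X \<in> Obj C"
  shows "ob F X \<in> Obj C" "ar F (Ident C X) = Ident C (ob F X)"
  using assms unfolding linear_functor_def by blast+

lemma lin_add_smult:
  assumes "lin F" "X \<in> Obj C" "Y \<in> Obj C" "f \<in> carrier (Hom C X Y)"
  shows "f' \<in> carrier (Hom C X Y) \<Longrightarrow>
      ar F (f \<oplus>\<^bsub>Hom C X Y\<^esub> f') = ar F f \<oplus>\<^bsub>Hom C (ob F X) (ob F Y)\<^esub> ar F f'"
    and "a \<in> carrier K \<Longrightarrow> ar F (a \<odot>\<^bsub>Hom C X Y\<^esub> f) = a \<odot>\<^bsub>Hom C (ob F X) (ob F Y)\<^esub> ar F f"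
  using assms unfolding linear_functor_def by blast+

lemma lin_arr [simp]:
  assumes "lin F" "f \<in> Arr"
  shows "ar F f \<in> Arr" "src (ar F f) = ob F (src f)" "tgt (ar F f) = ob F (tgt f)"
proof -
  have "ar F f \<in> carrier (Hom C (ob F (src f)) (ob F (tgt f)))"
    using assms(1) Arr_hom[OF assms(2) refl refl] src_tgt_Obj[OF assms(2)]
    unfolding linear_functor_def by blast
  then show "ar F f \<in> Arr" "src (ar F f) = ob F (src f)" "tgt (ar F f) = ob F (tgt f)"
    using hom_src_tgt[of "ob F (src f)" "ob F (tgt f)" "ar F f"] assms by auto
qed

lemma lin_after [simp]:
  assumes "lin F" "f \<in> Arr" "g \<in> Arr" "src g = tgt f"
  shows "ar F (g \<star> f) = ar F g \<star> ar F f"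
proof -
  have "f \<in> carrier (Hom C (src f) (tgt f))" "g \<in> carrier (Hom C (tgt f) (tgt g))"
    using assms by (simp_all add: Arr_hom)
  then show ?thesis
    using assms(1) src_tgt_Obj[OF assms(2)] src_tgt_Obj(2)[OF assms(3)]
    unfolding linear_functor_def by blast
qed

lemma lin_scale [simp]:
  assumes "lin F" "f \<in> Arr" "a \<in> carrier K"
  shows "ar F (a \<ast> f) = a \<ast> ar F f"
proof -
  have "ar F (a \<odot>\<^bsub>Hom C (src f) (tgt f)\<^esub> f) = a \<odot>\<^bsub>Hom C (ob F (src f)) (ob F (tgt f))\<^esub> ar F f"
    using assms Arr_hom[OF assms(2) refl refl] by (simp add: lin_add_smult)
  then show ?thesis
    using assms by (simp add: scale_def)
qed

lemma lin_id [simp]: "lin id_functor"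
  by (simp add: linear_functor_def)

lemma lin_fcomp [simp]:
  assumes "lin F" "lin F'"
  shows "lin (F \<bullet> F')"
  unfolding linear_functor_def
  by (intro conjI ballI) (use assms in \<open>simp_all add: lin_add_smult hom_iff\<close>)

lemma nat_transI:
  assumes "lin F" "lin F'"
    and "\<And>X. X \<in> Obj C \<Longrightarrow> \<alpha> X \<in> Arr \<and> src (\<alpha> X) = ob F X \<and> tgt (\<alpha> X) = ob F' X"
    and "\<And>f. f \<in> Arr \<Longrightarrow> \<alpha> (tgt f) \<star> ar F f = ar F' f \<star> \<alpha> (src f)"
  shows "nat_trans C F F' \<alpha>"
  unfolding nat_trans_def
proof (intro conjI ballI)
  show "\<alpha> X \<in> carrier (Hom C (ob F X) (ob F' X))" if "X \<in> Obj C" for X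
    using that assms(1,2) assms(3)[OF that] by (simp add: hom_iff)
  show "\<alpha> Y \<star> ar F f = ar F' f \<star> \<alpha> X"
    if "X \<in> Obj C" "Y \<in> Obj C" "f \<in> carrier (Hom C X Y)" for X Y f
    using assms(4) hom_src_tgt[OF that] by blast
qed

lemma nat_trans_arr:
  assumes "nat_trans C F F' \<alpha>" "lin F" "lin F'" "X \<in> Obj C"
  shows "\<alpha> X \<in> Arr" "src (\<alpha> X) = ob F X" "tgt (\<alpha> X) = ob F' X"
proof -
  have "\<alpha> X \<in> carrier (Hom C (ob F X) (ob F' X))"
    using assms unfolding nat_trans_def by blast
  then show "\<alpha> X \<in> Arr" "src (\<alpha> X) = ob F X" "tgt (\<alpha> X) = ob F' X"
    using assms by (simp_all add: hom_iff)
qed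

lemma nat_trans_natural:
  assumes "nat_trans C F F' \<alpha>" "f \<in> Arr" "src f = X" "tgt f = Y"
  shows "\<alpha> Y \<star> ar F f = ar F' f \<star> \<alpha> X"
proof -
  have "X \<in> Obj C" "Y \<in> Obj C" "f \<in> carrier (Hom C X Y)"
    using assms(2-4) by (auto intro: Arr_hom)
  then show ?thesis
    using assms(1) unfolding nat_trans_def by blast
qed

lemma nat_iso_arr:
  assumes "nat_iso C F F' \<alpha>" "lin F" "lin F'" "X \<in> Obj C"
  shows "\<alpha> X \<in> Arr" "src (\<alpha> X) = ob F X" "tgt (\<alpha> X) = ob F' X"
  using assms nat_trans_arr unfolding nat_iso_def by blast+

lemma nat_iso_natural:
  assumes "nat_iso C F F' \<alpha>" "f \<in> Arr" "src f = X" "tgt f = Y"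
  shows "\<alpha> Y \<star> ar F f = ar F' f \<star> \<alpha> X"
  using assms nat_trans_natural unfolding nat_iso_def by blast

lemma nat_isoI:
  assumes "nat_trans C F F' \<alpha>" "nat_trans C F' F \<beta>" "lin F" "lin F'"
    and "\<And>X. X \<in> Obj C \<Longrightarrow> \<beta> X \<star> \<alpha> X = Ident C (ob F X)"
    and "\<And>X. X \<in> Obj C \<Longrightarrow> \<alpha> X \<star> \<beta> X = Ident C (ob F' X)"
  shows "nat_iso C F F' \<alpha>"
proof -
  have "is_iso C (ob F X) (ob F' X) (\<alpha> X)" if X: "X \<in> Obj C" for X
    using X assms(3-6) nat_trans_arr[OF assms(1,3,4) X] nat_trans_arr[OF assms(2,4,3) X]
    by (auto simp: is_iso_iff intro!: bexI[of _ "\<beta> X"])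
  then show ?thesis
    using assms(1) unfolding nat_iso_def by blast
qed

text \<open>
  The inverse is chosen objectwise; conjugating a naturality square of \<open>\<alpha>\<close> makes it natural.
\<close>

lemma nat_iso_inverse:
  assumes \<alpha>: "nat_iso C F F' \<alpha>" and F: "lin F" "lin F'"
  obtains \<beta> where "nat_iso C F' F \<beta>"
    "\<forall>X \<in> Obj C. \<beta> X \<star> \<alpha> X = Ident C (ob F X)"
    "\<forall>X \<in> Obj C. \<alpha> X \<star> \<beta> X = Ident C (ob F' X)"
proof -
  note arr = nat_iso_arr[OF \<alpha> F]
  have "\<forall>X \<in> Obj C. \<exists>g. g \<in> Arr \<and> src g = ob F' X \<and> tgt g = ob F X \<and>
      g \<star> \<alpha> X = Ident C (ob F X) \<and> \<alpha> X \<star> g = Ident C (ob F' X)"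
    using \<alpha> F unfolding nat_iso_def by (fastforce simp: is_iso_iff)
  then obtain \<beta> where "\<forall>X \<in> Obj C. \<beta> X \<in> Arr \<and> src (\<beta> X) = ob F' X \<and> tgt (\<beta> X) = ob F X \<and>
      \<beta> X \<star> \<alpha> X = Ident C (ob F X) \<and> \<alpha> X \<star> \<beta> X = Ident C (ob F' X)"
    unfolding bchoice_iff by blast
  then have \<beta>: "\<beta> X \<in> Arr" "src (\<beta> X) = ob F' X" "tgt (\<beta> X) = ob F X"
      "\<beta> X \<star> \<alpha> X = Ident C (ob F X)" "\<alpha> X \<star> \<beta> X = Ident C (ob F' X)" if "X \<in> Obj C" for X
    using that by auto
  have "nat_trans C F' F \<beta>"
  proof (rule nat_transI[OF F(2,1)])
    fix f assume f: "f \<in> Arr"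
    have "\<beta> (tgt f) \<star> ar F' f = \<beta> (tgt f) \<star> (ar F' f \<star> \<alpha> (src f)) \<star> \<beta> (src f)"
      using f F arr \<beta> by (simp add: after_assoc)
    also have "\<dots> = \<beta> (tgt f) \<star> (\<alpha> (tgt f) \<star> ar F f) \<star> \<beta> (src f)"
      using f nat_iso_natural[OF \<alpha> f] by simp
    also have "\<dots> = (\<beta> (tgt f) \<star> \<alpha> (tgt f)) \<star> ar F f \<star> \<beta> (src f)"
      using f F arr \<beta>(1-3) by (simp add: after_assoc)
    also have "\<dots> = ar F f \<star> \<beta> (src f)"
      using f F arr \<beta> by simp
    finally show "\<beta> (tgt f) \<star> ar F' f = ar F f \<star> \<beta> (src f)" .
  qed (use \<beta> in auto)
  then have "nat_iso C F' F \<beta>"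
    using nat_isoI[of F' F \<beta> \<alpha>] \<alpha> F \<beta>(4,5) unfolding nat_iso_def by blast
  then show thesis
    using \<beta> that by blast
qed

lemma nat_iso_id: "lin F \<Longrightarrow> nat_iso C F F (nt_id C F)"
  by (rule nat_isoI[where \<beta> = "nt_id C F"]) (auto intro!: nat_transI simp: nt_id_def)

lemma nat_trans_comp:
  assumes \<alpha>: "nat_trans C F F' \<alpha>" and \<beta>: "nat_trans C F' F'' \<beta>" and F: "lin F" "lin F'" "lin F''"
  shows "nat_trans C F F'' (\<beta> \<circ>\<^bsub>C\<^esub> \<alpha>)"
proof (rule nat_transI[OF F(1,3)])
  note arr = nat_trans_arr[OF \<alpha> F(1,2)] nat_trans_arr[OF \<beta> F(2,3)]
  show "(\<beta> \<circ>\<^bsub>C\<^esub> \<alpha>) X \<in> Arr \<and> src ((\<beta> \<circ>\<^bsub>C\<^esub> \<alpha>) X) = ob F X \<and> tgt ((\<beta> \<circ>\<^bsub>C\<^esub> \<alpha>) X) = ob F'' X"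
    if "X \<in> Obj C" for X
    using that arr by (simp add: nt_comp_def)
  fix f assume f: "f \<in> Arr"
  have "\<beta> (tgt f) \<star> \<alpha> (tgt f) \<star> ar F f = (\<beta> (tgt f) \<star> ar F' f) \<star> \<alpha> (src f)"
    using f arr F by (simp add: after_assoc nat_trans_natural[OF \<alpha>])
  also have "\<dots> = ar F'' f \<star> \<beta> (src f) \<star> \<alpha> (src f)"
    using f arr F by (simp add: after_assoc nat_trans_natural[OF \<beta>])
  finally show "(\<beta> \<circ>\<^bsub>C\<^esub> \<alpha>) (tgt f) \<star> ar F f = ar F'' f \<star> (\<beta> \<circ>\<^bsub>C\<^esub> \<alpha>) (src f)"
    using f arr F by (simp add: nt_comp_def after_assoc)
qed

lemma nat_iso_comp:
  assumes \<alpha>: "nat_iso C F F' \<alpha>" and \<beta>: "nat_iso C F' F'' \<beta>" and F: "lin F" "lin F'" "lin F''"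
  shows "nat_iso C F F'' (\<beta> \<circ>\<^bsub>C\<^esub> \<alpha>)"
proof -
  obtain \<alpha>' where \<alpha>': "nat_iso C F' F \<alpha>'"
      "\<forall>X \<in> Obj C. \<alpha>' X \<star> \<alpha> X = Ident C (ob F X)"
      "\<forall>X \<in> Obj C. \<alpha> X \<star> \<alpha>' X = Ident C (ob F' X)"
    by (rule nat_iso_inverse[OF \<alpha> F(1,2)])
  obtain \<beta>' where \<beta>': "nat_iso C F'' F' \<beta>'"
      "\<forall>X \<in> Obj C. \<beta>' X \<star> \<beta> X = Ident C (ob F' X)"
      "\<forall>X \<in> Obj C. \<beta> X \<star> \<beta>' X = Ident C (ob F'' X)"
    by (rule nat_iso_inverse[OF \<beta> F(2,3)])
  note arr = nat_iso_arr[OF \<alpha> F(1,2)] nat_iso_arr[OF \<alpha>'(1) F(2,1)]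
    nat_iso_arr[OF \<beta> F(2,3)] nat_iso_arr[OF \<beta>'(1) F(3,2)]
  show ?thesis
  proof (rule nat_isoI[where \<beta> = "\<alpha>' \<circ>\<^bsub>C\<^esub> \<beta>'"])
    fix X assume X: "X \<in> Obj C"
    have "(\<alpha>' X \<star> \<beta>' X) \<star> (\<beta> X \<star> \<alpha> X) = \<alpha>' X \<star> (\<beta>' X \<star> \<beta> X) \<star> \<alpha> X"
      using X arr by (simp add: after_assoc)
    then show "(\<alpha>' \<circ>\<^bsub>C\<^esub> \<beta>') X \<star> (\<beta> \<circ>\<^bsub>C\<^esub> \<alpha>) X = Ident C (ob F X)"
      using X arr \<alpha>' \<beta>' by (simp add: nt_comp_def)
    have "(\<beta> X \<star> \<alpha> X) \<star> (\<alpha>' X \<star> \<beta>' X) = \<beta> X \<star> (\<alpha> X \<star> \<alpha>' X) \<star> \<beta>' X"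
      using X arr by (simp add: after_assoc)
    then show "(\<beta> \<circ>\<^bsub>C\<^esub> \<alpha>) X \<star> (\<alpha>' \<circ>\<^bsub>C\<^esub> \<beta>') X = Ident C (ob F'' X)"
      using X arr \<alpha>' \<beta>' by (simp add: nt_comp_def)
  qed (use \<alpha> \<beta> \<alpha>' \<beta>' F in \<open>auto intro: nat_trans_comp simp: nat_iso_def\<close>)
qed

lemma nat_iso_whisker_left:
  assumes \<alpha>: "nat_iso C F F' \<alpha>" and F: "lin F" "lin F'" "lin H"
  shows "nat_iso C (H \<bullet> F) (H \<bullet> F') (H \<rhd> \<alpha>)"
proof -
  have trans: "nat_trans C (H \<bullet> F) (H \<bullet> F') (H \<rhd> \<alpha>)"
    if \<alpha>: "nat_iso C F F' \<alpha>" and F: "lin F" "lin F'" for F F' \<alpha>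
  proof (rule nat_transI)
    note arr = nat_iso_arr[OF \<alpha> F]
    fix f assume f: "f \<in> Arr"
    have "ar H (\<alpha> (tgt f)) \<star> ar H (ar F f) = ar H (\<alpha> (tgt f) \<star> ar F f)"
      using f arr F assms(4) by simp
    also have "\<dots> = ar H (ar F' f \<star> \<alpha> (src f))"
      using f by (simp add: nat_iso_natural[OF \<alpha>])
    finally show "(H \<rhd> \<alpha>) (tgt f) \<star> ar (H \<bullet> F) f = ar (H \<bullet> F') f \<star> (H \<rhd> \<alpha>) (src f)"
      using f arr F assms(4) by (simp add: whisker_left_def)
  qed (use nat_iso_arr[OF \<alpha> F] F assms(4) in \<open>auto simp: whisker_left_def\<close>)
  obtain \<beta> where \<beta>: "nat_iso C F' F \<beta>"
      "\<forall>X \<in> Obj C. \<beta> X \<star> \<alpha> X = Ident C (ob F X)"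
      "\<forall>X \<in> Obj C. \<alpha> X \<star> \<beta> X = Ident C (ob F' X)"
    by (rule nat_iso_inverse[OF \<alpha> F(1,2)])
  note arr = nat_iso_arr[OF \<alpha> F(1,2)] nat_iso_arr[OF \<beta>(1) F(2,1)]
  show ?thesis
  proof (rule nat_isoI[OF trans[OF \<alpha> F(1,2)] trans[OF \<beta>(1) F(2,1)]])
    fix X assume X: "X \<in> Obj C"
    have "ar H (\<beta> X) \<star> ar H (\<alpha> X) = ar H (\<beta> X \<star> \<alpha> X)" "ar H (\<alpha> X) \<star> ar H (\<beta> X) = ar H (\<alpha> X \<star> \<beta> X)"
      using X arr F(3) by simp_all
    then show "(H \<rhd> \<beta>) X \<star> (H \<rhd> \<alpha>) X = Ident C (ob (H \<bullet> F) X)"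
        "(H \<rhd> \<alpha>) X \<star> (H \<rhd> \<beta>) X = Ident C (ob (H \<bullet> F') X)"
      using X \<beta> F by (simp_all add: whisker_left_def)
  qed (use F in auto)
qed

lemma nat_iso_whisker_right:
  assumes \<alpha>: "nat_iso C F F' \<alpha>" and F: "lin F" "lin F'" "lin H"
  shows "nat_iso C (F \<bullet> H) (F' \<bullet> H) (\<alpha> \<lhd>\<^sub>w H)"
  unfolding nat_iso_def
proof
  show "nat_trans C (F \<bullet> H) (F' \<bullet> H) (\<alpha> \<lhd>\<^sub>w H)"
    by (rule nat_transI) (use nat_iso_arr[OF \<alpha> F(1,2)] F in
        \<open>auto simp: whisker_right_def intro: nat_iso_natural[OF \<alpha>]\<close>)
  show "\<forall>X \<in> Obj C. is_iso C (ob (F \<bullet> H) X) (ob (F' \<bullet> H) X) ((\<alpha> \<lhd>\<^sub>w H) X)"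
    using \<alpha> F unfolding nat_iso_def by (simp add: whisker_right_def)
qed

lemma nat_iso_scale:
  assumes \<alpha>: "nat_iso C F F' \<alpha>" and F: "lin F" "lin F'" and a: "a \<in> Units K"
  shows "nat_iso C F F' (\<lambda>X. a \<ast> \<alpha> X)"
proof -
  have trans: "nat_trans C F F' (\<lambda>X. a \<ast> \<alpha> X)"
    if \<alpha>: "nat_iso C F F' \<alpha>" and F: "lin F" "lin F'" and a: "a \<in> Units K" for F F' \<alpha> a
    by (rule nat_transI[OF F]) (use nat_iso_arr[OF \<alpha> F] F Units_closed[OF a] in
        \<open>simp_all add: nat_iso_natural[OF \<alpha>]\<close>)
  obtain \<beta> where \<beta>: "nat_iso C F' F \<beta>"
      "\<forall>X \<in> Obj C. \<beta> X \<star> \<alpha> X = Ident C (ob F X)"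
      "\<forall>X \<in> Obj C. \<alpha> X \<star> \<beta> X = Ident C (ob F' X)"
    by (rule nat_iso_inverse[OF \<alpha> F])
  show ?thesis
    by (rule nat_isoI[OF trans[OF \<alpha> F a] trans[OF \<beta>(1) F(2,1) Units_inv_Units[OF a]] F])
      (use nat_iso_arr[OF \<alpha> F] nat_iso_arr[OF \<beta>(1) F(2,1)] \<beta> F a in
        \<open>simp_all add: Units_closed\<close>)
qed

end


context linear_category
begin

text \<open>
  Components of natural isomorphisms are monic and epic; most identities of scalars below are
  obtained by cancelling them.
\<close>

lemma nat_iso_cancel:
  assumes \<alpha>: "nat_iso C F F' \<alpha>" and F: "lin F" "lin F'" and X: "X \<in> Obj C"
    and uv: "u \<in> Arr" "v \<in> Arr"
  shows nat_iso_cancel_left: "\<lbrakk>tgt u = ob F X; tgt v = ob F X; \<alpha> X \<star> u = \<alpha> X \<star> v\<rbrakk> \<Longrightarrow> u = v"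
    and nat_iso_cancel_right: "\<lbrakk>src u = ob F' X; src v = ob F' X; u \<star> \<alpha> X = v \<star> \<alpha> X\<rbrakk> \<Longrightarrow> u = v"
proof -
  obtain \<beta> where \<beta>: "nat_iso C F' F \<beta>"
      "\<forall>X \<in> Obj C. \<beta> X \<star> \<alpha> X = Ident C (ob F X)"
      "\<forall>X \<in> Obj C. \<alpha> X \<star> \<beta> X = Ident C (ob F' X)"
    by (rule nat_iso_inverse[OF \<alpha> F])
  note arr = nat_iso_arr[OF \<alpha> F X] nat_iso_arr[OF \<beta>(1) F(2,1) X]
  have L: "w = \<beta> X \<star> (\<alpha> X \<star> w)" if "w \<in> Arr" "tgt w = ob F X" for w
    using that arr bspec[OF \<beta>(2) X] after_assoc[of w "\<alpha> X" "\<beta> X"] by simp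
  have R: "w = (w \<star> \<alpha> X) \<star> \<beta> X" if "w \<in> Arr" "src w = ob F' X" for w
    using that arr bspec[OF \<beta>(3) X] by (simp add: after_assoc)
  show "u = v" if "tgt u = ob F X" "tgt v = ob F X" "\<alpha> X \<star> u = \<alpha> X \<star> v"
    using L[OF uv(1) that(1)] L[OF uv(2) that(2)] that(3) by simp
  show "u = v" if "src u = ob F' X" "src v = ob F' X" "u \<star> \<alpha> X = v \<star> \<alpha> X"
    using R[OF uv(1) that(1)] R[OF uv(2) that(2)] that(3) by simp
qed


section \<open>The group of autoequivalences\<close>

text \<open>
  For linear functors, existence of a natural isomorphism is a congruence for composition.  This
  replaces explicit isomorphisms wherever only isoclasses matter.
\<close>

definition isomorphic :: "('o, 'm) endofunctor \<Rightarrow> ('o, 'm) endofunctor \<Rightarrow> bool"  (infix \<open>\<doteq>\<close> 50) where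
  "F \<doteq> F' \<longleftrightarrow> lin F \<and> lin F' \<and> (\<exists>\<alpha>. nat_iso C F F' \<alpha>)"

lemma isomorphic_refl: "lin F \<Longrightarrow> F \<doteq> F"
  unfolding isomorphic_def using nat_iso_id by blast

lemma isomorphic_sym: "F \<doteq> F' \<Longrightarrow> F' \<doteq> F"
  unfolding isomorphic_def using nat_iso_inverse by metis

lemma isomorphic_trans [trans]: "\<lbrakk>F \<doteq> F'; F' \<doteq> F''\<rbrakk> \<Longrightarrow> F \<doteq> F''"
  unfolding isomorphic_def using nat_iso_comp by blast

lemma isomorphic_fcomp:
  assumes "F \<doteq> F'" "H \<doteq> H'"
  shows "F \<bullet> H \<doteq> F' \<bullet> H'"
proof -
  have "F \<bullet> H \<doteq> F \<bullet> H'"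
    using assms unfolding isomorphic_def by (meson lin_fcomp nat_iso_whisker_left)
  also have "F \<bullet> H' \<doteq> F' \<bullet> H'"
    using assms unfolding isomorphic_def by (meson lin_fcomp nat_iso_whisker_right)
  finally show ?thesis .
qed

abbreviation Auteq :: "('o, 'm) endofunctor set" where
  "Auteq \<equiv> autoequivalences K C"

lemma Auteq_iff: "F \<in> Auteq \<longleftrightarrow> lin F \<and> (\<exists>F'. lin F' \<and> id_functor \<doteq> F' \<bullet> F \<and> F \<bullet> F' \<doteq> id_functor)"
  unfolding autoequivalences_def isomorphic_def using lin_fcomp lin_id by blast

lemma Auteq_lin [simp]: "F \<in> Auteq \<Longrightarrow> lin F"
  by (simp add: Auteq_iff)

lemma Auteq_inverse:
  assumes "F \<in> Auteq"
  obtains F' where "F' \<in> Auteq" "id_functor \<doteq> F' \<bullet> F" "F \<bullet> F' \<doteq> id_functor"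
  using assms isomorphic_sym unfolding Auteq_iff by metis

lemma Auteq_id [simp]: "id_functor \<in> Auteq"
  unfolding Auteq_iff using isomorphic_refl[OF lin_id] by (metis fcomp_id(1) lin_id)

lemma Auteq_fcomp [simp]:
  assumes "F \<in> Auteq" "H \<in> Auteq"
  shows "F \<bullet> H \<in> Auteq"
proof -
  obtain F' where F': "F' \<in> Auteq" "id_functor \<doteq> F' \<bullet> F" "F \<bullet> F' \<doteq> id_functor"
    using Auteq_inverse[OF assms(1)] .
  obtain H' where H': "H' \<in> Auteq" "id_functor \<doteq> H' \<bullet> H" "H \<bullet> H' \<doteq> id_functor"
    using Auteq_inverse[OF assms(2)] .
  note lin = Auteq_lin[OF assms(1)] Auteq_lin[OF assms(2)] Auteq_lin[OF F'(1)] Auteq_lin[OF H'(1)]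
  note refl = lin[THEN isomorphic_refl]
  have "H' \<bullet> H \<doteq> (H' \<bullet> F') \<bullet> (F \<bullet> H)"
    using isomorphic_fcomp[OF refl(4) isomorphic_fcomp[OF F'(2) refl(2)]] by simp
  moreover have "(F \<bullet> H) \<bullet> (H' \<bullet> F') \<doteq> F \<bullet> F'"
    using isomorphic_fcomp[OF refl(1) isomorphic_fcomp[OF H'(3) refl(3)]] by simp
  ultimately show ?thesis
    unfolding Auteq_iff using lin F'(3) H'(2) isomorphic_trans lin_fcomp by blast
qed

lemma functor_iso_rel_iff:
  "(F, F') \<in> functor_iso_rel K C \<longleftrightarrow> F \<in> Auteq \<and> F' \<in> Auteq \<and> F \<doteq> F'"
  unfolding functor_iso_rel_def isomorphic_def by auto

lemma functor_iso_rel_equiv: "equiv Auteq (functor_iso_rel K C)"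
  by (rule equivI)
    (auto simp: refl_on_def sym_def trans_def functor_iso_rel_iff
      intro: isomorphic_refl isomorphic_sym isomorphic_trans)

lemma iso_class_eq_iff:
  "\<lbrakk>F \<in> Auteq; F' \<in> Auteq\<rbrakk> \<Longrightarrow> iso_class K C F = iso_class K C F' \<longleftrightarrow> F \<doteq> F'"
  unfolding iso_class_def using eq_equiv_class_iff[OF functor_iso_rel_equiv]
  by (simp add: functor_iso_rel_iff)

lemma
  shows Aut_group: "group (Aut K C)"
    and Aut_mult: "\<And>F F'. \<lbrakk>F \<in> Auteq; F' \<in> Auteq\<rbrakk> \<Longrightarrow>
      iso_class K C F \<otimes>\<^bsub>Aut K C\<^esub> iso_class K C F' = iso_class K C (F \<bullet> F')"
proof -
  have inv: "\<exists>F' \<in> Auteq. F' \<bullet> F \<doteq> id_functor" if F: "F \<in> Auteq" for F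
    using Auteq_inverse[OF F] isomorphic_sym by metis
  note q = quotient_group[OF functor_iso_rel_equiv Auteq_id Auteq_fcomp, folded iso_class_def]
  show "group (Aut K C)"
    unfolding Aut_def
    by (rule q(1)) (auto simp: functor_iso_rel_iff isomorphic_refl intro: isomorphic_fcomp dest: inv)
  show "\<And>F F'. \<lbrakk>F \<in> Auteq; F' \<in> Auteq\<rbrakk> \<Longrightarrow>
      iso_class K C F \<otimes>\<^bsub>Aut K C\<^esub> iso_class K C F' = iso_class K C (F \<bullet> F')"
    unfolding Aut_def
    by (rule q(2)) (auto simp: functor_iso_rel_iff isomorphic_refl intro: isomorphic_fcomp dest: inv)
qed

lemma Aut_carrier: "A \<in> carrier (Aut K C) \<longleftrightarrow> (\<exists>F \<in> Auteq. A = iso_class K C F)"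
  by (auto simp: Aut_def quotient_def iso_class_def)

lemma Aut_one: "\<one>\<^bsub>Aut K C\<^esub> = iso_class K C id_functor"
  by (simp add: Aut_def)

end


section \<open>Natural isomorphisms over a scalar center\<close>

locale scalar_center = linear_category K C
  for K :: "('k, 'r) ring_scheme" (structure) and C :: "('k, 'o, 'm) lincat" +
  assumes center_scalars: "center_is_scalars K C"
begin

lemma center_smult_one:
  "a \<odot>\<^bsub>center C\<^esub> \<one>\<^bsub>center C\<^esub> = (\<lambda>X \<in> Obj C. a \<ast> Ident C X)"
  by (auto simp: center_def scale_def intro!: restrict_ext)

lemma center_bij: "bij_betw (\<lambda>a. a \<odot>\<^bsub>center C\<^esub> \<one>\<^bsub>center C\<^esub>) (carrier K) (carrier (center C))"
  using center_scalars unfolding center_is_scalars_def ring_iso_def by blast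

lemma endo_id_scalar:
  assumes "nat_trans C id_functor id_functor \<alpha>"
  obtains c where "c \<in> carrier K" "\<And>X. X \<in> Obj C \<Longrightarrow> \<alpha> X = c \<ast> Ident C X"
proof -
  have "nat_trans C id_functor id_functor (restrict \<alpha> (Obj C))"
    using assms unfolding nat_trans_def by simp
  then have "restrict \<alpha> (Obj C) \<in> carrier (center C)"
    by (simp add: center_def)
  then obtain c where c: "c \<in> carrier K" "restrict \<alpha> (Obj C) = (\<lambda>X \<in> Obj C. c \<ast> Ident C X)"
    using bij_betw_imp_surj_on[OF center_bij] unfolding center_smult_one by blast
  have "\<alpha> X = c \<ast> Ident C X" if "X \<in> Obj C" for X
    using fun_cong[OF c(2), of X] that by simp
  then show thesis
    using that c(1) by blast
qed

lemma scalar_id_inj: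
  assumes "a \<in> carrier K" "b \<in> carrier K" "\<And>X. X \<in> Obj C \<Longrightarrow> a \<ast> Ident C X = b \<ast> Ident C X"
  shows "a = b"
proof (rule inj_onD[OF bij_betw_imp_inj_on[OF center_bij] _ assms(1,2)])
  show "a \<odot>\<^bsub>center C\<^esub> \<one>\<^bsub>center C\<^esub> = b \<odot>\<^bsub>center C\<^esub> \<one>\<^bsub>center C\<^esub>"
    unfolding center_smult_one using assms(3) by (rule restrict_ext)
qed

lemma Auteq_isos:
  assumes "F \<in> Auteq"
  obtains F' \<eta> \<theta> where "F' \<in> Auteq" "nat_iso C id_functor (F' \<bullet> F) \<eta>" "nat_iso C (F \<bullet> F') id_functor \<theta>"
  using Auteq_inverse[OF assms] unfolding isomorphic_def by metis

text \<open>
  Let \<open>F'\<close> be a quasi-inverse of \<open>F\<close>, with \<open>\<theta> : F F' \<rightarrow> Id\<close> and \<open>\<eta> : Id \<rightarrow> F' F\<close>.  Conjugating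
  \<open>\<alpha> F'\<close> by \<open>\<theta>\<close> gives an endomorphism of the identity, hence a scalar.  This determines \<open>\<alpha>\<close> on the
  objects \<open>F' Y\<close>, and \<open>\<eta>\<close> transports the result to all objects, each \<open>X\<close> being isomorphic to
  \<open>F' (F X)\<close>.
\<close>

lemma endo_scalar:
  assumes F: "F \<in> Auteq" and \<alpha>: "nat_trans C F F \<alpha>"
  obtains c where "c \<in> carrier K" "\<And>X. X \<in> Obj C \<Longrightarrow> \<alpha> X = c \<ast> Ident C (ob F X)"
proof -
  obtain F' \<eta> \<theta> where F': "F' \<in> Auteq" and \<eta>: "nat_iso C id_functor (F' \<bullet> F) \<eta>"
    and \<theta>: "nat_iso C (F \<bullet> F') id_functor \<theta>"
    using Auteq_isos[OF F] .
  note lin = Auteq_lin[OF F] Auteq_lin[OF F']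
  have FF': "lin (F \<bullet> F')" "lin (F' \<bullet> F)"
    using lin by simp_all
  obtain \<theta>' where \<theta>': "nat_iso C id_functor (F \<bullet> F') \<theta>'"
      "\<forall>X \<in> Obj C. \<theta>' X \<star> \<theta> X = Ident C (ob (F \<bullet> F') X)"
      "\<forall>X \<in> Obj C. \<theta> X \<star> \<theta>' X = Ident C (ob (id_functor :: ('o, 'm) endofunctor) X)"
    by (rule nat_iso_inverse[OF \<theta> FF'(1) lin_id])
  note arr = nat_trans_arr[OF \<alpha> lin(1,1)] nat_iso_arr[OF \<theta> FF'(1) lin_id]
    nat_iso_arr[OF \<theta>'(1) lin_id FF'(1)] nat_iso_arr[OF \<eta> lin_id FF'(2)]
  have \<alpha>F': "nat_trans C (F \<bullet> F') (F \<bullet> F') (\<alpha> \<lhd>\<^sub>w F')"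
    by (rule nat_transI) (use arr lin nat_trans_natural[OF \<alpha>] in \<open>auto simp: whisker_right_def\<close>)
  have "nat_trans C id_functor id_functor (\<theta> \<circ>\<^bsub>C\<^esub> (\<alpha> \<lhd>\<^sub>w F') \<circ>\<^bsub>C\<^esub> \<theta>')"
    using \<alpha>F' \<theta> \<theta>'(1) FF'(1) unfolding nat_iso_def by (meson lin_id nat_trans_comp)
  then obtain c where c: "c \<in> carrier K"
    and c_eq: "\<And>X. X \<in> Obj C \<Longrightarrow> (\<theta> \<circ>\<^bsub>C\<^esub> (\<alpha> \<lhd>\<^sub>w F') \<circ>\<^bsub>C\<^esub> \<theta>') X = c \<ast> Ident C X"
    using endo_id_scalar by blast
  have on_F': "\<alpha> (ob F' Y) = c \<ast> Ident C (ob F (ob F' Y))" if Y: "Y \<in> Obj C" for Y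
  proof -
    have "\<theta> Y \<star> \<alpha> (ob F' Y) = (\<theta> Y \<star> \<alpha> (ob F' Y) \<star> \<theta>' Y) \<star> \<theta> Y"
      using Y arr lin bspec[OF \<theta>'(2) Y] by (simp add: after_assoc)
    also have "\<dots> = (c \<ast> Ident C Y) \<star> \<theta> Y"
      using c_eq[OF Y] by (simp only: nt_comp_def whisker_right_def)
    also have "\<dots> = \<theta> Y \<star> c \<ast> Ident C (ob F (ob F' Y))"
      using Y c lin by (simp add: arr)
    finally show ?thesis
      using Y c arr lin by - (rule nat_iso_cancel_left[OF \<theta> FF'(1) lin_id Y], auto)
  qed
  have "\<alpha> X = c \<ast> Ident C (ob F X)" if X: "X \<in> Obj C" for X
  proof -
    have "nat_iso C (F \<bullet> id_functor) (F \<bullet> (F' \<bullet> F)) (F \<rhd> \<eta>)"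
      using nat_iso_whisker_left[OF \<eta> lin_id FF'(2) lin(1)] .
    then have F\<eta>: "nat_iso C F (F \<bullet> F' \<bullet> F) (F \<rhd> \<eta>)"
      by simp
    have "ar F (\<eta> X) \<star> \<alpha> X = \<alpha> (ob F' (ob F X)) \<star> ar F (\<eta> X)"
      using X arr lin by (simp add: nat_trans_natural[OF \<alpha>])
    also have "\<dots> = ar F (\<eta> X) \<star> c \<ast> Ident C (ob F X)"
      using X c arr lin by (simp add: on_F')
    finally have "(F \<rhd> \<eta>) X \<star> \<alpha> X = (F \<rhd> \<eta>) X \<star> c \<ast> Ident C (ob F X)"
      by (simp add: whisker_left_def)
    then show ?thesis
      using X c arr lin by - (rule nat_iso_cancel_left[OF F\<eta> _ _ X], auto)
  qed
  then show thesis
    using c that by blast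
qed

text \<open>
  A scalar is determined by its action on identities of all objects.  Cancelling \<open>\<beta>\<close> determines it
  on the objects \<open>F X\<close>, and every object is isomorphic to one of these.
\<close>

lemma scale_unique:
  assumes F: "F \<in> Auteq" and F': "lin F'" and \<beta>: "nat_iso C F F' \<beta>"
    and ab: "a \<in> carrier K" "b \<in> carrier K" "\<And>X. X \<in> Obj C \<Longrightarrow> a \<ast> \<beta> X = b \<ast> \<beta> X"
  shows "a = b"
proof (rule scalar_id_inj[OF ab(1,2)])
  fix Y assume Y: "Y \<in> Obj C"
  obtain P \<eta> \<theta> where P: "P \<in> Auteq" and \<theta>: "nat_iso C (F \<bullet> P) id_functor \<theta>"
    using Auteq_isos[OF F] .
  note lin = Auteq_lin[OF F] Auteq_lin[OF P]
  have FP: "lin (F \<bullet> P)"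
    using lin by simp
  have X: "ob P Y \<in> Obj C"
    using Y lin by simp
  note arr = nat_iso_arr[OF \<beta> lin(1) F' X] nat_iso_arr[OF \<theta> FP lin_id Y]
  have "\<beta> (ob P Y) \<star> a \<ast> Ident C (ob F (ob P Y)) = \<beta> (ob P Y) \<star> b \<ast> Ident C (ob F (ob P Y))"
    using X arr ab lin by simp
  then have "a \<ast> Ident C (ob F (ob P Y)) = b \<ast> Ident C (ob F (ob P Y))"
    using X arr ab lin by - (rule nat_iso_cancel_left[OF \<beta> lin(1) F' X], auto)
  then have "\<theta> Y \<star> a \<ast> Ident C (ob F (ob P Y)) = \<theta> Y \<star> b \<ast> Ident C (ob F (ob P Y))"
    by simp
  then have "(a \<ast> Ident C Y) \<star> \<theta> Y = (b \<ast> Ident C Y) \<star> \<theta> Y"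
    using X Y arr ab lin by simp
  then show "a \<ast> Ident C Y = b \<ast> Ident C Y"
    using Y arr ab lin by - (rule nat_iso_cancel_right[OF \<theta> FP lin_id Y], auto)
qed

text \<open>
  Composing \<open>\<alpha>\<close> with the inverse of \<open>\<beta>\<close> gives an endomorphism of \<open>F\<close>, hence a scalar.  It is a unit
  since the roles of \<open>\<alpha>\<close> and \<open>\<beta>\<close> can be exchanged.
\<close>

theorem nat_iso_proportional:
  assumes F: "F \<in> Auteq" "lin F'" and \<alpha>: "nat_iso C F F' \<alpha>" and \<beta>: "nat_iso C F F' \<beta>"
  obtains c where "c \<in> Units K" "\<And>X. X \<in> Obj C \<Longrightarrow> \<alpha> X = c \<ast> \<beta> X"
proof -
  have multiple: "\<exists>c \<in> carrier K. \<forall>X \<in> Obj C. \<alpha> X = c \<ast> \<beta> X"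
    if \<alpha>: "nat_iso C F F' \<alpha>" and \<beta>: "nat_iso C F F' \<beta>" for \<alpha> \<beta>
  proof -
    note lin = Auteq_lin[OF F(1)] F(2)
    obtain \<gamma> where \<gamma>: "nat_iso C F' F \<gamma>"
        "\<forall>X \<in> Obj C. \<gamma> X \<star> \<beta> X = Ident C (ob F X)"
        "\<forall>X \<in> Obj C. \<beta> X \<star> \<gamma> X = Ident C (ob F' X)"
      by (rule nat_iso_inverse[OF \<beta> lin])
    have "nat_trans C F F (\<gamma> \<circ>\<^bsub>C\<^esub> \<alpha>)"
      using \<alpha> \<gamma>(1) lin unfolding nat_iso_def by (meson nat_trans_comp)
    then obtain c where c: "c \<in> carrier K" "\<And>X. X \<in> Obj C \<Longrightarrow> (\<gamma> \<circ>\<^bsub>C\<^esub> \<alpha>) X = c \<ast> Ident C (ob F X)"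
      using endo_scalar[OF F(1)] by blast
    note arr = nat_iso_arr[OF \<alpha> lin] nat_iso_arr[OF \<beta> lin] nat_iso_arr[OF \<gamma>(1) lin(2,1)]
    have "\<alpha> X = c \<ast> \<beta> X" if X: "X \<in> Obj C" for X
    proof -
      have "\<alpha> X = (\<beta> X \<star> \<gamma> X) \<star> \<alpha> X"
        using X arr lin by (simp add: \<gamma>)
      also have "\<dots> = \<beta> X \<star> c \<ast> Ident C (ob F X)"
        using X arr lin c(2)[OF X] by (simp add: after_assoc nt_comp_def)
      finally show ?thesis
        using X arr lin c(1) by simp
    qed
    then show ?thesis
      using c(1) by blast
  qed
  obtain c where c: "c \<in> carrier K" "\<And>X. X \<in> Obj C \<Longrightarrow> \<alpha> X = c \<ast> \<beta> X"
    using multiple[OF \<alpha> \<beta>] by blast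
  obtain d where d: "d \<in> carrier K" "\<And>X. X \<in> Obj C \<Longrightarrow> \<beta> X = d \<ast> \<alpha> X"
    using multiple[OF \<beta> \<alpha>] by blast
  have "c \<otimes> d = \<one>"
  proof (rule scale_unique[OF F \<alpha>])
    fix X assume X: "X \<in> Obj C"
    have arr: "\<alpha> X \<in> Arr"
      using nat_iso_arr[OF \<alpha> Auteq_lin[OF F(1)] F(2) X] by simp
    have "(c \<otimes> d) \<ast> \<alpha> X = c \<ast> d \<ast> \<alpha> X"
      using arr c(1) d(1) by simp
    also have "\<dots> = \<alpha> X"
      by (simp only: d(2)[OF X, symmetric] c(2)[OF X, symmetric])
    also have "\<dots> = \<one> \<ast> \<alpha> X"
      using arr by simp
    finally show "(c \<otimes> d) \<ast> \<alpha> X = \<one> \<ast> \<alpha> X" .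
  qed (use c d in auto)
  then have "c \<in> Units K"
    using c(1) d(1) m_comm[OF c(1) d(1)] unfolding Units_def by (auto intro!: bexI[of _ d])
  then show thesis
    using c(2) that by blast
qed

end


section \<open>Characters and second cohomology\<close>

lemma comm_group_product:
  assumes "\<And>i. i \<in> I \<Longrightarrow> comm_group (H i)"
  shows "comm_group (product_group I H)"
proof (rule group.group_comm_groupI)
  show "group (product_group I H)"
    using assms by (intro product_group) (auto simp: comm_group_def)
  show "x \<otimes>\<^bsub>product_group I H\<^esub> y = y \<otimes>\<^bsub>product_group I H\<^esub> x"
    if "x \<in> carrier (product_group I H)" "y \<in> carrier (product_group I H)" for x y
  proof -
    have "x i \<otimes>\<^bsub>H i\<^esub> y i = y i \<otimes>\<^bsub>H i\<^esub> x i" if "i \<in> I" for i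
      using assms[OF that] that \<open>x \<in> _\<close> \<open>y \<in> _\<close>
      by (auto intro!: comm_monoid.m_comm simp: comm_group_def)
    then show ?thesis
      by (auto intro!: restrict_ext)
  qed
qed

locale trivial_coefficients = K: cring K + G: group G
  for K :: "('k, 'r) ring_scheme" and G :: "('g, 's) monoid_scheme"
begin

lemma units_swap:
  "\<lbrakk>u \<in> Units K; v \<in> Units K; w \<in> Units K; z \<in> Units K\<rbrakk> \<Longrightarrow>
    u \<otimes>\<^bsub>K\<^esub> v \<otimes>\<^bsub>K\<^esub> (w \<otimes>\<^bsub>K\<^esub> z) = u \<otimes>\<^bsub>K\<^esub> w \<otimes>\<^bsub>K\<^esub> (v \<otimes>\<^bsub>K\<^esub> z)"
  by (simp add: K.m_ac K.Units_closed)

lemma units_comm_group: "comm_group (units_of K)"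
  by (rule K.units_comm_group)

lemma units_of_simps [simp]:
  "carrier (units_of K) = Units K" "monoid.mult (units_of K) = monoid.mult K" "one (units_of K) = one K"
  by (simp_all add: units_of_carrier units_of_mult units_of_one)

lemma character_group: "group (character_group G K)"
proof -
  interpret P: comm_group "product_group (carrier G) (\<lambda>_. units_of K)"
    by (intro comm_group_product units_comm_group)
  have "subgroup (hom G (units_of K) \<inter> extensional (carrier G)) (product_group (carrier G) (\<lambda>_. units_of K))"
  proof (rule P.subgroupI)
    show "hom G (units_of K) \<inter> extensional (carrier G) \<subseteq> carrier (product_group (carrier G) (\<lambda>_. units_of K))"
      by (auto simp: hom_def PiE_def)
    have "(\<lambda>g \<in> carrier G. \<one>\<^bsub>K\<^esub>) \<in> hom G (units_of K) \<inter> extensional (carrier G)"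
      by (auto simp: hom_def)
    then show "hom G (units_of K) \<inter> extensional (carrier G) \<noteq> {}"
      by blast
  next
    fix a assume a: "a \<in> hom G (units_of K) \<inter> extensional (carrier G)"
    then have aU: "a \<in> carrier G \<rightarrow>\<^sub>E Units K"
      by (auto simp: hom_def PiE_def)
    interpret U: comm_group "units_of K"
      by (rule units_comm_group)
    have "inv\<^bsub>product_group (carrier G) (\<lambda>_. units_of K)\<^esub> a = (\<lambda>g \<in> carrier G. inv\<^bsub>units_of K\<^esub> a g)"
      using aU by (intro inv_product_group) auto
    moreover have "inv\<^bsub>units_of K\<^esub> a (g \<otimes>\<^bsub>G\<^esub> h) = inv\<^bsub>units_of K\<^esub> a g \<otimes>\<^bsub>K\<^esub> inv\<^bsub>units_of K\<^esub> a h"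
      if "g \<in> carrier G" "h \<in> carrier G" for g h
      using a aU that U.inv_mult[of "a g" "a h"] by (auto simp: hom_def)
    ultimately show "inv\<^bsub>product_group (carrier G) (\<lambda>_. units_of K)\<^esub> a \<in> hom G (units_of K) \<inter> extensional (carrier G)"
      using aU U.inv_closed by (auto simp: hom_def)
  next
    fix a b assume ab: "a \<in> hom G (units_of K) \<inter> extensional (carrier G)"
      "b \<in> hom G (units_of K) \<inter> extensional (carrier G)"
    then have "a g \<otimes>\<^bsub>K\<^esub> a h \<otimes>\<^bsub>K\<^esub> (b g \<otimes>\<^bsub>K\<^esub> b h) = a g \<otimes>\<^bsub>K\<^esub> b g \<otimes>\<^bsub>K\<^esub> (a h \<otimes>\<^bsub>K\<^esub> b h)"
      if "g \<in> carrier G" "h \<in> carrier G" for g h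
      using that ab by (intro units_swap) (auto simp: hom_def)
    then show "a \<otimes>\<^bsub>product_group (carrier G) (\<lambda>_. units_of K)\<^esub> b \<in> hom G (units_of K) \<inter> extensional (carrier G)"
      using ab by (auto simp: hom_def Pi_iff)
  qed
  then show ?thesis
    unfolding character_group_def by (rule P.subgroup_imp_group)
qed

lemma character_group_iff:
  "\<chi> \<in> carrier (character_group G K) \<longleftrightarrow> \<chi> \<in> extensional (carrier G) \<and> \<chi> \<in> carrier G \<rightarrow> Units K \<and>
    (\<forall>g \<in> carrier G. \<forall>h \<in> carrier G. \<chi> (g \<otimes>\<^bsub>G\<^esub> h) = \<chi> g \<otimes>\<^bsub>K\<^esub> \<chi> h)"
  by (auto simp: character_group_def hom_def)

lemma character_mult: "\<chi> \<otimes>\<^bsub>character_group G K\<^esub> \<psi> = (\<lambda>g \<in> carrier G. \<chi> g \<otimes>\<^bsub>K\<^esub> \<psi> g)"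
  by (simp add: character_group_def)

lemma character_one: "\<one>\<^bsub>character_group G K\<^esub> = (\<lambda>g \<in> carrier G. \<one>\<^bsub>K\<^esub>)"
  by (simp add: character_group_def)

lemma cochains2_comm_group: "comm_group (cochains2 G K)"
  unfolding cochains2_def by (intro comm_group_product units_comm_group)

lemma cochains2_simps:
  "carrier (cochains2 G K) = carrier G \<times> carrier G \<rightarrow>\<^sub>E Units K"
  "c \<otimes>\<^bsub>cochains2 G K\<^esub> d = (\<lambda>x \<in> carrier G \<times> carrier G. c x \<otimes>\<^bsub>K\<^esub> d x)"
  "\<one>\<^bsub>cochains2 G K\<^esub> = (\<lambda>x \<in> carrier G \<times> carrier G. \<one>\<^bsub>K\<^esub>)"
  by (simp_all add: cochains2_def)

lemma cocycles2_iff: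
  "c \<in> carrier (cocycles2 G K) \<longleftrightarrow> c \<in> carrier G \<times> carrier G \<rightarrow>\<^sub>E Units K \<and>
    (\<forall>g \<in> carrier G. \<forall>h \<in> carrier G. \<forall>l \<in> carrier G.
      c (g \<otimes>\<^bsub>G\<^esub> h, l) \<otimes>\<^bsub>K\<^esub> c (g, h) = c (g, h \<otimes>\<^bsub>G\<^esub> l) \<otimes>\<^bsub>K\<^esub> c (h, l))"
  by (simp add: cocycles2_def cochains2_simps)

lemma cocycles2_mult: "c \<otimes>\<^bsub>cocycles2 G K\<^esub> d = (\<lambda>x \<in> carrier G \<times> carrier G. c x \<otimes>\<^bsub>K\<^esub> d x)"
  by (simp add: cocycles2_def cochains2_simps)

lemma cocycles2_comm_group: "comm_group (cocycles2 G K)"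
proof -
  interpret P: comm_group "cochains2 G K"
    by (rule cochains2_comm_group)
  interpret U: comm_group "units_of K"
    by (rule units_comm_group)
  let ?Z = "carrier (cocycles2 G K)"
  have "subgroup ?Z (cochains2 G K)"
  proof (rule P.subgroupI)
    show "?Z \<subseteq> carrier (cochains2 G K)"
      by (auto simp: cocycles2_def)
    have "\<one>\<^bsub>cochains2 G K\<^esub> \<in> ?Z"
      by (auto simp: cocycles2_iff cochains2_simps)
    then show "?Z \<noteq> {}"
      by blast
  next
    fix c assume c: "c \<in> ?Z"
    then have cU: "c \<in> carrier G \<times> carrier G \<rightarrow>\<^sub>E Units K"
      by (simp add: cocycles2_iff)
    have inv: "inv\<^bsub>cochains2 G K\<^esub> c = (\<lambda>x \<in> carrier G \<times> carrier G. inv\<^bsub>units_of K\<^esub> c x)"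
      unfolding cochains2_def using cU by (intro inv_product_group) auto
    have U: "c (x, y) \<in> Units K" if "x \<in> carrier G" "y \<in> carrier G" for x y
      using cU that by auto
    have "inv\<^bsub>units_of K\<^esub> c (g \<otimes>\<^bsub>G\<^esub> h, l) \<otimes>\<^bsub>K\<^esub> inv\<^bsub>units_of K\<^esub> c (g, h)
        = inv\<^bsub>units_of K\<^esub> c (g, h \<otimes>\<^bsub>G\<^esub> l) \<otimes>\<^bsub>K\<^esub> inv\<^bsub>units_of K\<^esub> c (h, l)"
      if "g \<in> carrier G" "h \<in> carrier G" "l \<in> carrier G" for g h l
      using c that U.inv_mult[of "c (g \<otimes>\<^bsub>G\<^esub> h, l)" "c (g, h)"] U.inv_mult[of "c (g, h \<otimes>\<^bsub>G\<^esub> l)" "c (h, l)"]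
      by (simp add: U cocycles2_iff)
    then show "inv\<^bsub>cochains2 G K\<^esub> c \<in> ?Z"
      using U.inv_closed U by (auto simp: inv cocycles2_iff)
  next
    fix c d assume cd: "c \<in> ?Z" "d \<in> ?Z"
    have U: "c (x, y) \<in> Units K" "d (x, y) \<in> Units K" if "x \<in> carrier G" "y \<in> carrier G" for x y
      using cd that by (auto simp: cocycles2_iff)
    show "c \<otimes>\<^bsub>cochains2 G K\<^esub> d \<in> ?Z"
      using cd by (auto simp: cocycles2_iff cochains2_simps U units_swap)
  qed
  then have "group ((cochains2 G K)\<lparr>carrier := ?Z\<rparr>)"
    by (rule P.subgroup_imp_group)
  then have "group (cocycles2 G K)"
    by (simp add: cocycles2_def)
  then show ?thesis
    by (rule group.group_comm_groupI)
      (auto simp: cocycles2_mult cocycles2_iff K.m_comm K.Units_closed PiE_iff intro!: restrict_ext)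
qed

definition coboundary :: "('g \<Rightarrow> 'k) \<Rightarrow> 'g \<times> 'g \<Rightarrow> 'k" where
  "coboundary b = (\<lambda>(g, h) \<in> carrier G \<times> carrier G. b g \<otimes>\<^bsub>K\<^esub> b h \<otimes>\<^bsub>K\<^esub> inv\<^bsub>K\<^esub> (b (g \<otimes>\<^bsub>G\<^esub> h)))"

lemma coboundaries2_eq: "coboundaries2 G K = coboundary ` (carrier G \<rightarrow> Units K)"
  unfolding coboundaries2_def coboundary_def by blast

lemma coboundary_at:
  "\<lbrakk>g \<in> carrier G; h \<in> carrier G\<rbrakk> \<Longrightarrow> coboundary b (g, h) = b g \<otimes>\<^bsub>K\<^esub> b h \<otimes>\<^bsub>K\<^esub> inv\<^bsub>K\<^esub> (b (g \<otimes>\<^bsub>G\<^esub> h))"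
  by (simp add: coboundary_def)

text \<open>
  Both sides of the cocycle identity become \<open>b g \<cdot> b h \<cdot> b l\<close> when multiplied by \<open>b (g h l)\<close>.
\<close>

lemma coboundary_cocycle:
  assumes b: "b \<in> carrier G \<rightarrow> Units K"
  shows "coboundary b \<in> carrier (cocycles2 G K)"
proof -
  have U: "b x \<in> Units K" "b x \<in> carrier K" "inv\<^bsub>K\<^esub> b x \<in> Units K" "inv\<^bsub>K\<^esub> b x \<in> carrier K"
    if "x \<in> carrier G" for x
    using b that by (auto simp: K.Units_closed)
  \<comment> \<open>This characterises the coboundary without inverses.\<close>
  have key: "coboundary b (x, y) \<otimes>\<^bsub>K\<^esub> b (x \<otimes>\<^bsub>G\<^esub> y) = b x \<otimes>\<^bsub>K\<^esub> b y"
    if "x \<in> carrier G" "y \<in> carrier G" for x y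
    using that U by (simp add: coboundary_at K.m_assoc)
  have cU: "coboundary b (x, y) \<in> Units K" if "x \<in> carrier G" "y \<in> carrier G" for x y
    using that U by (simp add: coboundary_at)
  have "coboundary b (g \<otimes>\<^bsub>G\<^esub> h, l) \<otimes>\<^bsub>K\<^esub> coboundary b (g, h)
      = coboundary b (g, h \<otimes>\<^bsub>G\<^esub> l) \<otimes>\<^bsub>K\<^esub> coboundary b (h, l)"
    if ghl: "g \<in> carrier G" "h \<in> carrier G" "l \<in> carrier G" for g h l
  proof -
    let ?gh = "g \<otimes>\<^bsub>G\<^esub> h" and ?hl = "h \<otimes>\<^bsub>G\<^esub> l" and ?ghl = "g \<otimes>\<^bsub>G\<^esub> h \<otimes>\<^bsub>G\<^esub> l"
    note C = U(2) cU[THEN K.Units_closed]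
    have "coboundary b (?gh, l) \<otimes>\<^bsub>K\<^esub> coboundary b (g, h) \<otimes>\<^bsub>K\<^esub> b ?ghl
        = coboundary b (g, h) \<otimes>\<^bsub>K\<^esub> (coboundary b (?gh, l) \<otimes>\<^bsub>K\<^esub> b ?ghl)"
      using ghl by (simp add: K.m_ac C)
    also have "\<dots> = (coboundary b (g, h) \<otimes>\<^bsub>K\<^esub> b ?gh) \<otimes>\<^bsub>K\<^esub> b l"
      unfolding key[OF G.m_closed[OF ghl(1,2)] ghl(3)] using ghl by (simp add: K.m_assoc C)
    also have "\<dots> = b g \<otimes>\<^bsub>K\<^esub> (b h \<otimes>\<^bsub>K\<^esub> b l)"
      unfolding key[OF ghl(1,2)] using ghl by (simp add: K.m_assoc C)
    also have "\<dots> = b g \<otimes>\<^bsub>K\<^esub> (coboundary b (h, l) \<otimes>\<^bsub>K\<^esub> b ?hl)"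
      using ghl by (simp add: key)
    also have "\<dots> = coboundary b (h, l) \<otimes>\<^bsub>K\<^esub> (b g \<otimes>\<^bsub>K\<^esub> b ?hl)"
      using ghl by (simp add: K.m_ac C)
    also have "b g \<otimes>\<^bsub>K\<^esub> b ?hl = coboundary b (g, ?hl) \<otimes>\<^bsub>K\<^esub> b ?ghl"
      using ghl key[of g ?hl] by (simp add: G.m_assoc)
    also have "coboundary b (h, l) \<otimes>\<^bsub>K\<^esub> (coboundary b (g, ?hl) \<otimes>\<^bsub>K\<^esub> b ?ghl)
        = coboundary b (g, ?hl) \<otimes>\<^bsub>K\<^esub> coboundary b (h, l) \<otimes>\<^bsub>K\<^esub> b ?ghl"
      using ghl by (simp add: K.m_ac C)
    finally show ?thesis
      using ghl K.Units_l_cancel[of "b ?ghl"] by (simp add: C U(1) K.m_comm[of _ "b ?ghl"])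
  qed
  then show ?thesis
    using cU by (auto simp: cocycles2_iff coboundary_def)
qed

lemma coboundary_mult:
  assumes "b \<in> carrier G \<rightarrow> Units K" "b' \<in> carrier G \<rightarrow> Units K"
  shows "coboundary b \<otimes>\<^bsub>cocycles2 G K\<^esub> coboundary b' = coboundary (\<lambda>g. b g \<otimes>\<^bsub>K\<^esub> b' g)"
proof -
  interpret U: comm_group "units_of K"
    by (rule units_comm_group)
  have U: "b x \<in> Units K" "b' x \<in> Units K" if "x \<in> carrier G" for x
    using assms that by auto
  have inv: "inv\<^bsub>K\<^esub> (b x \<otimes>\<^bsub>K\<^esub> b' x) = inv\<^bsub>K\<^esub> (b x) \<otimes>\<^bsub>K\<^esub> inv\<^bsub>K\<^esub> (b' x)" if "x \<in> carrier G" for x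
    using U.inv_mult[of "b x" "b' x"] U[OF that] by (simp add: K.units_of_inv)
  show ?thesis
    by (auto simp: cocycles2_mult coboundary_def inv U K.Units_closed K.m_ac intro!: restrict_ext)
qed

text \<open>
  The coboundaries are the image of the homomorphism \<open>coboundary\<close>, defined on the group of
  \<open>1\<close>-cochains.
\<close>

lemma coboundaries2_subgroup: "subgroup (coboundaries2 G K) (cocycles2 G K)"
proof -
  let ?P = "product_group (carrier G) (\<lambda>_. units_of K)"
  interpret P: comm_group ?P
    by (intro comm_group_product units_comm_group)
  interpret Z: comm_group "cocycles2 G K"
    by (rule cocycles2_comm_group)
  \<comment> \<open>The functions \<open>b\<close> in the definition of coboundaries may take any values outside \<open>G\<close>.\<close>
  have restr: "coboundary (restrict b (carrier G)) = coboundary b" for b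
    by (auto simp: coboundary_def intro!: restrict_ext)
  have "group_hom ?P (cocycles2 G K) coboundary"
  proof (rule group_hom.intro[OF P.is_group Z.is_group], rule group_hom_axioms.intro, rule homI)
    show "coboundary b \<in> carrier (cocycles2 G K)" if "b \<in> carrier ?P" for b
      using that by (intro coboundary_cocycle) (auto simp: PiE_def)
    show "coboundary (b \<otimes>\<^bsub>?P\<^esub> b') = coboundary b \<otimes>\<^bsub>cocycles2 G K\<^esub> coboundary b'"
      if "b \<in> carrier ?P" "b' \<in> carrier ?P" for b b'
      using that coboundary_mult[of b b'] by (simp add: restr PiE_def)
  qed
  then have "subgroup (coboundary ` carrier ?P) (cocycles2 G K)"
    by (rule group_hom.img_is_subgroup)
  moreover have "coboundary ` carrier ?P = coboundaries2 G K"
  proof -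
    have "coboundary b \<in> coboundary ` (carrier G \<rightarrow>\<^sub>E Units K)" if "b \<in> carrier G \<rightarrow> Units K" for b
      using that by (intro image_eqI[of _ _ "restrict b (carrier G)"]) (simp_all add: restr)
    then show ?thesis
      unfolding coboundaries2_eq by (auto simp: PiE_def)
  qed
  ultimately show ?thesis
    by simp
qed

lemma coboundaries2_normal: "coboundaries2 G K \<lhd> cocycles2 G K"
  by (rule comm_group.subgroup_imp_normal[OF cocycles2_comm_group coboundaries2_subgroup])

lemma H2_group: "group (H2 G K)"
  unfolding H2_def by (rule normal.factorgroup_is_group[OF coboundaries2_normal])

lemma H2_carrier: "c \<in> carrier (cocycles2 G K) \<Longrightarrow> cohomology_class G K c \<in> carrier (H2 G K)"
  by (simp add: H2_def cohomology_class_def carrier_FactGroup)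

lemma H2_mult:
  "\<lbrakk>c \<in> carrier (cocycles2 G K); d \<in> carrier (cocycles2 G K)\<rbrakk> \<Longrightarrow>
    cohomology_class G K c \<otimes>\<^bsub>H2 G K\<^esub> cohomology_class G K d = cohomology_class G K (c \<otimes>\<^bsub>cocycles2 G K\<^esub> d)"
  unfolding H2_def cohomology_class_def mult_FactGroup by (rule normal.rcos_sum[OF coboundaries2_normal])

lemma cohomology_class_trivial_iff:
  assumes c: "c \<in> carrier (cocycles2 G K)"
  shows "cohomology_class G K c = \<one>\<^bsub>H2 G K\<^esub> \<longleftrightarrow> c \<in> coboundaries2 G K"
proof -
  interpret Z: comm_group "cocycles2 G K"
    by (rule cocycles2_comm_group)
  show ?thesis
    unfolding H2_def cohomology_class_def one_FactGroup
    using Z.coset_join1[OF _ c coboundaries2_subgroup] Z.coset_join2[OF c coboundaries2_subgroup]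
      subgroup.subset[OF coboundaries2_subgroup] by blast
qed

text \<open>
  The hypothesis says \<open>c' = (coboundary b) c\<close>, in the form in which the scalars of
  \<open>defect_intertwined\<close> arise.
\<close>

lemma cohomology_class_eqI:
  assumes c: "c \<in> carrier (cocycles2 G K)" and c': "c' \<in> carrier (cocycles2 G K)"
    and b: "b \<in> carrier G \<rightarrow> Units K"
    and eq: "\<And>g h. \<lbrakk>g \<in> carrier G; h \<in> carrier G\<rbrakk> \<Longrightarrow>
      c (g, h) \<otimes>\<^bsub>K\<^esub> (b g \<otimes>\<^bsub>K\<^esub> b h) = b (g \<otimes>\<^bsub>G\<^esub> h) \<otimes>\<^bsub>K\<^esub> c' (g, h)"
  shows "cohomology_class G K c = cohomology_class G K c'"
proof -
  interpret Z: comm_group "cocycles2 G K"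
    by (rule cocycles2_comm_group)
  have U: "b x \<in> Units K" "b x \<in> carrier K" "inv\<^bsub>K\<^esub> b x \<in> carrier K" if "x \<in> carrier G" for x
    using b that by (auto simp: K.Units_closed)
  have cU: "c (x, y) \<in> carrier K" "c' (x, y) \<in> carrier K" if "x \<in> carrier G" "y \<in> carrier G" for x y
    using c c' that by (auto simp: cocycles2_iff K.Units_closed)
  have "(coboundary b \<otimes>\<^bsub>cocycles2 G K\<^esub> c) x = c' x" for x
  proof (cases "x \<in> carrier G \<times> carrier G")
    case True
    then obtain g h where x: "x = (g, h)" and gh: "g \<in> carrier G" "h \<in> carrier G"
      by blast
    have "coboundary b (g, h) \<otimes>\<^bsub>K\<^esub> c (g, h)
        = inv\<^bsub>K\<^esub> b (g \<otimes>\<^bsub>G\<^esub> h) \<otimes>\<^bsub>K\<^esub> (c (g, h) \<otimes>\<^bsub>K\<^esub> (b g \<otimes>\<^bsub>K\<^esub> b h))"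
      using gh by (simp add: coboundary_at U cU K.m_ac)
    also have "\<dots> = (inv\<^bsub>K\<^esub> b (g \<otimes>\<^bsub>G\<^esub> h) \<otimes>\<^bsub>K\<^esub> b (g \<otimes>\<^bsub>G\<^esub> h)) \<otimes>\<^bsub>K\<^esub> c' (g, h)"
      using gh by (simp only: eq) (simp add: U cU K.m_assoc del: K.Units_l_inv)
    also have "\<dots> = c' (g, h)"
      using gh by (simp add: U cU)
    finally show ?thesis
      using gh by (simp add: x cocycles2_mult)
  next
    case False
    moreover have "c' x = undefined"
      using c' False unfolding cocycles2_iff by (blast intro: PiE_arb)
    ultimately show ?thesis
      unfolding cocycles2_mult by simp
  qed
  then have "coboundary b \<otimes>\<^bsub>cocycles2 G K\<^esub> c = c'"
    by (rule ext)
  then have "coboundaries2 G K #>\<^bsub>cocycles2 G K\<^esub> c'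
      = coboundaries2 G K #>\<^bsub>cocycles2 G K\<^esub> (coboundary b \<otimes>\<^bsub>cocycles2 G K\<^esub> c)"
    by simp
  also have "\<dots> = (coboundaries2 G K #>\<^bsub>cocycles2 G K\<^esub> coboundary b) #>\<^bsub>cocycles2 G K\<^esub> c"
    using Z.coset_mult_assoc[OF subgroup.subset[OF coboundaries2_subgroup] coboundary_cocycle[OF b] c] by simp
  also have "coboundaries2 G K #>\<^bsub>cocycles2 G K\<^esub> coboundary b = coboundaries2 G K"
    using b by (intro Z.coset_join2[OF coboundary_cocycle[OF b] coboundaries2_subgroup]) (simp add: coboundaries2_eq)
  finally show ?thesis
    unfolding cohomology_class_def by simp
qed

end


section \<open>The obstruction cocycle\<close>

locale scalar_action = linear_group_action K C G T \<epsilon> + scalar_center K C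
  for K :: "('k, 'r) ring_scheme" (structure) and C :: "('k, 'o, 'm) lincat"
    and G :: "('g, 's) monoid_scheme" (structure)
    and T :: "'g \<Rightarrow> ('o, 'm) endofunctor" and \<epsilon> :: "'g \<Rightarrow> 'g \<Rightarrow> 'o \<Rightarrow> 'm"
begin

abbreviation gmult :: "'g \<Rightarrow> 'g \<Rightarrow> 'g"  (infixl \<open>\<odot>\<^sub>G\<close> 70) where
  "g \<odot>\<^sub>G h \<equiv> g \<otimes>\<^bsub>G\<^esub> h"

lemma gmult_closed [simp]: "\<lbrakk>g \<in> carrier G; h \<in> carrier G\<rbrakk> \<Longrightarrow> g \<odot>\<^sub>G h \<in> carrier G"
  by (rule monoid.m_closed[OF group.is_monoid[OF group_axioms]])

lemma unit_closed [simp]: "u \<in> Units K \<Longrightarrow> u \<in> carrier K"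
  by (simp add: Units_def)

lemma unit_one [simp]: "\<one>\<^bsub>K\<^esub> \<in> Units K"
  by (rule monoid.Units_one_closed[OF ring.is_monoid[OF ring_axioms]])

lemma unit_cancel:
  assumes "u \<in> Units K" "x \<in> carrier K" "y \<in> carrier K" "x \<otimes>\<^bsub>K\<^esub> u = y \<otimes>\<^bsub>K\<^esub> u"
  shows "x = y"
  using assms monoid.Units_l_cancel[OF ring.is_monoid[OF ring_axioms], of u x y] by (simp add: m_comm[of _ u])

lemma T_Auteq [simp]: "g \<in> carrier G \<Longrightarrow> T g \<in> Auteq"
  by (rule action_autoequivalence)

lemma T_lin [simp]: "g \<in> carrier G \<Longrightarrow> lin (T g)"
  by simp

lemma \<epsilon>_arr [simp]:
  assumes "g \<in> carrier G" "h \<in> carrier G" "X \<in> Obj C"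
  shows "\<epsilon> g h X \<in> Arr" "src (\<epsilon> g h X) = ob (T g) (ob (T h) X)" "tgt (\<epsilon> g h X) = ob (T (g \<odot>\<^sub>G h)) X"
  using nat_iso_arr[OF action_iso _ _ assms(3), of g h] assms by auto

lemma \<epsilon>_natural:
  assumes "g \<in> carrier G" "h \<in> carrier G" "f \<in> Arr" "src f = X" "tgt f = Y"
  shows "\<epsilon> g h Y \<star> ar (T g) (ar (T h) f) = ar (T (g \<odot>\<^sub>G h)) f \<star> \<epsilon> g h X"
  using nat_iso_natural[OF action_iso[OF assms(1,2)] assms(3-5)] by simp

lemma \<epsilon>_assoc:
  assumes "g \<in> carrier G" "h \<in> carrier G" "l \<in> carrier G" "X \<in> Obj C"
  shows "\<epsilon> (g \<odot>\<^sub>G h) l X \<star> \<epsilon> g h (ob (T l) X) = \<epsilon> g (h \<odot>\<^sub>G l) X \<star> ar (T g) (\<epsilon> h l X)"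
  using action_assoc[OF assms(1-3)] assms(4)
  by (simp add: nt_eq_def nt_comp_def whisker_left_def whisker_right_def)

abbreviation comms :: "('o, 'm) endofunctor \<Rightarrow> ('g \<Rightarrow> 'o \<Rightarrow> 'm) set" where
  "comms F \<equiv> commutations C G T F"

lemma commsI: "(\<And>g. g \<in> carrier G \<Longrightarrow> nat_iso C (F \<bullet> T g) (T g \<bullet> F) (\<delta> g)) \<Longrightarrow> \<delta> \<in> comms F"
  by (simp add: commutations_def)

lemma comms_iso: "\<lbrakk>\<delta> \<in> comms F; g \<in> carrier G\<rbrakk> \<Longrightarrow> nat_iso C (F \<bullet> T g) (T g \<bullet> F) (\<delta> g)"
  by (simp add: commutations_def)

lemma comms_arr:
  assumes "\<delta> \<in> comms F" "lin F" "g \<in> carrier G" "X \<in> Obj C"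
  shows "\<delta> g X \<in> Arr" "src (\<delta> g X) = ob F (ob (T g) X)" "tgt (\<delta> g X) = ob (T g) (ob F X)"
  using nat_iso_arr[OF comms_iso[OF assms(1,3)] _ _ assms(4)] assms by auto

lemma comms_natural:
  assumes "\<delta> \<in> comms F" "g \<in> carrier G" "f \<in> Arr" "src f = X" "tgt f = Y"
  shows "\<delta> g Y \<star> ar F (ar (T g) f) = ar (T g) (ar F f) \<star> \<delta> g X"
  using nat_iso_natural[OF comms_iso[OF assms(1,2)] assms(3-5)] by simp

text \<open>
  The two ways around the equivariance diagram, both from \<open>F F\<^sub>g F\<^sub>h\<close> to \<open>F\<^sub>g\<^sub>h F\<close>: merge \<open>F\<^sub>g F\<^sub>h\<close>
  into \<open>F\<^sub>g\<^sub>h\<close> and commute it with \<open>F\<close>, or commute one factor at a time and merge afterwards.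
\<close>

definition merge_commute where
  "merge_commute F \<delta> g h = \<delta> (g \<odot>\<^sub>G h) \<circ>\<^bsub>C\<^esub> (F \<rhd> \<epsilon> g h)"

definition commute_merge where
  "commute_merge F \<delta> g h = (\<epsilon> g h \<lhd>\<^sub>w F) \<circ>\<^bsub>C\<^esub> (T g \<rhd> \<delta> h) \<circ>\<^bsub>C\<^esub> (\<delta> g \<lhd>\<^sub>w T h)"

lemma merge_commute_at: "merge_commute F \<delta> g h X = \<delta> (g \<odot>\<^sub>G h) X \<star> ar F (\<epsilon> g h X)"
  by (simp add: merge_commute_def nt_comp_def whisker_left_def)

lemma commute_merge_at:
  "commute_merge F \<delta> g h X = \<epsilon> g h (ob F X) \<star> ar (T g) (\<delta> h X) \<star> \<delta> g (ob (T h) X)"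
  by (simp add: commute_merge_def nt_comp_def whisker_left_def whisker_right_def)

lemma
  assumes \<delta>: "\<delta> \<in> comms F" and F: "lin F" and gh: "g \<in> carrier G" "h \<in> carrier G"
  shows merge_commute_iso: "nat_iso C (F \<bullet> T g \<bullet> T h) (T (g \<odot>\<^sub>G h) \<bullet> F) (merge_commute F \<delta> g h)"
    and commute_merge_iso: "nat_iso C (F \<bullet> T g \<bullet> T h) (T (g \<odot>\<^sub>G h) \<bullet> F) (commute_merge F \<delta> g h)"
proof -
  note T = T_lin[OF gh(1)] T_lin[OF gh(2)] T_lin[OF gmult_closed[OF gh]]
  have 1: "nat_iso C (F \<bullet> (T g \<bullet> T h)) (F \<bullet> T (g \<odot>\<^sub>G h)) (F \<rhd> \<epsilon> g h)"
    using T F by (intro nat_iso_whisker_left action_iso gh) auto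
  have 2: "nat_iso C (F \<bullet> T (g \<odot>\<^sub>G h)) (T (g \<odot>\<^sub>G h) \<bullet> F) (\<delta> (g \<odot>\<^sub>G h))"
    using comms_iso[OF \<delta>] gh by simp
  show "nat_iso C (F \<bullet> T g \<bullet> T h) (T (g \<odot>\<^sub>G h) \<bullet> F) (merge_commute F \<delta> g h)"
    unfolding merge_commute_def fcomp_assoc by (rule nat_iso_comp[OF 1 2]) (use T F in auto)
  have 3: "nat_iso C (F \<bullet> T g \<bullet> T h) (T g \<bullet> F \<bullet> T h) (\<delta> g \<lhd>\<^sub>w T h)"
    using T F by (intro nat_iso_whisker_right comms_iso[OF \<delta> gh(1)]) auto
  have 4: "nat_iso C (T g \<bullet> F \<bullet> T h) (T g \<bullet> (T h \<bullet> F)) (T g \<rhd> \<delta> h)"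
    unfolding fcomp_assoc using T F by (intro nat_iso_whisker_left comms_iso[OF \<delta> gh(2)]) auto
  have 5: "nat_iso C (T g \<bullet> (T h \<bullet> F)) (T (g \<odot>\<^sub>G h) \<bullet> F) (\<epsilon> g h \<lhd>\<^sub>w F)"
    unfolding fcomp_assoc[symmetric] using T F by (intro nat_iso_whisker_right action_iso gh) auto
  show "nat_iso C (F \<bullet> T g \<bullet> T h) (T (g \<odot>\<^sub>G h) \<bullet> F) (commute_merge F \<delta> g h)"
    unfolding commute_merge_def
    by (rule nat_iso_comp[OF nat_iso_comp[OF 3 4] 5]) (use T F in auto)
qed

text \<open>
  The unit by which the diagram fails to commute.  Its defining property, hidden behind a definite
  description, is recovered in the lemma \<open>defect\<close>.
\<close>

abbreviation defect where
  "defect F \<delta> g h \<equiv> obstruction_cocycle K C G T \<epsilon> F \<delta> (g, h)"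

lemma commute_merge_arr:
  assumes "\<delta> \<in> comms F" "lin F" "g \<in> carrier G" "h \<in> carrier G" "X \<in> Obj C"
  shows "commute_merge F \<delta> g h X \<in> Arr"
    "src (commute_merge F \<delta> g h X) = ob F (ob (T g) (ob (T h) X))"
    "tgt (commute_merge F \<delta> g h X) = ob (T (g \<odot>\<^sub>G h)) (ob F X)"
  using nat_iso_arr[OF commute_merge_iso[OF assms(1-4)] _ _ assms(5)] assms(2-4) by auto

lemma defect_eqI:
  assumes F: "F \<in> Auteq" and \<delta>: "\<delta> \<in> comms F" and gh: "g \<in> carrier G" "h \<in> carrier G"
    and c: "c \<in> Units K"
    and eq: "\<And>X. X \<in> Obj C \<Longrightarrow> merge_commute F \<delta> g h X = c \<ast> commute_merge F \<delta> g h X"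
  shows "defect F \<delta> g h = c"
proof -
  note arr = commute_merge_arr[OF \<delta> Auteq_lin[OF F] gh]
  have smult: "nt_smult C (F \<bullet> T g \<bullet> T h) (T (g \<odot>\<^sub>G h) \<bullet> F) a (commute_merge F \<delta> g h) X
      = a \<ast> commute_merge F \<delta> g h X" if "X \<in> Obj C" for a X
    using that by (simp add: nt_smult_def scale_def arr)
  have iff: "nt_eq C (merge_commute F \<delta> g h)
      (nt_smult C (F \<bullet> T g \<bullet> T h) (T (g \<odot>\<^sub>G h) \<bullet> F) a (commute_merge F \<delta> g h))
    \<longleftrightarrow> (\<forall>X \<in> Obj C. merge_commute F \<delta> g h X = a \<ast> commute_merge F \<delta> g h X)" for a
    by (simp add: nt_eq_def smult del: fcomp_assoc)
  have "(THE a. a \<in> Units K \<and> (\<forall>X \<in> Obj C. merge_commute F \<delta> g h X = a \<ast> commute_merge F \<delta> g h X)) = c"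
  proof (rule the_equality)
    fix a assume a: "a \<in> Units K \<and> (\<forall>X \<in> Obj C. merge_commute F \<delta> g h X = a \<ast> commute_merge F \<delta> g h X)"
    show "a = c"
    proof (rule scale_unique[OF _ _ commute_merge_iso[OF \<delta> Auteq_lin[OF F] gh]])
      fix X assume "X \<in> Obj C"
      then show "a \<ast> commute_merge F \<delta> g h X = c \<ast> commute_merge F \<delta> g h X"
        using a eq[of X] by metis
    qed (use a c F gh in auto)
  qed (use c eq in blast)
  then show ?thesis
    using gh
    by (simp add: obstruction_cocycle_def iff flip: merge_commute_def commute_merge_def
        del: fcomp_assoc)
qed

lemma defect:
  assumes F: "F \<in> Auteq" and \<delta>: "\<delta> \<in> comms F" and gh: "g \<in> carrier G" "h \<in> carrier G"
  shows "defect F \<delta> g h \<in> Units K"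
    and "X \<in> Obj C \<Longrightarrow> merge_commute F \<delta> g h X = defect F \<delta> g h \<ast> commute_merge F \<delta> g h X"
proof -
  have dom: "F \<bullet> T g \<bullet> T h \<in> Auteq" "lin (T (g \<odot>\<^sub>G h) \<bullet> F)"
    using F gh by simp_all
  obtain c where c: "c \<in> Units K"
      "\<And>X. X \<in> Obj C \<Longrightarrow> merge_commute F \<delta> g h X = c \<ast> commute_merge F \<delta> g h X"
    using nat_iso_proportional[OF dom merge_commute_iso commute_merge_iso, OF \<delta> _ gh \<delta> _ gh] F
    by (metis Auteq_lin)
  show "defect F \<delta> g h \<in> Units K"
    and "X \<in> Obj C \<Longrightarrow> merge_commute F \<delta> g h X = defect F \<delta> g h \<ast> commute_merge F \<delta> g h X"
    using defect_eqI[OF F \<delta> gh c] c by auto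
qed

text \<open>
  \<open>\<phi>\<close> carries \<open>\<delta>\<^sub>g\<close> to \<open>\<delta>'\<^sub>g\<close> up to the scalar \<open>b g\<close>; for \<open>b = 1\<close> it is a morphism of equivariant
  functors.
\<close>

definition intertwines where
  "intertwines \<phi> \<delta> b \<delta>' \<longleftrightarrow>
    (\<forall>g \<in> carrier G. \<forall>X \<in> Obj C. ar (T g) (\<phi> X) \<star> \<delta> g X = b g \<ast> (\<delta>' g X \<star> \<phi> (ob (T g) X)))"

lemma intertwinesD:
  "\<lbrakk>intertwines \<phi> \<delta> b \<delta>'; g \<in> carrier G; X \<in> Obj C\<rbrakk> \<Longrightarrow>
    ar (T g) (\<phi> X) \<star> \<delta> g X = b g \<ast> (\<delta>' g X \<star> \<phi> (ob (T g) X))"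
  by (simp add: intertwines_def)

text \<open>
  Extend both sides of the diagram for \<open>F\<close> by \<open>F\<^sub>g\<^sub>h \<phi>\<close> and push \<open>\<phi>\<close> to the source.  Along the side
  \<open>merge_commute\<close> it passes \<open>\<delta>\<close> once, which costs \<open>b (g h)\<close>; along \<open>commute_merge\<close> it passes \<open>\<delta>\<close>
  twice, which costs \<open>b g \<cdot> b h\<close>.  What remains is the diagram for \<open>F'\<close>.
\<close>

lemma defect_intertwined:
  assumes F: "F \<in> Auteq" "F' \<in> Auteq" and \<delta>: "\<delta> \<in> comms F" and \<delta>': "\<delta>' \<in> comms F'"
    and \<phi>: "nat_iso C F F' \<phi>" and b: "b \<in> carrier G \<rightarrow> Units K" and tw: "intertwines \<phi> \<delta> b \<delta>'"
    and gh: "g \<in> carrier G" "h \<in> carrier G"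
  shows "defect F \<delta> g h \<otimes> (b g \<otimes> b h) = b (g \<odot>\<^sub>G h) \<otimes> defect F' \<delta>' g h"
proof -
  define c where "c = defect F \<delta> g h"
  define c' where "c' = defect F' \<delta>' g h"
  have U: "c \<in> Units K" "c' \<in> Units K" "b g \<in> Units K" "b h \<in> Units K" "b (g \<odot>\<^sub>G h) \<in> Units K"
    using defect(1)[OF F(1) \<delta> gh] defect(1)[OF F(2) \<delta>' gh] b gh by (auto simp: c_def c'_def)
  note carr = U[THEN unit_closed]
  note lin = Auteq_lin[OF F(1)] Auteq_lin[OF F(2)] T_lin[OF gh(1)] T_lin[OF gh(2)]
    T_lin[OF gmult_closed[OF gh]]
  note arr = comms_arr[OF \<delta> lin(1)] comms_arr[OF \<delta>' lin(2)] nat_iso_arr[OF \<phi> lin(1,2)]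
    commute_merge_arr[OF \<delta> lin(1) gh] commute_merge_arr[OF \<delta>' lin(2) gh]
  let ?w = "commute_merge F' \<delta>' g h \<circ>\<^bsub>C\<^esub> (\<phi> \<lhd>\<^sub>w (T g \<bullet> T h))"
  have w: "nat_iso C (F \<bullet> (T g \<bullet> T h)) (T (g \<odot>\<^sub>G h) \<bullet> F') ?w"
    using commute_merge_iso[OF \<delta>' lin(2) gh] lin
    by (intro nat_iso_comp[OF nat_iso_whisker_right[OF \<phi>]]) auto
  have "c \<otimes> (b g \<otimes> b h) = b (g \<odot>\<^sub>G h) \<otimes> c'"
  proof (rule scale_unique[OF _ _ w])
    fix X assume X: "X \<in> Obj C"
    let ?ThX = "ob (T h) X" and ?TX = "ob (T g) (ob (T h) X)" and ?gh = "g \<odot>\<^sub>G h"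
    have objs: "?ThX \<in> Obj C" "?TX \<in> Obj C" "ob F X \<in> Obj C" "ob F' X \<in> Obj C" "ob (T ?gh) X \<in> Obj C"
      using X lin by simp_all
    note [simp] = X gh objs lin arr carr after_assoc
    have w_at: "?w X = commute_merge F' \<delta>' g h X \<star> \<phi> ?TX"
      by (simp add: nt_comp_def whisker_right_def)
    have "ar (T ?gh) (\<phi> X) \<star> merge_commute F \<delta> g h X
        = (ar (T ?gh) (\<phi> X) \<star> \<delta> ?gh X) \<star> ar F (\<epsilon> g h X)"
      by (simp add: merge_commute_at)
    also have "\<dots> = (b ?gh \<ast> (\<delta>' ?gh X \<star> \<phi> (ob (T ?gh) X))) \<star> ar F (\<epsilon> g h X)"
      by (simp only: intertwinesD[OF tw gmult_closed[OF gh] X])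
    also have "\<dots> = b ?gh \<ast> (\<delta>' ?gh X \<star> (\<phi> (ob (T ?gh) X) \<star> ar F (\<epsilon> g h X)))"
      by simp
    also have "\<phi> (ob (T ?gh) X) \<star> ar F (\<epsilon> g h X) = ar F' (\<epsilon> g h X) \<star> \<phi> ?TX"
      by (rule nat_iso_natural[OF \<phi>]) simp_all
    also have "b ?gh \<ast> (\<delta>' ?gh X \<star> (ar F' (\<epsilon> g h X) \<star> \<phi> ?TX))
        = b ?gh \<ast> (merge_commute F' \<delta>' g h X \<star> \<phi> ?TX)"
      by (simp add: merge_commute_at)
    also have "\<dots> = b ?gh \<ast> ((c' \<ast> commute_merge F' \<delta>' g h X) \<star> \<phi> ?TX)"
      by (simp only: c'_def defect(2)[OF F(2) \<delta>' gh X])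
    also have "\<dots> = (b ?gh \<otimes> c') \<ast> ?w X"
      unfolding w_at by simp
    finally have L: "ar (T ?gh) (\<phi> X) \<star> merge_commute F \<delta> g h X = (b ?gh \<otimes> c') \<ast> ?w X" .
    have "ar (T ?gh) (\<phi> X) \<star> commute_merge F \<delta> g h X
        = (ar (T ?gh) (\<phi> X) \<star> \<epsilon> g h (ob F X)) \<star> ar (T g) (\<delta> h X) \<star> \<delta> g ?ThX"
      by (simp add: commute_merge_at)
    also have "ar (T ?gh) (\<phi> X) \<star> \<epsilon> g h (ob F X) = \<epsilon> g h (ob F' X) \<star> ar (T g) (ar (T h) (\<phi> X))"
      by (rule \<epsilon>_natural[symmetric]) simp_all
    also have "(\<epsilon> g h (ob F' X) \<star> ar (T g) (ar (T h) (\<phi> X))) \<star> ar (T g) (\<delta> h X) \<star> \<delta> g ?ThX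
        = \<epsilon> g h (ob F' X) \<star> ar (T g) (ar (T h) (\<phi> X) \<star> \<delta> h X) \<star> \<delta> g ?ThX"
      by simp
    also have "ar (T h) (\<phi> X) \<star> \<delta> h X = b h \<ast> (\<delta>' h X \<star> \<phi> ?ThX)"
      by (rule intertwinesD[OF tw gh(2) X])
    also have "\<epsilon> g h (ob F' X) \<star> ar (T g) (b h \<ast> (\<delta>' h X \<star> \<phi> ?ThX)) \<star> \<delta> g ?ThX
        = b h \<ast> (\<epsilon> g h (ob F' X) \<star> ar (T g) (\<delta>' h X) \<star> (ar (T g) (\<phi> ?ThX) \<star> \<delta> g ?ThX))"
      by simp
    also have "ar (T g) (\<phi> ?ThX) \<star> \<delta> g ?ThX = b g \<ast> (\<delta>' g ?ThX \<star> \<phi> ?TX)"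
      by (rule intertwinesD[OF tw gh(1) objs(1)])
    also have "b h \<ast> (\<epsilon> g h (ob F' X) \<star> ar (T g) (\<delta>' h X) \<star> (b g \<ast> (\<delta>' g ?ThX \<star> \<phi> ?TX)))
        = (b g \<otimes> b h) \<ast> ?w X"
      unfolding w_at by (simp add: commute_merge_at m_comm[of "b g"])
    finally have R: "ar (T ?gh) (\<phi> X) \<star> commute_merge F \<delta> g h X = (b g \<otimes> b h) \<ast> ?w X" .
    have "?w X \<in> Arr"
      unfolding w_at by simp
    then have "(c \<otimes> (b g \<otimes> b h)) \<ast> ?w X = c \<ast> (ar (T ?gh) (\<phi> X) \<star> commute_merge F \<delta> g h X)"
      by (simp add: R)
    also have "\<dots> = ar (T ?gh) (\<phi> X) \<star> (c \<ast> commute_merge F \<delta> g h X)"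
      by simp
    also have "\<dots> = (b ?gh \<otimes> c') \<ast> ?w X"
      by (simp only: c_def L flip: defect(2)[OF F(1) \<delta> gh X])
    finally show "(c \<otimes> (b g \<otimes> b h)) \<ast> ?w X = (b ?gh \<otimes> c') \<ast> ?w X" .
  qed (use F gh carr in auto)
  then show ?thesis
    by (simp add: c_def c'_def)
qed

abbreviation comm_mult where
  "comm_mult F \<delta> F' \<delta>' \<equiv> \<lambda>g. (\<delta> g \<lhd>\<^sub>w F') \<circ>\<^bsub>C\<^esub> (F \<rhd> \<delta>' g)"

lemma comm_mult_at: "comm_mult F \<delta> F' \<delta>' g X = \<delta> g (ob F' X) \<star> ar F (\<delta>' g X)"
  by (simp add: nt_comp_def whisker_left_def whisker_right_def)

lemma comm_mult_comms:
  assumes F: "lin F" "lin F'" and \<delta>: "\<delta> \<in> comms F" "\<delta>' \<in> comms F'"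
  shows "comm_mult F \<delta> F' \<delta>' \<in> comms (F \<bullet> F')"
proof (rule commsI)
  fix g assume g: "g \<in> carrier G"
  have 1: "nat_iso C (F \<bullet> (F' \<bullet> T g)) (F \<bullet> (T g \<bullet> F')) (F \<rhd> \<delta>' g)"
    using F g by (intro nat_iso_whisker_left comms_iso[OF \<delta>(2)]) auto
  have 2: "nat_iso C (F \<bullet> T g \<bullet> F') (T g \<bullet> F \<bullet> F') (\<delta> g \<lhd>\<^sub>w F')"
    using F g by (intro nat_iso_whisker_right comms_iso[OF \<delta>(1)]) auto
  have "nat_iso C (F \<bullet> (F' \<bullet> T g)) (T g \<bullet> F \<bullet> F') (comm_mult F \<delta> F' \<delta>' g)"
    by (rule nat_iso_comp[OF 1 2[unfolded fcomp_assoc[of F]]]) (use F g in auto)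
  then show "nat_iso C (F \<bullet> F' \<bullet> T g) (T g \<bullet> (F \<bullet> F')) (comm_mult F \<delta> F' \<delta>' g)"
    by simp
qed

text \<open>
  The diagram for \<open>F F'\<close> is pasted from \<open>F\<close> applied to the diagram of \<open>F'\<close> and the diagram of \<open>F\<close>
  evaluated at \<open>F' X\<close>.  They are glued along a naturality square of \<open>\<delta>\<^sub>g\<close>, and the scalars
  multiply because \<open>F\<close> is linear.
\<close>

lemma defect_mult:
  assumes F: "F \<in> Auteq" "F' \<in> Auteq" and \<delta>: "\<delta> \<in> comms F" and \<delta>': "\<delta>' \<in> comms F'"
    and gh: "g \<in> carrier G" "h \<in> carrier G"
  shows "defect (F \<bullet> F') (comm_mult F \<delta> F' \<delta>') g h = defect F \<delta> g h \<otimes> defect F' \<delta>' g h"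
proof -
  define c where "c = defect F \<delta> g h"
  define c' where "c' = defect F' \<delta>' g h"
  have U: "c \<in> Units K" "c' \<in> Units K"
    using defect(1)[OF F(1) \<delta> gh] defect(1)[OF F(2) \<delta>' gh] by (auto simp: c_def c'_def)
  note lin = Auteq_lin[OF F(1)] Auteq_lin[OF F(2)] T_lin[OF gh(1)] T_lin[OF gh(2)]
    T_lin[OF gmult_closed[OF gh]]
  note arr = comms_arr[OF \<delta> lin(1)] comms_arr[OF \<delta>' lin(2)]
    commute_merge_arr[OF \<delta> lin(1) gh] commute_merge_arr[OF \<delta>' lin(2) gh]
  have "defect (F \<bullet> F') (comm_mult F \<delta> F' \<delta>') g h = c \<otimes> c'"
  proof (rule defect_eqI[OF Auteq_fcomp[OF F] comm_mult_comms[OF lin(1,2) \<delta> \<delta>'] gh])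
    fix X assume X: "X \<in> Obj C"
    let ?FX = "ob F' X" and ?ThX = "ob (T h) X" and ?gh = "g \<odot>\<^sub>G h"
    have objs: "?ThX \<in> Obj C" "?FX \<in> Obj C" "ob (T h) ?FX \<in> Obj C" "ob F' ?ThX \<in> Obj C"
        "ob F ?FX \<in> Obj C" "ob (T g) ?ThX \<in> Obj C"
      using X lin by simp_all
    note [simp] = X gh objs lin arr U[THEN unit_closed] after_assoc
    have "merge_commute (F \<bullet> F') (comm_mult F \<delta> F' \<delta>') g h X
        = \<delta> ?gh ?FX \<star> ar F (merge_commute F' \<delta>' g h X)"
      by (simp add: merge_commute_at comm_mult_at)
    also have "\<dots> = \<delta> ?gh ?FX \<star> ar F (c' \<ast> commute_merge F' \<delta>' g h X)"
      by (simp only: c'_def defect(2)[OF F(2) \<delta>' gh X])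
    also have "\<dots> = c' \<ast> (merge_commute F \<delta> g h ?FX \<star> ar F (ar (T g) (\<delta>' h X)) \<star> ar F (\<delta>' g ?ThX))"
      by (simp add: merge_commute_at commute_merge_at)
    also have "\<dots> = c' \<ast> ((c \<ast> commute_merge F \<delta> g h ?FX) \<star> ar F (ar (T g) (\<delta>' h X)) \<star> ar F (\<delta>' g ?ThX))"
      by (simp only: c_def defect(2)[OF F(1) \<delta> gh objs(2)])
    also have "\<dots> = (c \<otimes> c') \<ast> (\<epsilon> g h (ob F ?FX) \<star> ar (T g) (\<delta> h ?FX) \<star>
        (\<delta> g (ob (T h) ?FX) \<star> ar F (ar (T g) (\<delta>' h X))) \<star> ar F (\<delta>' g ?ThX))"
      by (simp add: commute_merge_at m_comm[of c c'])
    also have "\<delta> g (ob (T h) ?FX) \<star> ar F (ar (T g) (\<delta>' h X)) = ar (T g) (ar F (\<delta>' h X)) \<star> \<delta> g (ob F' ?ThX)"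
      by (rule comms_natural[OF \<delta>]) simp_all
    also have "(c \<otimes> c') \<ast> (\<epsilon> g h (ob F ?FX) \<star> ar (T g) (\<delta> h ?FX) \<star>
        (ar (T g) (ar F (\<delta>' h X)) \<star> \<delta> g (ob F' ?ThX)) \<star> ar F (\<delta>' g ?ThX))
        = (c \<otimes> c') \<ast> commute_merge (F \<bullet> F') (comm_mult F \<delta> F' \<delta>') g h X"
      by (simp add: commute_merge_at comm_mult_at)
    finally show "merge_commute (F \<bullet> F') (comm_mult F \<delta> F' \<delta>') g h X
        = (c \<otimes> c') \<ast> commute_merge (F \<bullet> F') (comm_mult F \<delta> F' \<delta>') g h X" .
  qed (use U in auto)
  then show ?thesis
    by (simp add: c_def c'_def)
qed

text \<open>
  By associativity of \<open>\<epsilon>\<close>, merging \<open>F\<^sub>g F\<^sub>h F\<^sub>l\<close> and then commuting with \<open>F\<close> gives the same arrow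
  whether \<open>g, h\<close> or \<open>h, l\<close> are merged first.  In both orders it is a multiple of the composite \<open>w\<close>
  that commutes \<open>F\<close> past each factor before merging, and the two sides of the identity are these
  multiples.
\<close>

lemma defect_cocycle:
  assumes F: "F \<in> Auteq" and \<delta>: "\<delta> \<in> comms F"
    and ghl: "g \<in> carrier G" "h \<in> carrier G" "l \<in> carrier G"
  shows "defect F \<delta> (g \<odot>\<^sub>G h) l \<otimes> defect F \<delta> g h
    = defect F \<delta> g (h \<odot>\<^sub>G l) \<otimes> defect F \<delta> h l"
proof -
  let ?gh = "g \<odot>\<^sub>G h" and ?hl = "h \<odot>\<^sub>G l" and ?ghl = "g \<odot>\<^sub>G h \<odot>\<^sub>G l"
  have assoc: "g \<odot>\<^sub>G ?hl = ?ghl"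
    using monoid.m_assoc[OF group.is_monoid[OF group_axioms]] ghl by simp
  have gs: "?gh \<in> carrier G" "?hl \<in> carrier G" "?ghl \<in> carrier G"
    using ghl by simp_all
  note lin = Auteq_lin[OF F] T_lin[OF ghl(1)] T_lin[OF ghl(2)] T_lin[OF ghl(3)] gs[THEN T_lin]
  note arr = comms_arr[OF \<delta> lin(1)]
  define c where "c = defect F \<delta>"
  have c: "c x y \<in> Units K" "X \<in> Obj C \<Longrightarrow> merge_commute F \<delta> x y X = c x y \<ast> commute_merge F \<delta> x y X"
    if "x \<in> carrier G" "y \<in> carrier G" for x y X
    using defect[OF F \<delta> that] by (simp_all add: c_def)
  have U: "c ?gh l \<in> Units K" "c g h \<in> Units K" "c g ?hl \<in> Units K" "c h l \<in> Units K"
    using c(1) ghl gs by simp_all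
  let ?w = "(\<epsilon> ?gh l \<lhd>\<^sub>w F) \<circ>\<^bsub>C\<^esub> (T ?gh \<rhd> \<delta> l) \<circ>\<^bsub>C\<^esub> (commute_merge F \<delta> g h \<lhd>\<^sub>w T l)"
  have w: "nat_iso C (F \<bullet> (T g \<bullet> (T h \<bullet> T l))) (T ?ghl \<bullet> F) ?w"
  proof -
    have 1: "nat_iso C (F \<bullet> (T g \<bullet> (T h \<bullet> T l))) (T ?gh \<bullet> (F \<bullet> T l)) (commute_merge F \<delta> g h \<lhd>\<^sub>w T l)"
      using nat_iso_whisker_right[OF commute_merge_iso[OF \<delta> lin(1) ghl(1,2)] _ _ lin(4)] lin by simp
    have 2: "nat_iso C (T ?gh \<bullet> (F \<bullet> T l)) (T ?gh \<bullet> (T l \<bullet> F)) (T ?gh \<rhd> \<delta> l)"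
      using nat_iso_whisker_left[OF comms_iso[OF \<delta> ghl(3)] _ _ lin(5)] lin by simp
    have 3: "nat_iso C (T ?gh \<bullet> (T l \<bullet> F)) (T ?ghl \<bullet> F) (\<epsilon> ?gh l \<lhd>\<^sub>w F)"
      using nat_iso_whisker_right[OF action_iso[OF gs(1) ghl(3)] _ _ lin(1)] lin by simp
    show ?thesis
      by (rule nat_iso_comp[OF nat_iso_comp[OF 1 2] 3]) (use lin in auto)
  qed
  have "c ?gh l \<otimes> c g h = c g ?hl \<otimes> c h l"
  proof (rule scale_unique[OF _ _ w])
    fix X assume X: "X \<in> Obj C"
    let ?FX = "ob F X" and ?lX = "ob (T l) X"
    have objs: "?lX \<in> Obj C" "?FX \<in> Obj C" "ob (T l) ?FX \<in> Obj C" "ob (T h) ?lX \<in> Obj C"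
        "ob F ?lX \<in> Obj C" "ob (T ?hl) X \<in> Obj C"
      using X lin by simp_all
    note [simp] = X ghl gs objs lin arr U[THEN unit_closed] after_assoc
    have w_at: "?w X = \<epsilon> ?gh l ?FX \<star> ar (T ?gh) (\<delta> l X) \<star> commute_merge F \<delta> g h ?lX"
      by (simp add: nt_comp_def whisker_left_def whisker_right_def)
    have cm: "commute_merge F \<delta> g h ?lX \<in> Arr"
        "src (commute_merge F \<delta> g h ?lX) = ob F (ob (T g) (ob (T h) ?lX))"
        "tgt (commute_merge F \<delta> g h ?lX) = ob (T ?gh) (ob F ?lX)"
      using commute_merge_arr[OF \<delta> lin(1) ghl(1,2) objs(1)] .
    have "\<delta> ?ghl X \<star> ar F (\<epsilon> ?gh l X \<star> \<epsilon> g h ?lX) = merge_commute F \<delta> ?gh l X \<star> ar F (\<epsilon> g h ?lX)"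
      by (simp add: merge_commute_at)
    also have "\<dots> = (c ?gh l \<ast> commute_merge F \<delta> ?gh l X) \<star> ar F (\<epsilon> g h ?lX)"
      by (simp only: c(2)[OF gs(1) ghl(3) X])
    also have "\<dots> = c ?gh l \<ast> (\<epsilon> ?gh l ?FX \<star> ar (T ?gh) (\<delta> l X) \<star> merge_commute F \<delta> g h ?lX)"
      by (simp add: merge_commute_at commute_merge_at)
    also have "\<dots> = c ?gh l \<ast> (\<epsilon> ?gh l ?FX \<star> ar (T ?gh) (\<delta> l X) \<star> c g h \<ast> commute_merge F \<delta> g h ?lX)"
      by (simp only: c(2)[OF ghl(1,2) objs(1)])
    also have "\<dots> = (c ?gh l \<otimes> c g h) \<ast> ?w X"
      unfolding w_at by (simp add: cm)
    finally have L: "\<delta> ?ghl X \<star> ar F (\<epsilon> ?gh l X \<star> \<epsilon> g h ?lX) = (c ?gh l \<otimes> c g h) \<ast> ?w X" .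
    have "?w X = \<epsilon> ?gh l ?FX \<star> (ar (T ?gh) (\<delta> l X) \<star> \<epsilon> g h (ob F ?lX)) \<star>
        ar (T g) (\<delta> h ?lX) \<star> \<delta> g (ob (T h) ?lX)"
      unfolding w_at by (simp add: commute_merge_at)
    also have "ar (T ?gh) (\<delta> l X) \<star> \<epsilon> g h (ob F ?lX) = \<epsilon> g h (ob (T l) ?FX) \<star> ar (T g) (ar (T h) (\<delta> l X))"
      by (rule \<epsilon>_natural[symmetric]) simp_all
    also have "\<epsilon> ?gh l ?FX \<star> (\<epsilon> g h (ob (T l) ?FX) \<star> ar (T g) (ar (T h) (\<delta> l X))) \<star>
          ar (T g) (\<delta> h ?lX) \<star> \<delta> g (ob (T h) ?lX)
        = (\<epsilon> ?gh l ?FX \<star> \<epsilon> g h (ob (T l) ?FX)) \<star> ar (T g) (ar (T h) (\<delta> l X)) \<star>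
          ar (T g) (\<delta> h ?lX) \<star> \<delta> g (ob (T h) ?lX)"
      by simp
    also have "\<epsilon> ?gh l ?FX \<star> \<epsilon> g h (ob (T l) ?FX) = \<epsilon> g ?hl ?FX \<star> ar (T g) (\<epsilon> h l ?FX)"
      by (rule \<epsilon>_assoc) simp_all
    also have "(\<epsilon> g ?hl ?FX \<star> ar (T g) (\<epsilon> h l ?FX)) \<star> ar (T g) (ar (T h) (\<delta> l X)) \<star>
          ar (T g) (\<delta> h ?lX) \<star> \<delta> g (ob (T h) ?lX)
        = \<epsilon> g ?hl ?FX \<star> ar (T g) (commute_merge F \<delta> h l X) \<star> \<delta> g (ob (T h) ?lX)"
      by (simp add: commute_merge_at assoc)
    \<comment> \<open>By associativity at \<open>F X\<close>, the common composite can also be read in the other order.\<close>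
    finally have w_alt:
      "?w X = \<epsilon> g ?hl ?FX \<star> ar (T g) (commute_merge F \<delta> h l X) \<star> \<delta> g (ob (T h) ?lX)" .
    have cm': "commute_merge F \<delta> h l X \<in> Arr"
        "src (commute_merge F \<delta> h l X) = ob F (ob (T h) ?lX)"
        "tgt (commute_merge F \<delta> h l X) = ob (T ?hl) ?FX"
      using commute_merge_arr[OF \<delta> lin(1) ghl(2,3) X] .
    have "\<delta> ?ghl X \<star> ar F (\<epsilon> ?gh l X \<star> \<epsilon> g h ?lX) = \<delta> ?ghl X \<star> ar F (\<epsilon> g ?hl X \<star> ar (T g) (\<epsilon> h l X))"
      by (simp only: \<epsilon>_assoc[OF ghl X])
    also have "\<dots> = merge_commute F \<delta> g ?hl X \<star> ar F (ar (T g) (\<epsilon> h l X))"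
      by (simp add: merge_commute_at assoc)
    also have "\<dots> = (c g ?hl \<ast> commute_merge F \<delta> g ?hl X) \<star> ar F (ar (T g) (\<epsilon> h l X))"
      by (simp only: c(2)[OF ghl(1) gs(2) X])
    also have "\<dots> = c g ?hl \<ast> (\<epsilon> g ?hl ?FX \<star> ar (T g) (\<delta> ?hl X) \<star>
        (\<delta> g (ob (T ?hl) X) \<star> ar F (ar (T g) (\<epsilon> h l X))))"
      by (simp add: commute_merge_at)
    also have "\<delta> g (ob (T ?hl) X) \<star> ar F (ar (T g) (\<epsilon> h l X)) = ar (T g) (ar F (\<epsilon> h l X)) \<star> \<delta> g (ob (T h) ?lX)"
      by (rule comms_natural[OF \<delta>]) simp_all
    also have "c g ?hl \<ast> (\<epsilon> g ?hl ?FX \<star> ar (T g) (\<delta> ?hl X) \<star>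
          (ar (T g) (ar F (\<epsilon> h l X)) \<star> \<delta> g (ob (T h) ?lX)))
        = c g ?hl \<ast> (\<epsilon> g ?hl ?FX \<star> ar (T g) (merge_commute F \<delta> h l X) \<star> \<delta> g (ob (T h) ?lX))"
      by (simp add: merge_commute_at)
    also have "\<dots> = c g ?hl \<ast> (\<epsilon> g ?hl ?FX \<star> ar (T g) (c h l \<ast> commute_merge F \<delta> h l X) \<star> \<delta> g (ob (T h) ?lX))"
      by (simp only: c(2)[OF ghl(2,3) X])
    also have "\<dots> = (c g ?hl \<otimes> c h l) \<ast> ?w X"
      unfolding w_alt by (simp add: cm')
    finally show "(c ?gh l \<otimes> c g h) \<ast> ?w X = (c g ?hl \<otimes> c h l) \<ast> ?w X"
      unfolding L .
  qed (use F ghl gs U in auto)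
  then show ?thesis
    by (simp add: c_def)
qed


section \<open>The group of equivariant autoequivalences\<close>

abbreviation EqAut where
  "EqAut \<equiv> equivariant_autoequivalences K C G T \<epsilon>"

abbreviation eq_rel where
  "eq_rel \<equiv> equivariant_iso_rel K C G T \<epsilon>"

lemma EqAut_iff:
  "(F, \<delta>) \<in> EqAut \<longleftrightarrow> F \<in> Auteq \<and> \<delta> \<in> comms F \<and>
    (\<forall>g \<in> carrier G. \<forall>h \<in> carrier G. defect F \<delta> g h = \<one>)"
proof -
  have "defect F \<delta> g h = \<one> \<longleftrightarrow> nt_eq C (merge_commute F \<delta> g h) (commute_merge F \<delta> g h)"
    if F: "F \<in> Auteq" and \<delta>: "\<delta> \<in> comms F" and gh: "g \<in> carrier G" "h \<in> carrier G" for g h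
  proof -
    have one: "\<one> \<ast> commute_merge F \<delta> g h X = commute_merge F \<delta> g h X" if "X \<in> Obj C" for X
      using commute_merge_arr[OF \<delta> Auteq_lin[OF F] gh that] by simp
    show ?thesis
      using defect_eqI[OF F \<delta> gh, of \<one>] defect(2)[OF F \<delta> gh] one
      unfolding nt_eq_def by (metis unit_one)
  qed
  then show ?thesis
    unfolding equivariant_autoequivalences_def merge_commute_def commute_merge_def by auto
qed

lemma eq_rel_iff:
  "((F, \<delta>), (F', \<delta>')) \<in> eq_rel \<longleftrightarrow> (F, \<delta>) \<in> EqAut \<and> (F', \<delta>') \<in> EqAut \<and>
    (\<exists>\<phi>. nat_iso C F F' \<phi> \<and> (\<forall>g \<in> carrier G. \<forall>X \<in> Obj C. ar (T g) (\<phi> X) \<star> \<delta> g X = \<delta>' g X \<star> \<phi> (ob (T g) X)))"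
  unfolding equivariant_iso_rel_def
  by (simp add: nt_eq_def nt_comp_def whisker_left_def whisker_right_def)

lemma intertwines_one_iff:
  assumes "lin F" "lin F'" "\<delta>' \<in> comms F'" "nat_iso C F F' \<phi>"
  shows "intertwines \<phi> \<delta> (\<lambda>g. \<one>) \<delta>' \<longleftrightarrow>
    (\<forall>g \<in> carrier G. \<forall>X \<in> Obj C. ar (T g) (\<phi> X) \<star> \<delta> g X = \<delta>' g X \<star> \<phi> (ob (T g) X))"
proof -
  have "\<one> \<ast> (\<delta>' g X \<star> \<phi> (ob (T g) X)) = \<delta>' g X \<star> \<phi> (ob (T g) X)"
    if "g \<in> carrier G" "X \<in> Obj C" for g X
    using that comms_arr[OF assms(3,2)] nat_iso_arr[OF assms(4,1,2)] assms(2) by simp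
  then show ?thesis
    unfolding intertwines_def by simp
qed

lemma eq_rel_intertwines:
  "((F, \<delta>), (F', \<delta>')) \<in> eq_rel \<longleftrightarrow> (F, \<delta>) \<in> EqAut \<and> (F', \<delta>') \<in> EqAut \<and>
    (\<exists>\<phi>. nat_iso C F F' \<phi> \<and> intertwines \<phi> \<delta> (\<lambda>g. \<one>) \<delta>')"
  unfolding eq_rel_iff using intertwines_one_iff EqAut_iff Auteq_lin by metis

text \<open>
  For each \<open>g\<close> the two isomorphisms \<open>(F\<^sub>g \<phi>) \<delta>\<^sub>g\<close> and \<open>\<delta>'\<^sub>g (\<phi> F\<^sub>g)\<close> have the same source and target.
\<close>

lemma intertwiner_exists:
  assumes F: "F \<in> Auteq" "F' \<in> Auteq" and \<delta>: "\<delta> \<in> comms F" and \<delta>': "\<delta>' \<in> comms F'"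
    and \<phi>: "nat_iso C F F' \<phi>"
  obtains b where "b \<in> carrier G \<rightarrow> Units K" "intertwines \<phi> \<delta> b \<delta>'"
proof -
  have "\<exists>b. b \<in> Units K \<and> (\<forall>X \<in> Obj C. ar (T g) (\<phi> X) \<star> \<delta> g X = b \<ast> (\<delta>' g X \<star> \<phi> (ob (T g) X)))"
    if g: "g \<in> carrier G" for g
  proof -
    note lin = Auteq_lin[OF F(1)] Auteq_lin[OF F(2)] T_lin[OF g]
    have 1: "nat_iso C (F \<bullet> T g) (T g \<bullet> F') ((T g \<rhd> \<phi>) \<circ>\<^bsub>C\<^esub> \<delta> g)"
      by (rule nat_iso_comp[OF comms_iso[OF \<delta> g] nat_iso_whisker_left[OF \<phi>]]) (use lin in auto)
    have 2: "nat_iso C (F \<bullet> T g) (T g \<bullet> F') (\<delta>' g \<circ>\<^bsub>C\<^esub> (\<phi> \<lhd>\<^sub>w T g))"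
      by (rule nat_iso_comp[OF nat_iso_whisker_right[OF \<phi>] comms_iso[OF \<delta>' g]]) (use lin in auto)
    obtain b where b: "b \<in> Units K"
        "\<And>X. X \<in> Obj C \<Longrightarrow> ((T g \<rhd> \<phi>) \<circ>\<^bsub>C\<^esub> \<delta> g) X = b \<ast> (\<delta>' g \<circ>\<^bsub>C\<^esub> (\<phi> \<lhd>\<^sub>w T g)) X"
      by (rule nat_iso_proportional[OF _ _ 1 2]) (use F g lin in auto)
    show ?thesis
      using b(1) b(2)[unfolded nt_comp_def whisker_left_def whisker_right_def] by blast
  qed
  then obtain b where "\<forall>g \<in> carrier G. b g \<in> Units K \<and>
      (\<forall>X \<in> Obj C. ar (T g) (\<phi> X) \<star> \<delta> g X = b g \<ast> (\<delta>' g X \<star> \<phi> (ob (T g) X)))"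
    by metis
  then show thesis
    using that[of b] unfolding intertwines_def by blast
qed

end


context scalar_action
begin

lemma EqAutD:
  assumes "(F, \<delta>) \<in> EqAut"
  shows "F \<in> Auteq" "lin F" "\<delta> \<in> comms F"
    "\<And>g h. \<lbrakk>g \<in> carrier G; h \<in> carrier G\<rbrakk> \<Longrightarrow> defect F \<delta> g h = \<one>"
  using assms unfolding EqAut_iff by auto

lemma eq_relI:
  assumes "(F, \<delta>) \<in> EqAut" "(F', \<delta>') \<in> EqAut" "nat_iso C F F' \<phi>"
    and "\<And>g X. \<lbrakk>g \<in> carrier G; X \<in> Obj C\<rbrakk> \<Longrightarrow> ar (T g) (\<phi> X) \<star> \<delta> g X = \<delta>' g X \<star> \<phi> (ob (T g) X)"
  shows "((F, \<delta>), (F', \<delta>')) \<in> eq_rel"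
  using assms unfolding eq_rel_iff by blast

lemma eq_relE:
  assumes "((F, \<delta>), (F', \<delta>')) \<in> eq_rel"
  obtains \<phi> where "(F, \<delta>) \<in> EqAut" "(F', \<delta>') \<in> EqAut" "nat_iso C F F' \<phi>"
    "\<forall>g \<in> carrier G. \<forall>X \<in> Obj C. ar (T g) (\<phi> X) \<star> \<delta> g X = \<delta>' g X \<star> \<phi> (ob (T g) X)"
  using assms unfolding eq_rel_iff by blast

text \<open>
  Structures that agree on objects and group elements may still differ as functions elsewhere; they
  are isomorphic by the identity.
\<close>

lemma eq_rel_same_functor:
  assumes E: "(F, \<delta>) \<in> EqAut" "(F, \<delta>') \<in> EqAut"
    and eq: "\<And>g X. \<lbrakk>g \<in> carrier G; X \<in> Obj C\<rbrakk> \<Longrightarrow> \<delta> g X = \<delta>' g X"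
  shows "((F, \<delta>), (F, \<delta>')) \<in> eq_rel"
proof (rule eq_relI[OF E nat_iso_id])
  show "lin F"
    using EqAutD[OF E(1)] by simp
  fix g X assume gX: "g \<in> carrier G" "X \<in> Obj C"
  note arr = comms_arr[OF EqAutD(3,2)[OF E(2)] gX]
  show "ar (T g) (nt_id C F X) \<star> \<delta> g X = \<delta>' g X \<star> nt_id C F (ob (T g) X)"
    using gX arr EqAutD(2)[OF E(1)] by (simp add: nt_id_def eq)
qed

lemma eq_rel_equiv: "equiv EqAut eq_rel"
proof (rule equivI)
  show "refl_on EqAut eq_rel"
  proof (rule refl_onI)
    fix p assume "p \<in> EqAut"
    then show "(p, p) \<in> eq_rel"
      by (cases p) (simp add: eq_rel_same_functor)
  qed
  show "eq_rel \<subseteq> EqAut \<times> EqAut"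
    unfolding equivariant_iso_rel_def by auto
  show "sym eq_rel"
  proof (rule symI, clarify)
    fix F \<delta> F' \<delta>' assume "((F, \<delta>), (F', \<delta>')) \<in> eq_rel"
    then obtain \<phi> where E: "(F, \<delta>) \<in> EqAut" "(F', \<delta>') \<in> EqAut" and \<phi>: "nat_iso C F F' \<phi>"
      and tw: "\<forall>g \<in> carrier G. \<forall>X \<in> Obj C. ar (T g) (\<phi> X) \<star> \<delta> g X = \<delta>' g X \<star> \<phi> (ob (T g) X)"
      by (rule eq_relE)
    note tw = tw[rule_format]
    note lin = EqAutD(2)[OF E(1)] EqAutD(2)[OF E(2)]
    obtain \<beta> where \<beta>: "nat_iso C F' F \<beta>"
        "\<forall>X \<in> Obj C. \<beta> X \<star> \<phi> X = Ident C (ob F X)" "\<forall>X \<in> Obj C. \<phi> X \<star> \<beta> X = Ident C (ob F' X)"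
      by (rule nat_iso_inverse[OF \<phi> lin])
    show "((F', \<delta>'), (F, \<delta>)) \<in> eq_rel"
    proof (rule eq_relI[OF E(2,1) \<beta>(1)])
      fix g X assume gX: "g \<in> carrier G" "X \<in> Obj C"
      have TX: "ob (T g) X \<in> Obj C"
        using gX by simp
      note [simp] = gX TX lin after_assoc T_lin[OF gX(1)] comms_arr[OF EqAutD(3)[OF E(1)] lin(1) gX]
        comms_arr[OF EqAutD(3)[OF E(2)] lin(2) gX] nat_iso_arr[OF \<phi> lin] nat_iso_arr[OF \<beta>(1) lin(2,1)]
      have "ar (T g) (\<beta> X) \<star> \<delta>' g X = ar (T g) (\<beta> X) \<star> \<delta>' g X \<star> (\<phi> (ob (T g) X) \<star> \<beta> (ob (T g) X))"
        by (simp add: bspec[OF \<beta>(3) TX] del: after_assoc)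
      also have "\<dots> = ar (T g) (\<beta> X) \<star> (\<delta>' g X \<star> \<phi> (ob (T g) X)) \<star> \<beta> (ob (T g) X)"
        by simp
      also have "\<dots> = ar (T g) (\<beta> X) \<star> (ar (T g) (\<phi> X) \<star> \<delta> g X) \<star> \<beta> (ob (T g) X)"
        by (simp only: tw[OF gX])
      also have "\<dots> = ar (T g) (\<beta> X \<star> \<phi> X) \<star> \<delta> g X \<star> \<beta> (ob (T g) X)"
        by simp
      also have "\<dots> = \<delta> g X \<star> \<beta> (ob (T g) X)"
        by (simp add: bspec[OF \<beta>(2) gX(2)] del: lin_after)
      finally show "ar (T g) (\<beta> X) \<star> \<delta>' g X = \<delta> g X \<star> \<beta> (ob (T g) X)" .
    qed
  qed
  show "trans eq_rel"
  proof (rule transI, clarify)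
    fix F \<delta> F' \<delta>' F'' \<delta>''
    assume "((F, \<delta>), (F', \<delta>')) \<in> eq_rel" "((F', \<delta>'), (F'', \<delta>'')) \<in> eq_rel"
    obtain \<phi> where E: "(F, \<delta>) \<in> EqAut" "(F', \<delta>') \<in> EqAut" and \<phi>: "nat_iso C F F' \<phi>"
      and tw: "\<forall>g \<in> carrier G. \<forall>X \<in> Obj C. ar (T g) (\<phi> X) \<star> \<delta> g X = \<delta>' g X \<star> \<phi> (ob (T g) X)"
      using \<open>((F, \<delta>), (F', \<delta>')) \<in> eq_rel\<close> by (rule eq_relE)
    note tw = tw[rule_format]
    obtain \<psi> where E': "(F'', \<delta>'') \<in> EqAut" and \<psi>: "nat_iso C F' F'' \<psi>"
      and tw': "\<forall>g \<in> carrier G. \<forall>X \<in> Obj C. ar (T g) (\<psi> X) \<star> \<delta>' g X = \<delta>'' g X \<star> \<psi> (ob (T g) X)"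
      using \<open>((F', \<delta>'), (F'', \<delta>'')) \<in> eq_rel\<close> by (rule eq_relE)
    note tw' = tw'[rule_format]
    note lin = EqAutD(2)[OF E(1)] EqAutD(2)[OF E(2)] EqAutD(2)[OF E']
    show "((F, \<delta>), (F'', \<delta>'')) \<in> eq_rel"
    proof (rule eq_relI[OF E(1) E' nat_iso_comp[OF \<phi> \<psi> lin]])
      fix g X assume gX: "g \<in> carrier G" "X \<in> Obj C"
      have TX: "ob (T g) X \<in> Obj C"
        using gX by simp
      note [simp] = gX TX lin after_assoc T_lin[OF gX(1)] comms_arr[OF EqAutD(3)[OF E(1)] lin(1) gX]
        comms_arr[OF EqAutD(3)[OF E(2)] lin(2) gX] comms_arr[OF EqAutD(3)[OF E'] lin(3) gX]
        nat_iso_arr[OF \<phi> lin(1,2)] nat_iso_arr[OF \<psi> lin(2,3)]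
      have "ar (T g) (\<psi> X \<star> \<phi> X) \<star> \<delta> g X = ar (T g) (\<psi> X) \<star> (ar (T g) (\<phi> X) \<star> \<delta> g X)"
        by simp
      also have "\<dots> = (ar (T g) (\<psi> X) \<star> \<delta>' g X) \<star> \<phi> (ob (T g) X)"
        by (simp add: tw[OF gX])
      also have "\<dots> = \<delta>'' g X \<star> \<psi> (ob (T g) X) \<star> \<phi> (ob (T g) X)"
        unfolding tw'[OF gX] by simp
      finally show "ar (T g) ((\<psi> \<circ>\<^bsub>C\<^esub> \<phi>) X) \<star> \<delta> g X = \<delta>'' g X \<star> (\<psi> \<circ>\<^bsub>C\<^esub> \<phi>) (ob (T g) X)"
        by (simp add: nt_comp_def)
    qed
  qed
qed

lemma EqAut_mult:
  assumes "(F, \<delta>) \<in> EqAut" "(F', \<delta>') \<in> EqAut"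
  shows "(F \<bullet> F', comm_mult F \<delta> F' \<delta>') \<in> EqAut"
  using assms comm_mult_comms defect_mult unfolding EqAut_iff by simp

text \<open>
  The horizontal composite of \<open>\<phi>\<close> and \<open>\<psi>\<close> is compatible with the structures: the two compatibility
  squares are glued along naturality squares of \<open>\<delta>\<^sub>g\<close> and of \<open>\<phi>\<close>.
\<close>

lemma eq_rel_mult:
  assumes "((F, \<delta>), (H, \<kappa>)) \<in> eq_rel" "((F', \<delta>'), (H', \<kappa>')) \<in> eq_rel"
  shows "((F \<bullet> F', comm_mult F \<delta> F' \<delta>'), (H \<bullet> H', comm_mult H \<kappa> H' \<kappa>')) \<in> eq_rel"
proof -
  obtain \<phi> where E: "(F, \<delta>) \<in> EqAut" "(H, \<kappa>) \<in> EqAut" and \<phi>: "nat_iso C F H \<phi>"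
    and tw: "\<forall>g \<in> carrier G. \<forall>X \<in> Obj C. ar (T g) (\<phi> X) \<star> \<delta> g X = \<kappa> g X \<star> \<phi> (ob (T g) X)"
    using assms(1) by (rule eq_relE)
    note tw = tw[rule_format]
  obtain \<psi> where E': "(F', \<delta>') \<in> EqAut" "(H', \<kappa>') \<in> EqAut" and \<psi>: "nat_iso C F' H' \<psi>"
    and tw': "\<forall>g \<in> carrier G. \<forall>X \<in> Obj C. ar (T g) (\<psi> X) \<star> \<delta>' g X = \<kappa>' g X \<star> \<psi> (ob (T g) X)"
    using assms(2) by (rule eq_relE)
    note tw' = tw'[rule_format]
  note lin = EqAutD(2)[OF E(1)] EqAutD(2)[OF E(2)] EqAutD(2)[OF E'(1)] EqAutD(2)[OF E'(2)]
  have 1: "nat_iso C (F \<bullet> F') (F \<bullet> H') (F \<rhd> \<psi>)"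
    using nat_iso_whisker_left[OF \<psi>] lin by blast
  have 2: "nat_iso C (F \<bullet> H') (H \<bullet> H') (\<phi> \<lhd>\<^sub>w H')"
    using nat_iso_whisker_right[OF \<phi>] lin by blast
  have iso: "nat_iso C (F \<bullet> F') (H \<bullet> H') ((\<phi> \<lhd>\<^sub>w H') \<circ>\<^bsub>C\<^esub> (F \<rhd> \<psi>))"
    by (rule nat_iso_comp[OF 1 2]) (use lin in auto)
  show ?thesis
  proof (rule eq_relI[OF EqAut_mult[OF E(1) E'(1)] EqAut_mult[OF E(2) E'(2)] iso])
    fix g X assume gX: "g \<in> carrier G" "X \<in> Obj C"
    let ?TX = "ob (T g) X"
    have obs: "?TX \<in> Obj C" "ob F' X \<in> Obj C" "ob H' X \<in> Obj C" "ob H' ?TX \<in> Obj C"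
      using gX lin by simp_all
    note [simp] = gX obs lin after_assoc T_lin[OF gX(1)] comms_arr[OF EqAutD(3)[OF E(1)] lin(1) gX(1)]
      comms_arr[OF EqAutD(3)[OF E(2)] lin(2) gX(1)] comms_arr[OF EqAutD(3)[OF E'(1)] lin(3) gX(1)]
      comms_arr[OF EqAutD(3)[OF E'(2)] lin(4) gX(1)] nat_iso_arr[OF \<phi> lin(1,2)] nat_iso_arr[OF \<psi> lin(3,4)]
    have "ar (T g) (\<phi> (ob H' X) \<star> ar F (\<psi> X)) \<star> \<delta> g (ob F' X) \<star> ar F (\<delta>' g X)
        = ar (T g) (\<phi> (ob H' X)) \<star> (ar (T g) (ar F (\<psi> X)) \<star> \<delta> g (ob F' X)) \<star> ar F (\<delta>' g X)"
      by simp
    also have "ar (T g) (ar F (\<psi> X)) \<star> \<delta> g (ob F' X) = \<delta> g (ob H' X) \<star> ar F (ar (T g) (\<psi> X))"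
      by (rule comms_natural[OF EqAutD(3)[OF E(1)], symmetric]) simp_all
    also have "ar (T g) (\<phi> (ob H' X)) \<star> (\<delta> g (ob H' X) \<star> ar F (ar (T g) (\<psi> X))) \<star> ar F (\<delta>' g X)
        = (ar (T g) (\<phi> (ob H' X)) \<star> \<delta> g (ob H' X)) \<star> ar F (ar (T g) (\<psi> X) \<star> \<delta>' g X)"
      by simp
    also have "\<dots> = (\<kappa> g (ob H' X) \<star> \<phi> (ob (T g) (ob H' X))) \<star> ar F (\<kappa>' g X \<star> \<psi> ?TX)"
      by (simp only: tw[OF gX(1) obs(3)] tw'[OF gX])
    also have "\<dots> = \<kappa> g (ob H' X) \<star> (\<phi> (ob (T g) (ob H' X)) \<star> ar F (\<kappa>' g X)) \<star> ar F (\<psi> ?TX)"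
      by simp
    also have "\<phi> (ob (T g) (ob H' X)) \<star> ar F (\<kappa>' g X) = ar H (\<kappa>' g X) \<star> \<phi> (ob H' ?TX)"
      by (rule nat_iso_natural[OF \<phi>]) simp_all
    finally show "ar (T g) (((\<phi> \<lhd>\<^sub>w H') \<circ>\<^bsub>C\<^esub> (F \<rhd> \<psi>)) X) \<star> comm_mult F \<delta> F' \<delta>' g X
        = comm_mult H \<kappa> H' \<kappa>' g X \<star> ((\<phi> \<lhd>\<^sub>w H') \<circ>\<^bsub>C\<^esub> (F \<rhd> \<psi>)) (ob (T g) X)"
      by (simp add: nt_comp_def whisker_left_def whisker_right_def)
  qed
qed

lemma rescale_comms:
  assumes "\<delta> \<in> comms F" "lin F" "b \<in> carrier G \<rightarrow> Units K"
  shows "(\<lambda>g X. b g \<ast> \<delta> g X) \<in> comms F"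
proof (rule commsI)
  fix g assume "g \<in> carrier G"
  with assms show "nat_iso C (F \<bullet> T g) (T g \<bullet> F) (\<lambda>X. b g \<ast> \<delta> g X)"
    by (intro nat_iso_scale[OF comms_iso[OF assms(1)]]) auto
qed

lemma rescale_intertwines:
  assumes \<delta>: "\<delta> \<in> comms F" and F: "lin F" and b: "b \<in> carrier G \<rightarrow> Units K"
  shows "intertwines (nt_id C F) (\<lambda>g X. b g \<ast> \<delta> g X) b \<delta>"
  unfolding intertwines_def
proof (intro ballI)
  fix g X assume gX: "g \<in> carrier G" "X \<in> Obj C"
  have "b g \<in> carrier K"
    using b gX by auto
  then show "ar (T g) (nt_id C F X) \<star> b g \<ast> \<delta> g X = b g \<ast> (\<delta> g X \<star> nt_id C F (ob (T g) X))"
    using gX F comms_arr[OF \<delta> F gX] by (simp add: nt_id_def)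
qed

abbreviation trivial_comm where
  "trivial_comm \<equiv> \<lambda>g. nt_id C (T g)"

lemma trivial_comm_EqAut: "(id_functor, trivial_comm) \<in> EqAut"
proof -
  have c: "trivial_comm \<in> comms id_functor"
    by (rule commsI) (simp add: nat_iso_id)
  have "defect id_functor trivial_comm g h = \<one>" if gh: "g \<in> carrier G" "h \<in> carrier G" for g h
  proof (rule defect_eqI[OF Auteq_id c gh unit_one])
    fix X assume X: "X \<in> Obj C"
    show "merge_commute id_functor trivial_comm g h X = \<one> \<ast> commute_merge id_functor trivial_comm g h X"
      using X gh by (simp add: merge_commute_at commute_merge_at nt_id_def)
  qed
  then show ?thesis
    using c unfolding EqAut_iff by simp
qed

text \<open>
  The conditions for different \<open>g\<close> are independent, so the isomorphisms can be chosen one by one.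
\<close>

lemma comms_nonempty:
  assumes "\<And>g. g \<in> carrier G \<Longrightarrow> F \<bullet> T g \<doteq> T g \<bullet> F"
  obtains \<delta> where "\<delta> \<in> comms F"
proof -
  have "\<forall>g \<in> carrier G. \<exists>\<alpha>. nat_iso C (F \<bullet> T g) (T g \<bullet> F) \<alpha>"
    using assms unfolding isomorphic_def by blast
  then obtain \<delta> where "\<forall>g \<in> carrier G. nat_iso C (F \<bullet> T g) (T g \<bullet> F) (\<delta> g)"
    by metis
  then show thesis
    using that commsI by blast
qed

lemma comms_isomorphic: "\<lbrakk>\<delta> \<in> comms F; lin F; g \<in> carrier G\<rbrakk> \<Longrightarrow> F \<bullet> T g \<doteq> T g \<bullet> F"
  unfolding isomorphic_def using comms_iso by (meson T_lin lin_fcomp)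

text \<open>
  A quasi-inverse \<open>F'\<close> also commutes with all \<open>F\<^sub>g\<close> up to isomorphism, so some \<open>\<delta>'\<close> exists.  Rescale it
  such that \<open>\<eta> : Id \<rightarrow> F' F\<close> respects the structures on the nose.  The structure on \<open>F' F\<close> is then
  isomorphic to the trivial one, so its defect is \<open>1\<close>; that of \<open>F\<close> is \<open>1\<close> too, and by
  multiplicativity so is that of \<open>F'\<close>.
\<close>

lemma EqAut_left_inverse:
  assumes E: "(F, \<delta>) \<in> EqAut"
  obtains F' \<delta>' where "(F', \<delta>') \<in> EqAut"
    "((F' \<bullet> F, comm_mult F' \<delta>' F \<delta>), (id_functor, trivial_comm)) \<in> eq_rel"
proof -
  note F = EqAutD(1)[OF E] and lin = EqAutD(2)[OF E] and \<delta> = EqAutD(3)[OF E]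
  obtain F' where F': "F' \<in> Auteq" "id_functor \<doteq> F' \<bullet> F" "F \<bullet> F' \<doteq> id_functor"
    by (rule Auteq_inverse[OF F])
  note lin' = Auteq_lin[OF F'(1)]
  have "F' \<bullet> T g \<doteq> T g \<bullet> F'" if g: "g \<in> carrier G" for g
  proof -
    note r = isomorphic_refl[OF lin'] isomorphic_refl[OF T_lin[OF g]]
    have "F' \<bullet> T g \<doteq> F' \<bullet> (T g \<bullet> F) \<bullet> F'"
      using isomorphic_fcomp[OF isomorphic_fcomp[OF r(1,2)] isomorphic_sym[OF F'(3)]] by simp
    also have "\<dots> \<doteq> F' \<bullet> (F \<bullet> T g) \<bullet> F'"
      using isomorphic_fcomp[OF isomorphic_fcomp[OF r(1) isomorphic_sym[OF comms_isomorphic[OF \<delta> lin g]]] r(1)] .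
    also have "\<dots> \<doteq> T g \<bullet> F'"
      using isomorphic_fcomp[OF isomorphic_sym[OF F'(2)] isomorphic_fcomp[OF r(2,1)]] by simp
    finally show ?thesis .
  qed
  then obtain \<delta>' where \<delta>': "\<delta>' \<in> comms F'"
    by (rule comms_nonempty)
  obtain \<eta> where \<eta>: "nat_iso C id_functor (F' \<bullet> F) \<eta>"
    using F'(2) unfolding isomorphic_def by blast
  note FF = Auteq_fcomp[OF F'(1) F]
  note trivial = EqAutD(3)[OF trivial_comm_EqAut]
  obtain b where b: "b \<in> carrier G \<rightarrow> Units K"
    and tw: "intertwines \<eta> trivial_comm b (comm_mult F' \<delta>' F \<delta>)"
    by (rule intertwiner_exists[OF Auteq_id FF trivial comm_mult_comms[OF lin' lin \<delta>' \<delta>] \<eta>])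
  define \<kappa> where "\<kappa> = (\<lambda>g X. b g \<ast> \<delta>' g X)"
  have \<kappa>_at: "\<kappa> g X = b g \<ast> \<delta>' g X" for g X
    by (simp add: \<kappa>_def)
  have \<kappa>: "\<kappa> \<in> comms F'"
    unfolding \<kappa>_def by (rule rescale_comms[OF \<delta>' lin' b])
  have tw': "intertwines \<eta> trivial_comm (\<lambda>g. \<one>) (comm_mult F' \<kappa> F \<delta>)"
    unfolding intertwines_def
  proof (intro ballI)
    fix g X assume gX: "g \<in> carrier G" "X \<in> Obj C"
    have objs: "ob (T g) X \<in> Obj C" "ob F X \<in> Obj C"
      using gX lin by simp_all
    have bg: "b g \<in> carrier K"
      using b gX by auto
    note [simp] = gX objs bg lin lin' T_lin[OF gX(1)] comms_arr[OF \<delta> lin gX] comms_arr[OF \<delta>' lin' gX(1)]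
      nat_iso_arr[OF \<eta> lin_id Auteq_lin[OF FF]]
    have "b g \<ast> (comm_mult F' \<delta>' F \<delta> g X \<star> \<eta> (ob (T g) X)) = \<one> \<ast> (comm_mult F' \<kappa> F \<delta> g X \<star> \<eta> (ob (T g) X))"
      by (simp add: comm_mult_at \<kappa>_at)
    then show "ar (T g) (\<eta> X) \<star> trivial_comm g X = \<one> \<ast> (comm_mult F' \<kappa> F \<delta> g X \<star> \<eta> (ob (T g) X))"
      using intertwinesD[OF tw gX] by simp
  qed
  note mult = comm_mult_comms[OF lin' lin \<kappa> \<delta>]
  have "defect F' \<kappa> g h = \<one>" if gh: "g \<in> carrier G" "h \<in> carrier G" for g h
  proof -
    have "defect (F' \<bullet> F) (comm_mult F' \<kappa> F \<delta>) g h = \<one>"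
      using defect_intertwined[OF Auteq_id FF trivial mult \<eta> _ tw' gh]
        defect(1)[OF FF mult gh] EqAutD(4)[OF trivial_comm_EqAut gh] by simp
    then show ?thesis
      using defect_mult[OF F'(1) F \<kappa> \<delta> gh] defect(1)[OF F'(1) \<kappa> gh] EqAutD(4)[OF E gh] by simp
  qed
  then have E': "(F', \<kappa>) \<in> EqAut"
    using F' \<kappa> unfolding EqAut_iff by simp
  have "((id_functor, trivial_comm), (F' \<bullet> F, comm_mult F' \<kappa> F \<delta>)) \<in> eq_rel"
    unfolding eq_rel_intertwines using trivial_comm_EqAut EqAut_mult[OF E' E] \<eta> tw' by blast
  then show thesis
    using that[OF E'] eq_rel_equiv unfolding equiv_def sym_def by blast
qed

abbreviation AutE where
  "AutE \<equiv> Aut_equivariant K C G T \<epsilon>"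

abbreviation eq_class where
  "eq_class F \<delta> \<equiv> equivariant_class K C G T \<epsilon> (F, \<delta>)"

lemma
  shows AutE_group: "group AutE"
    and AutE_mult: "\<And>F \<delta> F' \<delta>'. \<lbrakk>(F, \<delta>) \<in> EqAut; (F', \<delta>') \<in> EqAut\<rbrakk> \<Longrightarrow>
      eq_class F \<delta> \<otimes>\<^bsub>AutE\<^esub> eq_class F' \<delta>' = eq_class (F \<bullet> F') (comm_mult F \<delta> F' \<delta>')"
proof -
  have closed: "equivariant_mult C p q \<in> EqAut" if "p \<in> EqAut" "q \<in> EqAut" for p q
    using that EqAut_mult by (cases p; cases q) simp
  have cong: "(equivariant_mult C p q, equivariant_mult C p' q') \<in> eq_rel"
    if "(p, p') \<in> eq_rel" "(q, q') \<in> eq_rel" for p p' q q'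
    using that eq_rel_mult by (cases p; cases q; cases p'; cases q') simp
  have assoc: "(equivariant_mult C (equivariant_mult C p q) r, equivariant_mult C p (equivariant_mult C q r)) \<in> eq_rel"
    if pqr: "p \<in> EqAut" "q \<in> EqAut" "r \<in> EqAut" for p q r
  proof -
    obtain F \<delta> F' \<delta>' F'' \<delta>'' where p: "p = (F, \<delta>)" "q = (F', \<delta>')" "r = (F'', \<delta>'')"
      by (metis surj_pair)
    note E = pqr[unfolded p]
    note lin = E[THEN EqAutD(2)] and c = E[THEN EqAutD(3)]
    have "((F \<bullet> F' \<bullet> F'', comm_mult (F \<bullet> F') (comm_mult F \<delta> F' \<delta>') F'' \<delta>''),
        (F \<bullet> F' \<bullet> F'', comm_mult F \<delta> (F' \<bullet> F'') (comm_mult F' \<delta>' F'' \<delta>''))) \<in> eq_rel"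
    proof (rule eq_rel_same_functor)
      show "(F \<bullet> F' \<bullet> F'', comm_mult (F \<bullet> F') (comm_mult F \<delta> F' \<delta>') F'' \<delta>'') \<in> EqAut"
        by (intro EqAut_mult E)
      show "(F \<bullet> F' \<bullet> F'', comm_mult F \<delta> (F' \<bullet> F'') (comm_mult F' \<delta>' F'' \<delta>'')) \<in> EqAut"
        using EqAut_mult[OF E(1) EqAut_mult[OF E(2,3)]] by simp
      fix g X assume gX: "g \<in> carrier G" "X \<in> Obj C"
      show "comm_mult (F \<bullet> F') (comm_mult F \<delta> F' \<delta>') F'' \<delta>'' g X
          = comm_mult F \<delta> (F' \<bullet> F'') (comm_mult F' \<delta>' F'' \<delta>'') g X"
        using gX lin comms_arr[OF c(1) lin(1) gX(1)] comms_arr[OF c(2) lin(2) gX(1)]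
          comms_arr[OF c(3) lin(3) gX(1)]
        by (simp add: nt_comp_def whisker_left_def whisker_right_def after_assoc)
    qed
    then show ?thesis
      by (simp add: p)
  qed
  have unit: "(equivariant_mult C (id_functor, trivial_comm) p, p) \<in> eq_rel" if E: "p \<in> EqAut" for p
  proof -
    obtain F \<delta> where p: "p = (F, \<delta>)"
      by (metis surj_pair)
    note E = E[unfolded p]
    have "((F, comm_mult id_functor trivial_comm F \<delta>), (F, \<delta>)) \<in> eq_rel"
    proof (rule eq_rel_same_functor[OF _ E])
      show "(F, comm_mult id_functor trivial_comm F \<delta>) \<in> EqAut"
        using EqAut_mult[OF trivial_comm_EqAut E] by simp
      fix g X assume gX: "g \<in> carrier G" "X \<in> Obj C"
      show "comm_mult id_functor trivial_comm F \<delta> g X = \<delta> g X"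
        using gX comms_arr[OF EqAutD(3,2)[OF E] gX] EqAutD(2)[OF E] by (simp add: nt_comp_def whisker_left_def whisker_right_def nt_id_def)
    qed
    then show ?thesis
      by (simp add: p)
  qed
  have inverse: "\<exists>q \<in> EqAut. (equivariant_mult C q p, (id_functor, trivial_comm)) \<in> eq_rel" if E: "p \<in> EqAut" for p
  proof -
    obtain F \<delta> where p: "p = (F, \<delta>)"
      by (metis surj_pair)
    obtain F' \<delta>' where "(F', \<delta>') \<in> EqAut"
        "((F' \<bullet> F, comm_mult F' \<delta>' F \<delta>), (id_functor, trivial_comm)) \<in> eq_rel"
      by (rule EqAut_left_inverse[OF E[unfolded p]])
    then show ?thesis
      by (intro bexI[of _ "(F', \<delta>')"]) (simp_all add: p)
  qed
  note q = quotient_group[OF eq_rel_equiv trivial_comm_EqAut closed cong assoc unit inverse,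
      folded equivariant_class_def]
  show "group AutE"
    unfolding Aut_equivariant_def by (rule q(1))
  show "eq_class F \<delta> \<otimes>\<^bsub>AutE\<^esub> eq_class F' \<delta>' = eq_class (F \<bullet> F') (comm_mult F \<delta> F' \<delta>')"
    if "(F, \<delta>) \<in> EqAut" "(F', \<delta>') \<in> EqAut" for F \<delta> F' \<delta>'
  proof -
    have "eq_class F \<delta> \<otimes>\<^bsub>AutE\<^esub> eq_class F' \<delta>'
        = equivariant_class K C G T \<epsilon> (equivariant_mult C (F, \<delta>) (F', \<delta>'))"
      unfolding Aut_equivariant_def by (rule q(2)) (use that in auto)
    then show ?thesis
      by simp
  qed
qed

lemma AutE_carrier: "A \<in> carrier AutE \<longleftrightarrow> (\<exists>F \<delta>. (F, \<delta>) \<in> EqAut \<and> A = eq_class F \<delta>)"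
  by (auto simp: Aut_equivariant_def quotient_def equivariant_class_def)

lemma AutE_one: "\<one>\<^bsub>AutE\<^esub> = eq_class id_functor trivial_comm"
  by (simp add: Aut_equivariant_def)

lemma eq_class_eq_iff:
  "\<lbrakk>(F, \<delta>) \<in> EqAut; (F', \<delta>') \<in> EqAut\<rbrakk> \<Longrightarrow>
    eq_class F \<delta> = eq_class F' \<delta>' \<longleftrightarrow> ((F, \<delta>), (F', \<delta>')) \<in> eq_rel"
  unfolding equivariant_class_def using eq_equiv_class_iff[OF eq_rel_equiv] by simp

end


section \<open>Exactness\<close>

context scalar_action
begin

sublocale coefficients: trivial_coefficients K G
  by (intro trivial_coefficients.intro cring_axioms group_axioms)

abbreviation Aut0 where
  "Aut0 \<equiv> AutG K C G T"

abbreviation cls where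
  "cls F \<equiv> iso_class K C F"

lemma AutG_carrier:
  "A \<in> carrier Aut0 \<longleftrightarrow> (\<exists>F \<in> Auteq. A = cls F \<and> comms F \<noteq> {})"
proof -
  have "(\<forall>g \<in> carrier G. cls (F \<bullet> T g) = cls (T g \<bullet> F)) \<longleftrightarrow> comms F \<noteq> {}" if F: "F \<in> Auteq" for F
  proof -
    have "(\<forall>g \<in> carrier G. cls (F \<bullet> T g) = cls (T g \<bullet> F)) \<longleftrightarrow> (\<forall>g \<in> carrier G. F \<bullet> T g \<doteq> T g \<bullet> F)"
      using F by (simp add: iso_class_eq_iff)
    also have "\<dots> \<longleftrightarrow> comms F \<noteq> {}"
    proof
      assume comm: "\<forall>g \<in> carrier G. F \<bullet> T g \<doteq> T g \<bullet> F"
      obtain \<delta> where "\<delta> \<in> comms F"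
        by (rule comms_nonempty[OF bspec[OF comm]])
      then show "comms F \<noteq> {}"
        by blast
    next
      assume "comms F \<noteq> {}"
      then show "\<forall>g \<in> carrier G. F \<bullet> T g \<doteq> T g \<bullet> F"
        using comms_isomorphic[OF _ Auteq_lin[OF F]] by blast
    qed
    finally show ?thesis .
  qed
  moreover have "A \<in> carrier Aut0 \<longleftrightarrow>
      (\<exists>F \<in> Auteq. A = cls F \<and> (\<forall>g \<in> carrier G. cls (F \<bullet> T g) = cls (T g \<bullet> F)))"
    unfolding AutG_def by auto
  ultimately show ?thesis
    by (simp cong: bex_cong)
qed

lemma AutG_simps:
  "A \<otimes>\<^bsub>Aut0\<^esub> B = A \<otimes>\<^bsub>Aut K C\<^esub> B" "\<one>\<^bsub>Aut0\<^esub> = cls id_functor"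
  by (simp_all add: AutG_def Aut_one)

text \<open>
  In \<open>Aut(C)\<close> this is the centralizer of the classes \<open>[F\<^sub>g]\<close>.
\<close>

lemma AutG_group: "group Aut0"
proof -
  interpret A: group "Aut K C"
    by (rule Aut_group)
  define t where "t g = cls (T g)" for g
  have t: "t g \<in> carrier (Aut K C)" if "g \<in> carrier G" for g
    using that unfolding t_def Aut_carrier by auto
  let ?Z = "{A \<in> carrier (Aut K C). \<forall>g \<in> carrier G. A \<otimes>\<^bsub>Aut K C\<^esub> t g = t g \<otimes>\<^bsub>Aut K C\<^esub> A}"
  have carrier: "carrier Aut0 = ?Z"
    unfolding AutG_def by (auto simp: Aut_carrier Aut_mult t_def)
  have "subgroup ?Z (Aut K C)"
  proof (rule A.subgroupI)
    have "\<one>\<^bsub>Aut K C\<^esub> \<in> ?Z"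
      using t by simp
    then show "?Z \<noteq> {}"
      by blast
  next
    fix A assume A: "A \<in> ?Z"
    have "inv\<^bsub>Aut K C\<^esub> A \<otimes>\<^bsub>Aut K C\<^esub> t g = t g \<otimes>\<^bsub>Aut K C\<^esub> inv\<^bsub>Aut K C\<^esub> A" if g: "g \<in> carrier G" for g
    proof -
      have "t g = inv\<^bsub>Aut K C\<^esub> A \<otimes>\<^bsub>Aut K C\<^esub> (t g \<otimes>\<^bsub>Aut K C\<^esub> A)"
        using A t[OF g] g by (simp add: A.inv_solve_left)
      also have "\<dots> = (inv\<^bsub>Aut K C\<^esub> A \<otimes>\<^bsub>Aut K C\<^esub> t g) \<otimes>\<^bsub>Aut K C\<^esub> A"
        using A t[OF g] by (simp add: A.m_assoc)
      finally show ?thesis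
        using A t[OF g] by (simp add: A.inv_solve_right)
    qed
    then show "inv\<^bsub>Aut K C\<^esub> A \<in> ?Z"
      using A by simp
  next
    fix A B assume AB: "A \<in> ?Z" "B \<in> ?Z"
    have "(A \<otimes>\<^bsub>Aut K C\<^esub> B) \<otimes>\<^bsub>Aut K C\<^esub> t g = t g \<otimes>\<^bsub>Aut K C\<^esub> (A \<otimes>\<^bsub>Aut K C\<^esub> B)" if g: "g \<in> carrier G" for g
    proof -
      have "(A \<otimes>\<^bsub>Aut K C\<^esub> B) \<otimes>\<^bsub>Aut K C\<^esub> t g = A \<otimes>\<^bsub>Aut K C\<^esub> (t g \<otimes>\<^bsub>Aut K C\<^esub> B)"
        using AB t[OF g] g by (simp add: A.m_assoc)
      also have "\<dots> = (t g \<otimes>\<^bsub>Aut K C\<^esub> A) \<otimes>\<^bsub>Aut K C\<^esub> B"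
        using AB t[OF g] g by (simp flip: A.m_assoc)
      finally show ?thesis
        using AB t[OF g] by (simp add: A.m_assoc)
    qed
    then show "A \<otimes>\<^bsub>Aut K C\<^esub> B \<in> ?Z"
      using AB by simp
  qed auto
  then have "group ((Aut K C)\<lparr>carrier := ?Z\<rparr>)"
    by (rule A.subgroup_imp_group)
  then show ?thesis
    unfolding carrier[symmetric] by (simp add: AutG_def)
qed

text \<open>
  The structure on the identity functor attached to a character.
\<close>

abbreviation char_comm where
  "char_comm \<chi> \<equiv> \<lambda>g. nt_smult C (T g) (T g) (\<chi> g) (nt_id C (T g))"

lemma char_comm_at:
  "\<lbrakk>g \<in> carrier G; X \<in> Obj C\<rbrakk> \<Longrightarrow> char_comm \<chi> g X = \<chi> g \<ast> Ident C (ob (T g) X)"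
  by (simp add: nt_smult_def scale_def nt_id_def)

lemma nat_iso_cong:
  assumes "nat_iso C F F' \<alpha>" "\<And>X. X \<in> Obj C \<Longrightarrow> \<beta> X = \<alpha> X"
  shows "nat_iso C F F' \<beta>"
  using assms unfolding nat_iso_def nat_trans_def by simp

lemma char_comm_comms:
  assumes "\<chi> \<in> carrier G \<rightarrow> Units K"
  shows "char_comm \<chi> \<in> comms id_functor"
proof (rule commsI)
  fix g assume g: "g \<in> carrier G"
  have "nat_iso C (T g) (T g) (\<lambda>X. \<chi> g \<ast> nt_id C (T g) X)"
    using assms g by (intro nat_iso_scale nat_iso_id) auto
  then have "nat_iso C (T g) (T g) (char_comm \<chi> g)"
    by (rule nat_iso_cong) (use g in \<open>simp_all add: nt_smult_def scale_def nt_id_def\<close>)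
  then show "nat_iso C (id_functor \<bullet> T g) (T g \<bullet> id_functor) (char_comm \<chi> g)"
    by simp
qed

text \<open>
  The identity intertwines \<open>char_comm \<chi>\<close> and the trivial structure with factor \<open>\<chi>\<close>, so the defect is
  the coboundary of \<open>\<chi>\<close> up to inversion, which is trivial.
\<close>

lemma char_comm_EqAut:
  assumes "\<chi> \<in> carrier (character_group G K)"
  shows "(id_functor, char_comm \<chi>) \<in> EqAut"
proof -
  note \<chi> = assms[unfolded coefficients.character_group_iff]
  have \<chi>U: "\<chi> g \<in> Units K" if "g \<in> carrier G" for g
    using \<chi> that by auto
  have c: "char_comm \<chi> \<in> comms id_functor"
    using \<chi> char_comm_comms by blast
  note triv = EqAutD[OF trivial_comm_EqAut]
  have tw: "intertwines (nt_id C id_functor) (char_comm \<chi>) \<chi> trivial_comm"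
    unfolding intertwines_def
    by (intro ballI) (simp only: char_comm_at, simp add: nt_id_def \<chi>U)
  have "defect id_functor (char_comm \<chi>) g h = \<one>" if gh: "g \<in> carrier G" "h \<in> carrier G" for g h
  proof -
    have "defect id_functor (char_comm \<chi>) g h \<otimes> \<chi> (g \<odot>\<^sub>G h) = \<chi> (g \<odot>\<^sub>G h)"
      using defect_intertwined[OF Auteq_id Auteq_id c triv(3) nat_iso_id[OF lin_id] _ tw gh]
        \<chi> \<chi>U triv(4) gh by simp
    then show ?thesis
      using defect(1)[OF Auteq_id c gh] \<chi>U[OF gmult_closed[OF gh]]
      by - (rule unit_cancel[of "\<chi> (g \<odot>\<^sub>G h)"], simp_all)
  qed
  then show ?thesis
    using c unfolding EqAut_iff by simp
qed

lemma rho_hom: "group_hom (character_group G K) AutE (rho K C G T \<epsilon>)"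
proof (rule group_hom.intro)
  show "group (character_group G K)"
    by (rule coefficients.character_group)
  show "group AutE"
    by (rule AutE_group)
  show "group_hom_axioms (character_group G K) AutE (rho K C G T \<epsilon>)"
  proof (rule group_hom_axioms.intro, rule homI)
    fix \<chi> assume "\<chi> \<in> carrier (character_group G K)"
    then show "rho K C G T \<epsilon> \<chi> \<in> carrier AutE"
      unfolding rho_def AutE_carrier using char_comm_EqAut by blast
  next
    fix \<chi> \<psi> assume \<chi>: "\<chi> \<in> carrier (character_group G K)" and \<psi>: "\<psi> \<in> carrier (character_group G K)"
    let ?\<omega> = "\<chi> \<otimes>\<^bsub>character_group G K\<^esub> \<psi>"
    have \<omega>: "?\<omega> \<in> carrier (character_group G K)"
      using \<chi> \<psi> monoid.m_closed[OF group.is_monoid[OF coefficients.character_group]] by blast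
    have U: "\<chi> g \<in> Units K" "\<psi> g \<in> Units K" "?\<omega> g = \<chi> g \<otimes> \<psi> g" if "g \<in> carrier G" for g
      using \<chi> \<psi> that unfolding coefficients.character_group_iff
        coefficients.character_mult by auto
    note E = char_comm_EqAut[OF \<chi>] char_comm_EqAut[OF \<psi>]
    have "((id_functor, char_comm ?\<omega>), (id_functor, comm_mult id_functor (char_comm \<chi>) id_functor (char_comm \<psi>))) \<in> eq_rel"
    proof (rule eq_rel_same_functor[OF char_comm_EqAut[OF \<omega>]])
      show "(id_functor, comm_mult id_functor (char_comm \<chi>) id_functor (char_comm \<psi>)) \<in> EqAut"
        using EqAut_mult[OF E] by simp
      fix g X assume gX: "g \<in> carrier G" "X \<in> Obj C"
      have "char_comm \<chi> g X \<star> char_comm \<psi> g X = (\<chi> g \<otimes> \<psi> g) \<ast> Ident C (ob (T g) X)"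
        unfolding char_comm_at[OF gX] using gX U by (simp add: m_comm)
      also have "\<dots> = char_comm ?\<omega> g X"
        unfolding char_comm_at[OF gX] using gX U by simp
      finally show "char_comm ?\<omega> g X = comm_mult id_functor (char_comm \<chi>) id_functor (char_comm \<psi>) g X"
        by (simp add: nt_comp_def whisker_left_def whisker_right_def)
    qed
    then show "rho K C G T \<epsilon> ?\<omega> = rho K C G T \<epsilon> \<chi> \<otimes>\<^bsub>AutE\<^esub> rho K C G T \<epsilon> \<psi>"
      unfolding rho_def AutE_mult[OF E]
      using eq_class_eq_iff[OF char_comm_EqAut[OF \<omega>] EqAut_mult[OF E]] by simp
  qed
qed

text \<open>
  An isomorphism from \<open>(Id, \<chi>)\<close> to \<open>(Id, 1)\<close> is a scalar \<open>d\<close>, and compatibility at \<open>g\<close> reads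
  \<open>d \<chi>(g) = d\<close>.
\<close>

lemma rho_kernel: "kernel (character_group G K) AutE (rho K C G T \<epsilon>) = {\<one>\<^bsub>character_group G K\<^esub>}"
proof
  interpret \<rho>: group_hom "character_group G K" AutE "rho K C G T \<epsilon>"
    by (rule rho_hom)
  show "{\<one>\<^bsub>character_group G K\<^esub>} \<subseteq> kernel (character_group G K) AutE (rho K C G T \<epsilon>)"
    using \<rho>.hom_one \<rho>.G.one_closed by (simp add: kernel_def)
  show "kernel (character_group G K) AutE (rho K C G T \<epsilon>) \<subseteq> {\<one>\<^bsub>character_group G K\<^esub>}"
  proof
    fix \<chi> assume "\<chi> \<in> kernel (character_group G K) AutE (rho K C G T \<epsilon>)"
    then have \<chi>: "\<chi> \<in> carrier (character_group G K)" and "eq_class id_functor (char_comm \<chi>) = eq_class id_functor trivial_comm"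
      by (auto simp: kernel_def rho_def AutE_one)
    then have "((id_functor, char_comm \<chi>), (id_functor, trivial_comm)) \<in> eq_rel"
      using eq_class_eq_iff[OF char_comm_EqAut[OF \<chi>] trivial_comm_EqAut] by blast
    then obtain \<phi> where \<phi>: "nat_iso C id_functor id_functor \<phi>"
      and tw: "\<forall>g \<in> carrier G. \<forall>X \<in> Obj C. ar (T g) (\<phi> X) \<star> char_comm \<chi> g X = trivial_comm g X \<star> \<phi> (ob (T g) X)"
      by (rule eq_relE)
    obtain d where d: "d \<in> Units K" "\<And>X. X \<in> Obj C \<Longrightarrow> \<phi> X = d \<ast> nt_id C id_functor X"
      by (rule nat_iso_proportional[OF Auteq_id lin_id \<phi> nat_iso_id[OF lin_id]]) blast
    have U: "\<chi> g \<in> Units K" if "g \<in> carrier G" for g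
      using \<chi> that unfolding coefficients.character_group_iff by auto
    have one: "\<chi> g = \<one>" if g: "g \<in> carrier G" for g
    proof -
      have "d \<otimes> \<chi> g = d"
      proof (rule scale_unique[OF T_Auteq[OF g] T_lin[OF g] nat_iso_id[OF T_lin[OF g]]])
        fix X assume X: "X \<in> Obj C"
        have TX: "ob (T g) X \<in> Obj C"
          using X g by simp
        have "ar (T g) (d \<ast> Ident C X) \<star> char_comm \<chi> g X = trivial_comm g X \<star> d \<ast> Ident C (ob (T g) X)"
          using tw[rule_format, OF g X] d(2)[OF X] d(2)[OF TX] by (simp add: nt_id_def)
        then show "(d \<otimes> \<chi> g) \<ast> nt_id C (T g) X = d \<ast> nt_id C (T g) X"
          unfolding char_comm_at[OF g X] using X g TX d(1) U[OF g] by (simp add: nt_id_def m_comm)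
      qed (use d U g in auto)
      then show ?thesis
        using d(1) U[OF g] by - (rule unit_cancel[of d], simp_all add: m_comm)
    qed
    have "\<chi> = \<one>\<^bsub>character_group G K\<^esub>"
      unfolding coefficients.character_one
    proof (rule extensionalityI[of _ "carrier G"])
      show "\<chi> \<in> extensional (carrier G)"
        using \<chi> unfolding coefficients.character_group_iff by blast
    qed (simp_all add: one)
    then show "\<chi> \<in> {\<one>\<^bsub>character_group G K\<^esub>}"
      by simp
  qed
qed

lemma forget_class:
  assumes E: "(F, \<delta>) \<in> EqAut"
  shows "forget K C (eq_class F \<delta>) = cls F"
proof -
  have "cls F' = cls F" if "(F', \<delta>') \<in> eq_class F \<delta>" for F' \<delta>'
  proof -
    have "((F, \<delta>), (F', \<delta>')) \<in> eq_rel"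
      using that by (simp add: equivariant_class_def)
    then obtain \<phi> where "(F', \<delta>') \<in> EqAut" "nat_iso C F F' \<phi>"
      by (rule eq_relE)
    then have "F \<doteq> F'" "F' \<in> Auteq"
      unfolding isomorphic_def using EqAutD(2)[OF E] EqAutD(1,2)[of F' \<delta>'] by auto
    then show ?thesis
      using iso_class_eq_iff[OF EqAutD(1)[OF E]] by blast
  qed
  moreover have "(F, \<delta>) \<in> eq_class F \<delta>"
    unfolding equivariant_class_def by (rule equiv_class_self[OF eq_rel_equiv E])
  ultimately show ?thesis
    unfolding forget_def by blast
qed

lemma forget_hom: "group_hom AutE Aut0 (forget K C)"
proof (rule group_hom.intro[OF AutE_group AutG_group], rule group_hom_axioms.intro, rule homI)
  show "forget K C A \<in> carrier Aut0" if "A \<in> carrier AutE" for A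
    using that forget_class EqAutD unfolding AutE_carrier AutG_carrier by fastforce
  show "forget K C (A \<otimes>\<^bsub>AutE\<^esub> B) = forget K C A \<otimes>\<^bsub>Aut0\<^esub> forget K C B"
    if mem: "A \<in> carrier AutE" "B \<in> carrier AutE" for A B
  proof -
    obtain F \<delta> F' \<delta>' where E: "(F, \<delta>) \<in> EqAut" "(F', \<delta>') \<in> EqAut"
      and AB: "A = eq_class F \<delta>" "B = eq_class F' \<delta>'"
      using mem unfolding AutE_carrier by blast
    show ?thesis
      unfolding AB AutE_mult[OF E] forget_class[OF EqAut_mult[OF E]] forget_class[OF E(1)]
        forget_class[OF E(2)] AutG_simps
      using Aut_mult[OF E[THEN EqAutD(1)]] by simp
  qed
qed

text \<open>
  If \<open>\<phi> : F \<rightarrow> Id\<close>, then \<open>\<phi>\<close> intertwines \<open>\<delta>\<close> and the trivial structure with some factor \<open>b\<close>.  Both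
  defects are \<open>1\<close>, so \<open>b\<close> is multiplicative, and \<open>\<phi>\<close> becomes an isomorphism from \<open>(F, \<delta>)\<close> to the
  identity with the structure of the character \<open>b\<close>.
\<close>

lemma forget_kernel:
  "kernel AutE Aut0 (forget K C) = rho K C G T \<epsilon> ` carrier (character_group G K)"
proof
  show "rho K C G T \<epsilon> ` carrier (character_group G K) \<subseteq> kernel AutE Aut0 (forget K C)"
    unfolding kernel_def rho_def using char_comm_EqAut forget_class
    by (auto simp: AutE_carrier AutG_simps)
  show "kernel AutE Aut0 (forget K C) \<subseteq> rho K C G T \<epsilon> ` carrier (character_group G K)"
  proof
    fix A assume "A \<in> kernel AutE Aut0 (forget K C)"
    then obtain F \<delta> where E: "(F, \<delta>) \<in> EqAut" and A: "A = eq_class F \<delta>" and "cls F = cls id_functor"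
      unfolding kernel_def AutE_carrier AutG_simps using forget_class by auto
    note F = EqAutD(1)[OF E] and \<delta> = EqAutD(3)[OF E]
    have "F \<doteq> id_functor"
      using \<open>cls F = cls id_functor\<close> iso_class_eq_iff[OF F Auteq_id] by simp
    then obtain \<phi> where \<phi>: "nat_iso C F id_functor \<phi>"
      unfolding isomorphic_def by blast
    note triv = EqAutD[OF trivial_comm_EqAut]
    obtain b where b: "b \<in> carrier G \<rightarrow> Units K" and tw: "intertwines \<phi> \<delta> b trivial_comm"
      by (rule intertwiner_exists[OF F Auteq_id \<delta> triv(3) \<phi>])
    have bU: "b g \<in> Units K" if "g \<in> carrier G" for g
      using b that by auto
    have b_mult: "b (g \<odot>\<^sub>G h) = b g \<otimes> b h" if gh: "g \<in> carrier G" "h \<in> carrier G" for g h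
      using defect_intertwined[OF F Auteq_id \<delta> triv(3) \<phi> b tw gh] EqAutD(4)[OF E gh] triv(4)[OF gh]
        bU gh by simp
    define \<chi> where "\<chi> = restrict b (carrier G)"
    have \<chi>: "\<chi> \<in> carrier (character_group G K)"
      unfolding coefficients.character_group_iff
      using bU b_mult by (auto simp: \<chi>_def)
    note arr = nat_iso_arr[OF \<phi> Auteq_lin[OF F] lin_id]
    have "((F, \<delta>), (id_functor, char_comm \<chi>)) \<in> eq_rel"
    proof (rule eq_relI[OF E char_comm_EqAut[OF \<chi>] \<phi>])
      fix g X assume gX: "g \<in> carrier G" "X \<in> Obj C"
      have "ob (T g) X \<in> Obj C"
        using gX by simp
      then show "ar (T g) (\<phi> X) \<star> \<delta> g X = char_comm \<chi> g X \<star> \<phi> (ob (T g) X)"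
        unfolding intertwinesD[OF tw gX] char_comm_at[OF gX]
        using gX bU arr by (simp add: \<chi>_def nt_id_def)
    qed
    then have "A = rho K C G T \<epsilon> \<chi>"
      unfolding A rho_def using eq_class_eq_iff[OF E char_comm_EqAut[OF \<chi>]] by simp
    then show "A \<in> rho K C G T \<epsilon> ` carrier (character_group G K)"
      using \<chi> by blast
  qed
qed

abbreviation defect_class where
  "defect_class F \<delta> \<equiv> cohomology_class G K (obstruction_cocycle K C G T \<epsilon> F \<delta>)"

lemma obstruction_cocycle_mem:
  assumes F: "F \<in> Auteq" and \<delta>: "\<delta> \<in> comms F"
  shows "obstruction_cocycle K C G T \<epsilon> F \<delta> \<in> carrier (cocycles2 G K)"
proof -
  have "obstruction_cocycle K C G T \<epsilon> F \<delta> \<in> extensional (carrier G \<times> carrier G)"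
    by (simp add: obstruction_cocycle_def)
  then show ?thesis
    unfolding coefficients.cocycles2_iff
    using defect(1)[OF F \<delta>] defect_cocycle[OF F \<delta>] by (auto simp: PiE_def)
qed

text \<open>
  Independence of the representative and of the choice of \<open>\<delta>\<close> at once: any two choices are related by
  an intertwiner, hence have cohomologous defects.
\<close>

lemma obstruction_eq:
  assumes F: "F \<in> Auteq" and \<delta>: "\<delta> \<in> comms F"
  shows "obstruction K C G T \<epsilon> (cls F) = defect_class F \<delta>"
proof -
  have "defect_class F \<delta> = defect_class F' \<delta>'" if F': "F' \<in> cls F" and \<delta>': "\<delta>' \<in> comms F'" for F' \<delta>'
  proof -
    have F'A: "F' \<in> Auteq" and "F \<doteq> F'"
      using F' unfolding iso_class_def by (simp_all add: functor_iso_rel_iff)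
    then obtain \<phi> where \<phi>: "nat_iso C F F' \<phi>"
      unfolding isomorphic_def by blast
    obtain b where b: "b \<in> carrier G \<rightarrow> Units K" and tw: "intertwines \<phi> \<delta> b \<delta>'"
      by (rule intertwiner_exists[OF F F'A \<delta> \<delta>' \<phi>])
    show ?thesis
      by (rule coefficients.cohomology_class_eqI[OF obstruction_cocycle_mem[OF F \<delta>] obstruction_cocycle_mem[OF F'A \<delta>'] b])
        (rule defect_intertwined[OF F F'A \<delta> \<delta>' \<phi> b tw])
  qed
  moreover have "F \<in> cls F"
    unfolding iso_class_def by (rule equiv_class_self[OF functor_iso_rel_equiv F])
  ultimately show ?thesis
    unfolding obstruction_def using \<delta> by blast
qed

lemma obstruction_hom: "group_hom Aut0 (H2 G K) (obstruction K C G T \<epsilon>)"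
proof (rule group_hom.intro[OF AutG_group coefficients.H2_group],
    rule group_hom_axioms.intro, rule homI)
  show "obstruction K C G T \<epsilon> A \<in> carrier (H2 G K)" if "A \<in> carrier Aut0" for A
  proof -
    obtain F \<delta> where "F \<in> Auteq" "A = cls F" "\<delta> \<in> comms F"
      using \<open>A \<in> carrier Aut0\<close> unfolding AutG_carrier by blast
    then show ?thesis
      using obstruction_eq coefficients.H2_carrier[OF obstruction_cocycle_mem]
      by simp
  qed
  show "obstruction K C G T \<epsilon> (A \<otimes>\<^bsub>Aut0\<^esub> B) = obstruction K C G T \<epsilon> A \<otimes>\<^bsub>H2 G K\<^esub> obstruction K C G T \<epsilon> B"
    if AB: "A \<in> carrier Aut0" "B \<in> carrier Aut0" for A B
  proof -
    obtain F \<delta> where F: "F \<in> Auteq" "A = cls F" and \<delta>: "\<delta> \<in> comms F"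
      using AB(1) unfolding AutG_carrier by blast
    obtain F' \<delta>' where F': "F' \<in> Auteq" "B = cls F'" and \<delta>': "\<delta>' \<in> comms F'"
      using AB(2) unfolding AutG_carrier by blast
    note FF = Auteq_fcomp[OF F(1) F'(1)]
    note \<delta>\<delta> = comm_mult_comms[OF Auteq_lin[OF F(1)] Auteq_lin[OF F'(1)] \<delta> \<delta>']
    have "obstruction_cocycle K C G T \<epsilon> (F \<bullet> F') (comm_mult F \<delta> F' \<delta>')
        = obstruction_cocycle K C G T \<epsilon> F \<delta> \<otimes>\<^bsub>cocycles2 G K\<^esub> obstruction_cocycle K C G T \<epsilon> F' \<delta>'"
      unfolding coefficients.cocycles2_mult
    proof (rule extensionalityI[of _ "carrier G \<times> carrier G"])
      fix x assume "x \<in> carrier G \<times> carrier G"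
      then show "obstruction_cocycle K C G T \<epsilon> (F \<bullet> F') (comm_mult F \<delta> F' \<delta>') x
          = (\<lambda>x \<in> carrier G \<times> carrier G. obstruction_cocycle K C G T \<epsilon> F \<delta> x \<otimes> obstruction_cocycle K C G T \<epsilon> F' \<delta>' x) x"
        using defect_mult[OF F(1) F'(1) \<delta> \<delta>'] by auto
    qed (simp_all add: obstruction_cocycle_def)
    then have "defect_class (F \<bullet> F') (comm_mult F \<delta> F' \<delta>') = defect_class F \<delta> \<otimes>\<^bsub>H2 G K\<^esub> defect_class F' \<delta>'"
      using coefficients.H2_mult[OF obstruction_cocycle_mem[OF F(1) \<delta>]
          obstruction_cocycle_mem[OF F'(1) \<delta>']] by simp
    then show ?thesis
      unfolding F(2) F'(2) AutG_simps Aut_mult[OF F(1) F'(1)] obstruction_eq[OF F(1) \<delta>]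
        obstruction_eq[OF F'(1) \<delta>'] obstruction_eq[OF FF \<delta>\<delta>] .
  qed
qed

text \<open>
  If the defect of \<open>\<delta>\<close> is the coboundary of \<open>b\<close>, then rescaling \<open>\<delta>\<close> by \<open>b\<close> makes it \<open>1\<close>.
\<close>

lemma obstruction_kernel:
  "kernel Aut0 (H2 G K) (obstruction K C G T \<epsilon>) = forget K C ` carrier AutE"
proof
  have trivial: "obstruction K C G T \<epsilon> (cls F) = \<one>\<^bsub>H2 G K\<^esub> \<longleftrightarrow>
      obstruction_cocycle K C G T \<epsilon> F \<delta> \<in> coboundaries2 G K" if "F \<in> Auteq" "\<delta> \<in> comms F" for F \<delta>
    using obstruction_eq[OF that] obstruction_cocycle_mem[OF that]
      coefficients.cohomology_class_trivial_iff by simp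
  show "forget K C ` carrier AutE \<subseteq> kernel Aut0 (H2 G K) (obstruction K C G T \<epsilon>)"
  proof
    fix A assume "A \<in> forget K C ` carrier AutE"
    then obtain F \<delta> where E: "(F, \<delta>) \<in> EqAut" and A: "A = cls F"
      using forget_class by (auto simp: AutE_carrier)
    note F = EqAutD(1)[OF E] and \<delta> = EqAutD(3)[OF E]
    have "obstruction_cocycle K C G T \<epsilon> F \<delta> = \<one>\<^bsub>cocycles2 G K\<^esub>"
    proof (rule extensionalityI[of _ "carrier G \<times> carrier G"])
      fix x assume "x \<in> carrier G \<times> carrier G"
      then show "obstruction_cocycle K C G T \<epsilon> F \<delta> x = \<one>\<^bsub>cocycles2 G K\<^esub> x"
        using EqAutD(4)[OF E]
        by (auto simp: cocycles2_def coefficients.cochains2_simps)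
    qed (simp_all add: obstruction_cocycle_def cocycles2_def
        coefficients.cochains2_simps)
    then have "obstruction_cocycle K C G T \<epsilon> F \<delta> \<in> coboundaries2 G K"
      using subgroup.one_closed[OF coefficients.coboundaries2_subgroup] by simp
    then show "A \<in> kernel Aut0 (H2 G K) (obstruction K C G T \<epsilon>)"
      using trivial[OF F \<delta>] F \<delta> unfolding kernel_def A AutG_carrier by blast
  qed
  show "kernel Aut0 (H2 G K) (obstruction K C G T \<epsilon>) \<subseteq> forget K C ` carrier AutE"
  proof
    fix A assume A: "A \<in> kernel Aut0 (H2 G K) (obstruction K C G T \<epsilon>)"
    then obtain F \<delta> where F: "F \<in> Auteq" and A_eq: "A = cls F" and \<delta>: "\<delta> \<in> comms F"
      unfolding kernel_def AutG_carrier by blast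
    note lin = Auteq_lin[OF F]
    have "obstruction_cocycle K C G T \<epsilon> F \<delta> \<in> coboundaries2 G K"
      using A trivial[OF F \<delta>] unfolding kernel_def A_eq by blast
    then obtain b where b: "b \<in> carrier G \<rightarrow> Units K"
      and cb: "obstruction_cocycle K C G T \<epsilon> F \<delta> = coefficients.coboundary b"
      unfolding coefficients.coboundaries2_eq by blast
    have bU: "b g \<in> Units K" "b g \<in> carrier K" "inv b g \<in> carrier K" if "g \<in> carrier G" for g
    proof -
      show U: "b g \<in> Units K"
        using b that by auto
      then show "b g \<in> carrier K" "inv b g \<in> carrier K"
        by (simp_all add: monoid.Units_inv_closed[OF ring.is_monoid[OF ring_axioms]])
    qed
    define \<kappa> where "\<kappa> = (\<lambda>g X. b g \<ast> \<delta> g X)"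
    have \<kappa>: "\<kappa> \<in> comms F"
      unfolding \<kappa>_def by (rule rescale_comms[OF \<delta> lin b])
    have tw: "intertwines (nt_id C F) \<kappa> b \<delta>"
      unfolding \<kappa>_def by (rule rescale_intertwines[OF \<delta> lin b])
    have "defect F \<kappa> g h = \<one>" if gh: "g \<in> carrier G" "h \<in> carrier G" for g h
    proof -
      let ?gh = "g \<odot>\<^sub>G h"
      have "defect F \<kappa> g h \<otimes> (b g \<otimes> b h) = b ?gh \<otimes> defect F \<delta> g h"
        by (rule defect_intertwined[OF F F \<kappa> \<delta> nat_iso_id[OF lin] b tw gh])
      also have "\<dots> = b ?gh \<otimes> (b g \<otimes> b h \<otimes> inv b ?gh)"
        unfolding cb coefficients.coboundary_at[OF gh] ..
      also have "\<dots> = (inv b ?gh \<otimes> b ?gh) \<otimes> (b g \<otimes> b h)"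
        using bU gh by (simp add: m_ac del: Units_l_inv Units_r_inv)
      also have "inv b ?gh \<otimes> b ?gh = \<one>"
        by (rule monoid.Units_l_inv[OF ring.is_monoid[OF ring_axioms] bU(1)[OF gmult_closed[OF gh]]])
      finally show ?thesis
        using bU gh defect(1)[OF F \<kappa> gh] by - (rule unit_cancel[of "b g \<otimes> b h"], simp_all)
    qed
    then have "(F, \<kappa>) \<in> EqAut"
      using F \<kappa> unfolding EqAut_iff by blast
    then show "A \<in> forget K C ` carrier AutE"
      unfolding A_eq using forget_class AutE_carrier by (metis image_eqI)
  qed
qed

end

theorem proposition9p3:
  fixes K :: "('k, 'r) ring_scheme"
    and C :: "('k, 'o, 'm) lincat"
    and G :: "('g, 's) monoid_scheme"
    and T :: "'g \<Rightarrow> ('o, 'm) endofunctor"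
    and \<epsilon> :: "'g \<Rightarrow> 'g \<Rightarrow> 'o \<Rightarrow> 'm"
  assumes "field K"
    and "linear_category K C"
    and "center_is_scalars K C"
    and "group G"
    and "linear_group_action K C G T \<epsilon>"
  shows "group_hom (character_group G K) (Aut_equivariant K C G T \<epsilon>) (rho K C G T \<epsilon>) \<and>
    group_hom (Aut_equivariant K C G T \<epsilon>) (AutG K C G T) (forget K C) \<and>
    group_hom (AutG K C G T) (H2 G K) (obstruction K C G T \<epsilon>) \<and>
    kernel (character_group G K) (Aut_equivariant K C G T \<epsilon>) (rho K C G T \<epsilon>)
      = {\<one>\<^bsub>character_group G K\<^esub>} \<and>
    kernel (Aut_equivariant K C G T \<epsilon>) (AutG K C G T) (forget K C)
      = rho K C G T \<epsilon> ` carrier (character_group G K) \<and>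
    kernel (AutG K C G T) (H2 G K) (obstruction K C G T \<epsilon>)
      = forget K C ` carrier (Aut_equivariant K C G T \<epsilon>)"
proof -
  interpret scalar_action K C G T \<epsilon>
    using assms by (intro scalar_action.intro scalar_center.intro scalar_center_axioms.intro)
  show ?thesis
    using rho_hom forget_hom obstruction_hom rho_kernel forget_kernel obstruction_kernel by blast
qed

end
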